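(* Let $k>0$, $k\neq 1$, and let $\Omega$ be a simply connected bounded Lipschitz domain in $\mathbb{R}^2$. Let $a\in\mathbb{R}^2$, $a\neq 0$, and let $u$ be the solution of $$\nabla\cdot\big(1+(k-1)\chi(\Omega)\big)\nabla u=0\ \text{ in }\mathbb{R}^2,\qquad u(x)-a\cdot x=O(|x|^{-1})\ \text{ as }|x|\to\infty,$$ where $\chi(\Omega)$ is the indicator function of $\Omega$. If, for this single vector $a$, $u$ is linear in $\Omega$, then $\Omega$ is an ellipse.
   Context: The equation is understood in the weak sense with $u\in H^1_{loc}(\mathbb{R}^2)$. "Linear in $\Omega$" means $u(x)=b\cdot x+c$ for $x\in\Omega$, for some constant vector $b$ and constant $c$. An ellipse means the solid open region (disks included), with arbitrary center and axes. *)

theory Defs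
  imports "HOL-Analysis.Analysis" "HOL-Library.Landau_Symbols"
begin

definition gradient :: "('a::euclidean_space \<Rightarrow> real) \<Rightarrow> 'a \<Rightarrow> 'a" where
  "gradient f x = (\<Sum>b\<in>Basis. frechet_derivative f (at x) b *\<^sub>R b)"

primrec Ck :: "nat \<Rightarrow> ('a::euclidean_space \<Rightarrow> real) \<Rightarrow> bool" where
  "Ck 0 f \<longleftrightarrow> continuous_on UNIV f"
| "Ck (Suc n) f \<longleftrightarrow>
     (\<forall>x. f differentiable (at x)) \<and>
     (\<forall>b\<in>Basis. Ck n (\<lambda>x. frechet_derivative f (at x) b))"

definition test_function :: "('a::euclidean_space \<Rightarrow> real) \<Rightarrow> bool" where
  "test_function \<phi> \<longleftrightarrow> (\<forall>n. Ck n \<phi>) \<and> compact (closure {x. \<phi> x \<noteq> 0})"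

definition L2_loc :: "('a::euclidean_space \<Rightarrow> 'b::euclidean_space) \<Rightarrow> bool" where
  "L2_loc f \<longleftrightarrow>
     f \<in> borel_measurable lebesgue \<and>
     (\<forall>K. compact K \<longrightarrow> set_integrable lebesgue K (\<lambda>x. (norm (f x))\<^sup>2))"

text \<open>\<open>u\<close> is (a representative of) an element of the local Sobolev space $H^1_{loc}$ of the whole
  space, with distributional gradient \<open>G\<close>.\<close>

definition H1_loc_with_gradient :: "('a::euclidean_space \<Rightarrow> real) \<Rightarrow> ('a \<Rightarrow> 'a) \<Rightarrow> bool" where
  "H1_loc_with_gradient u G \<longleftrightarrow>
     L2_loc u \<and> L2_loc G \<and>
     (\<forall>\<phi>. test_function \<phi> \<longrightarrow>
        (LINT x|lebesgue. u x *\<^sub>R gradient \<phi> x) = - (LINT x|lebesgue. \<phi> x *\<^sub>R G x))"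

text \<open>Weak solutions in $H^1_{loc}$ of $\nabla\cdot(\sigma\nabla u) = 0$ in the whole space, for a
  bounded measurable coefficient \<open>\<sigma>\<close>. The weak gradient is unique up to null sets, so it does not
  matter which one is chosen.\<close>

definition weak_solution :: "('a::euclidean_space \<Rightarrow> real) \<Rightarrow> ('a \<Rightarrow> real) \<Rightarrow> bool" where
  "weak_solution \<sigma> u \<longleftrightarrow>
     (\<exists>G. H1_loc_with_gradient u G \<and>
        (\<forall>\<phi>. test_function \<phi> \<longrightarrow> (LINT x|lebesgue. \<sigma> x * (G x \<bullet> gradient \<phi> x)) = 0))"

text \<open>Elements of $H^1_{loc}$ are classes of functions modulo null sets, so the pointwise
  conditions on \<open>u\<close> below are invariant under changing \<open>u\<close> on a null set.\<close>

definition far_field :: "'a::euclidean_space \<Rightarrow> ('a \<Rightarrow> real) \<Rightarrow> bool" where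
  "far_field a u \<longleftrightarrow>
     (\<exists>v. (AE x in lebesgue. u x = v x) \<and>
          (\<lambda>x. v x - a \<bullet> x) \<in> O[at_infinity](\<lambda>x. 1 / norm x))"

definition linear_in :: "'a::euclidean_space set \<Rightarrow> ('a \<Rightarrow> real) \<Rightarrow> bool" where
  "linear_in \<Omega> u \<longleftrightarrow> (\<exists>b c. AE x in lebesgue. x \<in> \<Omega> \<longrightarrow> u x = b \<bullet> x + c)"

text \<open>Near each boundary point \<open>p\<close>, in some orthonormal frame \<open>(t, n)\<close> based at \<open>p\<close>, the domain is
  the part of a ball lying above the graph of a Lipschitz function \<open>g\<close>.\<close>

definition bounded_lipschitz_domain :: "(real^2) set \<Rightarrow> bool" where
  "bounded_lipschitz_domain \<Omega> \<longleftrightarrow>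
     \<Omega> \<noteq> {} \<and> open \<Omega> \<and> connected \<Omega> \<and> bounded \<Omega> \<and>
     (\<forall>p\<in>frontier \<Omega>. \<exists>t n r L g.
        norm t = 1 \<and> norm n = 1 \<and> t \<bullet> n = 0 \<and> r > 0 \<and>
        L-lipschitz_on UNIV (g :: real \<Rightarrow> real) \<and>
        (\<forall>x\<in>ball p r. x \<in> \<Omega> \<longleftrightarrow> (x - p) \<bullet> n > g ((x - p) \<bullet> t)))"

text \<open>Open solid ellipse with centre \<open>z\<close>, axis directions \<open>e\<close>, \<open>f\<close> and semi-axes \<open>\<alpha>\<close>, \<open>\<beta>\<close>.\<close>

definition is_ellipse :: "(real^2) set \<Rightarrow> bool" where
  "is_ellipse E \<longleftrightarrow>
     (\<exists>z e f \<alpha> \<beta>. norm e = 1 \<and> norm f = 1 \<and> e \<bullet> f = 0 \<and> \<alpha> > 0 \<and> \<beta> > 0 \<and>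
        E = {x. (((x - z) \<bullet> e) / \<alpha>)\<^sup>2 + (((x - z) \<bullet> f) / \<beta>)\<^sup>2 < 1})"

end

theory Submission
  imports Defs "HOL-Complex_Analysis.Complex_Analysis" "HOL-Real_Asymp.Real_Asymp"
begin

text \<open>
  Let \<open>u = b \<bullet> x + c\<close> in \<open>\<Omega>\<close>. The weak gradient of \<open>u\<close> is \<open>b\<close> there, so the equation reads
  \<open>\<Delta>u = - (k - 1) b \<bullet> \<nabla>\<chi>\<close> in the sense of distributions, with \<open>\<chi>\<close> the indicator function of \<open>\<Omega>\<close>.
  Tested with truncated logarithms centred at points of \<open>\<Omega>\<close>, this shows that \<open>Re (\<beta> C)\<close> is
  affine in \<open>\<Omega>\<close>, where \<open>\<beta>\<close> is the vector \<open>b\<close> as a complex number and \<open>\<pi> C\<close> is the Cauchy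
  transform of \<open>\<Omega>\<close>. Since \<open>C - cnj z\<close> is holomorphic in \<open>\<Omega>\<close>, already this one real relation
  gives \<open>C = cnj z + p z + q\<close> in \<open>\<Omega>\<close>; this is why a single vector \<open>a\<close> suffices.

  Now \<open>C\<close> is continuous, holomorphic outside \<open>\<Omega>\<close>, and \<open>O(1 / norm z)\<close> at infinity. On the
  frontier \<open>C * cnj C\<close> coincides with \<open>C * (z + cnj p * (C - p z - q) + cnj q)\<close>, which is
  holomorphic and bounded outside. Its boundary values are real, so it is constant by the maximum
  principle, and the frontier of \<open>\<Omega>\<close> lies on \<open>(norm (cnj z + p z + q))^2 = \<gamma>\<close>. A bounded open set
  with such a frontier is an ellipse. Simple connectedness and the Lipschitz condition enter only
  to make the exterior connected and the frontier of \<open>\<Omega>\<close> equal to that of the exterior.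
\<close>

section \<open>Smooth test functions\<close>

text \<open>Nothing is used of \<open>u\<close> beyond \<open>H1_loc\<close> and the a.e.
  conditions, so there are no jump relations and no boundary integrals: every use of the equation is
  an integral against a test function. A logarithm is not a test function. It is regularised to
  \<open>ln (s + \<epsilon>\<^sup>2)\<close>, with \<open>s\<close> the squared distance to its
  centre, and cut off at radius \<open>R\<close>. As \<open>R\<close> grows, the cutoff leaves an
  error of order ln R / R^2 on a disc of radius \<open>R\<close>, where
  \<open>u - a \<bullet> x\<close>, being O(1 / norm x), has mass O(R); so the decay condition makes
  the error disappear. As \<epsilon> tends to 0, the Laplacian of the regularised logarithm
  concentrates at the centre, near which \<open>u\<close> is affine, so the limit can be computed
  directly.

  The relation is empty if \<open>b = 0\<close>. In that case it would say that
  \<open>a \<bullet> x\<close> is constant in \<Omega>, which \<open>a \<noteq> 0\<close> forbids.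
  The coefficient \<open>p\<close> is not determined by the argument; the degenerate case
  \<open>norm p = 1\<close>, where the quadric consists of parallel lines, is excluded because
  \<Omega> is bounded.\<close>

lemma Ck_Suc_imp_Ck: "Ck (Suc n) f \<Longrightarrow> Ck n f"
proof (induction n arbitrary: f)
  case 0
  then show ?case
    by (auto intro!: continuous_at_imp_continuous_on differentiable_imp_continuous_within)
qed auto

lemma Ck_SucI:
  assumes "\<And>x. (f has_derivative f' x) (at x)" "\<And>b. b \<in> Basis \<Longrightarrow> Ck n (\<lambda>x. f' x b)"
  shows "Ck (Suc n) f"
proof -
  have "frechet_derivative f (at x) = f' x" for x
    using frechet_derivative_at[OF assms(1)] by simp
  then show ?thesis
    using assms by (auto simp: differentiable_def)
qed

lemma Ck_SucD:
  assumes "Ck (Suc n) f"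
  shows "(f has_derivative frechet_derivative f (at x)) (at x)"
    and "b \<in> Basis \<Longrightarrow> Ck n (\<lambda>x. frechet_derivative f (at x) b)"
  using assms frechet_derivative_works by auto

lemma Ck_const: "Ck n (\<lambda>x. c)"
proof (induction n arbitrary: c)
  case (Suc n)
  show ?case by (rule Ck_SucI[where f' = "\<lambda>x h. 0"]) (use Suc in auto)
qed auto

lemma Ck_add:
  assumes "Ck n f" "Ck n g"
  shows "Ck n (\<lambda>x. f x + g x)"
  using assms
proof (induction n arbitrary: f g)
  case (Suc n)
  show ?case
    by (rule Ck_SucI, rule has_derivative_add[OF Ck_SucD(1)[OF Suc.prems(1)] Ck_SucD(1)[OF Suc.prems(2)]])
      (use Suc in auto)
qed (auto intro: continuous_on_add)

lemma Ck_mult: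
  assumes "Ck n f" "Ck n g"
  shows "Ck n (\<lambda>x. f x * g x)"
  using assms
proof (induction n arbitrary: f g)
  case (Suc n)
  show ?case
    by (rule Ck_SucI, rule has_derivative_mult[OF Ck_SucD(1)[OF Suc.prems(1)] Ck_SucD(1)[OF Suc.prems(2)]])
      (intro Ck_add Suc.IH Ck_SucD(2) Suc.prems Ck_Suc_imp_Ck)
qed (auto intro: continuous_on_mult)

lemma Ck_sum:
  assumes "\<And>i. i \<in> I \<Longrightarrow> Ck n (f i)"
  shows "Ck n (\<lambda>x. \<Sum>i\<in>I. f i x)"
  using assms by (induction I rule: infinite_finite_induct) (simp_all add: Ck_const Ck_add)

lemma Ck_prod:
  assumes "\<And>i. i \<in> I \<Longrightarrow> Ck n (f i)"
  shows "Ck n (\<lambda>x. \<Prod>i\<in>I. f i x)"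
  using assms by (induction I rule: infinite_finite_induct) (simp_all add: Ck_const Ck_mult)

lemma Ck_inner: "Ck n (\<lambda>x. v \<bullet> x)"
proof (cases n)
  case (Suc m)
  show ?thesis unfolding Suc
    by (rule Ck_SucI[where f' = "\<lambda>x h. v \<bullet> h"])
      (auto intro!: derivative_eq_intros simp: Ck_const)
qed (auto intro!: continuous_intros)

lemma Ck_diff:
  assumes "Ck n f" "Ck n g"
  shows "Ck n (\<lambda>x. f x - g x)"
  using Ck_add[OF assms(1) Ck_mult[OF Ck_const[of n "-1"] assms(2)]] by simp

lemma Ck_norm_power2: "Ck n (\<lambda>x. (norm (x - z))\<^sup>2)"
proof -
  have "(norm (x - z))\<^sup>2 = (\<Sum>b\<in>Basis. (b \<bullet> x - b \<bullet> z) * (b \<bullet> x - b \<bullet> z))" for x :: 'a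
    unfolding power2_norm_eq_inner euclidean_inner[of "x - z" "x - z"]
    by (simp add: inner_commute inner_diff_right)
  then show ?thesis
    by (simp only:) (intro Ck_sum Ck_mult Ck_diff Ck_inner Ck_const)
qed

text \<open>A whole sequence \<open>F\<close>, each member the derivative of the one before, is
  carried along so that the induction on \<open>n\<close> can be uniform in \<open>i\<close>. It is
  applied to the derivatives of a bump function and of a logarithm.\<close>

lemma Ck_chain:
  assumes F: "\<And>i s. s \<in> S \<Longrightarrow> (F i has_real_derivative F (Suc i) s) (at s)"
    and g: "Ck n g" "range g \<subseteq> S"
  shows "Ck n (\<lambda>x. F i (g x))"
  using g(1)
proof (induction n arbitrary: i)
  case 0
  have "continuous_on S (F i)"
    using F by (meson DERIV_isCont continuous_at_imp_continuous_on)
  then show ?case using 0 g(2) by (auto intro: continuous_on_compose2)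
next
  case (Suc n)
  have "((\<lambda>x. F i (g x)) has_derivative (\<lambda>h. F (Suc i) (g x) * frechet_derivative g (at x) h)) (at x)" for x
    using has_derivative_compose[OF Ck_SucD(1)[OF Suc.prems, of x], of "F i" "(*) (F (Suc i) (g x))"]
      F[of "g x" i] g(2)
    by (auto simp: has_field_derivative_def)
  then show ?case
    by (rule Ck_SucI) (intro Ck_mult Suc.IH Ck_SucD(2) Suc.prems Ck_Suc_imp_Ck)
qed

text \<open>The polynomial factor makes this class of functions closed under differentiation, which
  \<open>exp (- (1 / t))\<close> alone is not.\<close>

definition flat :: "real poly \<Rightarrow> real \<Rightarrow> real" where
  "flat p t = (if t > 0 then poly p (1 / t) * exp (- (1 / t)) else 0)"

lemma tendsto_poly_exp_minus_at_top:
  "((\<lambda>x::real. poly p x * exp (- x)) \<longlongrightarrow> 0) at_top"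
proof -
  have "((\<lambda>x. \<Sum>i\<le>degree p. coeff p i * (x ^ i / exp x)) \<longlongrightarrow> (\<Sum>i\<le>degree p. coeff p i * 0)) at_top"
    by (intro tendsto_intros tendsto_power_div_exp_0)
  then show ?thesis
    by (simp add: poly_altdef sum_distrib_right exp_minus divide_inverse mult.assoc)
qed

lemma tendsto_flat_0: "(flat p \<longlongrightarrow> 0) (at 0)"
proof -
  have "((\<lambda>t. poly p (1 / t) * exp (- (1 / t))) \<longlongrightarrow> 0) (at_right 0)"
    using filterlim_compose[OF tendsto_poly_exp_minus_at_top[of p] filterlim_inverse_at_top_right]
    by (simp add: inverse_eq_divide)
  moreover have "\<forall>\<^sub>F t in at_right 0. poly p (1 / t) * exp (- (1 / t)) = flat p t"
    by (auto simp: flat_def eventually_at_right_field intro: exI[of _ 1])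
  ultimately have "(flat p \<longlongrightarrow> 0) (at_right 0)"
    using tendsto_cong by force
  moreover have "(flat p \<longlongrightarrow> 0) (at_left 0)"
    by (rule tendsto_eventually) (auto simp: flat_def eventually_at_left_field intro: exI[of _ "-1"])
  ultimately show ?thesis
    by (simp add: filterlim_split_at)
qed

text \<open>With \<open>s = 1 / t\<close>, the derivative of \<open>p(s) exp(-s)\<close> with
  respect to \<open>t\<close> is \<open>s^2 (p - p')(s) exp(-s)\<close>, and
  \<open>[:0, 0, 1:]\<close> is the polynomial \<open>s^2\<close>.\<close>

lemma flat_has_real_derivative:
  "(flat p has_real_derivative flat ([:0, 0, 1:] * (p - pderiv p)) t) (at t)"
proof -
  consider "t > 0" | "t < 0" | "t = 0" by linarith
  then show ?thesis
  proof cases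
    case 1
    have inv: "((\<lambda>t. 1 / t) has_real_derivative - (1 / t\<^sup>2)) (at t)"
      using 1 by (auto intro!: derivative_eq_intros simp: power2_eq_square)
    have "((\<lambda>t. poly p (1 / t) * exp (- (1 / t))) has_real_derivative
        poly (pderiv p) (1 / t) * - (1 / t\<^sup>2) * exp (- (1 / t))
        + exp (- (1 / t)) * - (- (1 / t\<^sup>2)) * poly p (1 / t)) (at t)"
      by (intro DERIV_mult DERIV_chain2[OF poly_DERIV] DERIV_chain2[OF DERIV_exp] DERIV_minus inv)
    moreover have "poly (pderiv p) (1 / t) * - (1 / t\<^sup>2) * exp (- (1 / t))
        + exp (- (1 / t)) * - (- (1 / t\<^sup>2)) * poly p (1 / t) = flat ([:0, 0, 1:] * (p - pderiv p)) t"
      using 1 by (simp add: flat_def algebra_simps power2_eq_square)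
    ultimately have "((\<lambda>t. poly p (1 / t) * exp (- (1 / t))) has_real_derivative
        flat ([:0, 0, 1:] * (p - pderiv p)) t) (at t)"
      by metis
    then show ?thesis
      by (rule has_field_derivative_transform_within_open[of _ _ _ "{0<..}"])
        (use 1 in \<open>auto simp: flat_def\<close>)
  next
    case 2
    have "((\<lambda>t. 0) has_real_derivative flat ([:0, 0, 1:] * (p - pderiv p)) t) (at t)"
      using 2 by (auto simp: flat_def)
    then show ?thesis
      by (rule has_field_derivative_transform_within_open[of _ _ _ "{..<0}"])
        (use 2 in \<open>auto simp: flat_def\<close>)
  next
    case 3
    \<comment> \<open>Division by \<open>h\<close> multiplies the polynomial by \<open>s\<close>, so
      the difference quotient at 0 is again a flat function and tends to 0.\<close>
    have "(\<lambda>h. (flat p h - flat p 0) / (h - 0)) = flat ([:0, 1:] * p)"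
      by (auto simp: flat_def fun_eq_iff)
    then show ?thesis
      using 3 tendsto_flat_0[of "[:0, 1:] * p"]
      by (simp add: has_field_derivative_iff flat_def)
  qed
qed

text \<open>This is the \<open>i\<close>-th derivative of \<open>exp (- (1 / t))\<close> continued
  by 0, a sequence of the form that \<open>Ck_chain\<close> expects.\<close>

definition bump :: "nat \<Rightarrow> real \<Rightarrow> real" where
  "bump i = flat (((\<lambda>p. [:0, 0, 1:] * (p - pderiv p)) ^^ i) [:1:])"

lemma bump_has_real_derivative: "(bump i has_real_derivative bump (Suc i) t) (at t)"
  unfolding bump_def by (simp only: funpow.simps comp_apply flat_has_real_derivative)

lemma bump_0: "bump 0 t = (if t > 0 then exp (- (1 / t)) else 0)"
  by (simp add: bump_def flat_def)

lemma bump_nonpos [simp]: "t \<le> 0 \<Longrightarrow> bump i t = 0"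
  by (simp add: bump_def flat_def)

lemma continuous_on_bump: "continuous_on S (bump i)"
  by (meson DERIV_isCont bump_has_real_derivative continuous_at_imp_continuous_on)

text \<open>In the truncated logarithms the argument is \<open>1 - s / R\<^sup>2\<close> with
  \<open>s \<ge> 0\<close>, hence at most 1. On negative arguments \<open>bump i\<close> vanishes,
  so compactness of the unit interval is enough.\<close>

lemma bump_bounded:
  obtains K where "K > 0" "\<And>t. t \<le> 1 \<Longrightarrow> \<bar>bump i t\<bar> \<le> K"
proof -
  have "bounded (bump i ` {0..1})"
    by (intro compact_imp_bounded compact_continuous_image continuous_on_bump) auto
  then obtain K where K: "K > 0" "\<And>t. t \<in> {0..1} \<Longrightarrow> \<bar>bump i t\<bar> \<le> K"
    by (auto simp: bounded_pos)
  have "\<bar>bump i t\<bar> \<le> K" if "t \<le> 1" for t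
    using K that by (cases "t \<ge> 0") auto
  with K(1) show ?thesis using that by blast
qed

section \<open>Test functions: supports, partial derivatives, products\<close>

lemma test_functionI:
  assumes "\<And>n. Ck n \<phi>" "compact K" "\<And>x. x \<notin> K \<Longrightarrow> \<phi> x = 0"
  shows "test_function \<phi>"
proof -
  have "closure {x. \<phi> x \<noteq> 0} \<subseteq> K"
    by (rule closure_minimal) (use assms in \<open>auto intro: compact_imp_closed\<close>)
  then have "compact (closure {x. \<phi> x \<noteq> 0})"
    using assms(2) by (metis bounded_subset closed_closure compact_eq_bounded_closed)
  with assms(1) show ?thesis by (simp add: test_function_def)
qed

lemma test_function_support:
  assumes "test_function \<phi>"
  obtains K where "compact K" "\<And>x. x \<notin> K \<Longrightarrow> \<phi> x = 0"
proof (rule that)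
  show "compact (closure {x. \<phi> x \<noteq> 0})"
    using assms unfolding test_function_def by (elim conjE)
  show "\<phi> x = 0" if "x \<notin> closure {x. \<phi> x \<noteq> 0}" for x
    using that closure_subset[of "{x. \<phi> x \<noteq> 0}"] by auto
qed

lemma frechet_derivative_zero_outside:
  assumes "closed K" "\<And>x. x \<notin> K \<Longrightarrow> \<phi> x = 0" "x \<notin> K"
  shows "frechet_derivative \<phi> (at x) = (\<lambda>h. 0)"
proof -
  have "(\<phi> has_derivative (\<lambda>h. 0)) (at x)"
    by (rule has_derivative_transform_within_open[of "\<lambda>x. 0" _ _ _ "- K"]) (use assms in auto)
  from frechet_derivative_at[OF this] show ?thesis by simp
qed

lemma test_function_partial:
  assumes "test_function \<phi>" "b \<in> Basis"
  shows "test_function (\<lambda>x. frechet_derivative \<phi> (at x) b)"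
proof -
  obtain K where K: "compact K" "\<And>x. x \<notin> K \<Longrightarrow> \<phi> x = 0"
    using test_function_support[OF assms(1)] by blast
  show ?thesis
  proof (rule test_functionI[OF _ K(1)])
    have "Ck (Suc n) \<phi>" for n
      using assms(1) unfolding test_function_def by (elim conjE allE)
    from Ck_SucD(2)[OF this assms(2)] show "Ck n (\<lambda>x. frechet_derivative \<phi> (at x) b)" for n .
    show "frechet_derivative \<phi> (at x) b = 0" if "x \<notin> K" for x
      using frechet_derivative_zero_outside[OF compact_imp_closed[OF K(1)] K(2) that] by simp
  qed
qed

lemma test_function_mult:
  assumes "test_function \<phi>" "\<And>n. Ck n f"
  shows "test_function (\<lambda>x. f x * \<phi> x)"
proof -
  obtain K where K: "compact K" "\<And>x. x \<notin> K \<Longrightarrow> \<phi> x = 0"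
    using test_function_support[OF assms(1)] by blast
  show ?thesis
  proof (rule test_functionI[OF _ K(1)])
    have "Ck n \<phi>" for n
      using assms(1) unfolding test_function_def by (elim conjE allE)
    from Ck_mult[OF assms(2) this] show "Ck n (\<lambda>x. f x * \<phi> x)" for n .
  qed (simp add: K(2))
qed

lemma gradient_inner_Basis:
  "b \<in> Basis \<Longrightarrow> gradient f x \<bullet> b = frechet_derivative f (at x) b"
  by (simp add: gradient_def inner_sum_left_Basis)

lemma gradient_eqI:
  assumes "(f has_derivative (\<lambda>h. v \<bullet> h)) (at x)"
  shows "gradient f x = v"
  using frechet_derivative_at[OF assms, symmetric] by (simp add: gradient_def euclidean_representation)

section \<open>Local square integrability and products with bounded functions\<close>

lemma continuous_imp_lebesgue_measurable:
  "continuous_on UNIV f \<Longrightarrow> f \<in> borel_measurable lebesgue"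
  by (intro measurable_completion) (simp add: borel_measurable_continuous_onI)

lemma bounded_of_compact_support:
  fixes f :: "'a::topological_space \<Rightarrow> real"
  assumes "continuous_on UNIV f" "compact K" "\<And>x. x \<notin> K \<Longrightarrow> f x = 0"
  obtains M where "M > 0" "\<And>x. \<bar>f x\<bar> \<le> M"
proof -
  have "bounded (f ` K)"
    using assms by (meson compact_continuous_image compact_imp_bounded continuous_on_subset top_greatest)
  then obtain M where M: "M > 0" "\<And>x. x \<in> K \<Longrightarrow> \<bar>f x\<bar> \<le> M"
    by (auto simp: bounded_pos)
  have "\<bar>f x\<bar> \<le> M" for x
    using M assms(3)[of x] by (cases "x \<in> K") auto
  with M(1) show ?thesis using that by blast
qed

lemma integrable_indicator_compact:
  "compact K \<Longrightarrow> integrable lebesgue (indicator K :: 'a::euclidean_space \<Rightarrow> real)"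
  using lmeasurable_compact[of K] by (auto simp: fmeasurable_def)

lemma L2_loc_integrable:
  fixes f :: "'a::euclidean_space \<Rightarrow> 'b::euclidean_space"
  assumes f: "L2_loc f" and K: "compact K"
  shows "integrable lebesgue (\<lambda>x. indicator K x *\<^sub>R f x)"
proof (rule Bochner_Integration.integrable_bound)
  have [measurable]: "f \<in> borel_measurable lebesgue" and "K \<in> sets lebesgue"
    using f K by (auto simp: L2_loc_def lmeasurable_compact fmeasurableD)
  then show "(\<lambda>x. indicator K x *\<^sub>R f x) \<in> borel_measurable lebesgue"
    by measurable
  show "integrable lebesgue (\<lambda>x. indicator K x + indicator K x * (norm (f x))\<^sup>2)"
    using f K integrable_indicator_compact[OF K]
    by (intro Bochner_Integration.integrable_add) (auto simp: L2_loc_def set_integrable_def)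
  \<comment> \<open>This bound turns square integrability on a compact set into
    integrability.\<close>
  have "y \<le> 1 + y\<^sup>2" for y :: real
    using zero_le_power2[of "y - 1"] zero_le_power2[of y]
    unfolding power2_eq_square left_diff_distrib right_diff_distrib by linarith
  then show "AE x in lebesgue. norm (indicator K x *\<^sub>R f x) \<le> norm (indicator K x + indicator K x * (norm (f x))\<^sup>2)"
    by (auto simp: indicator_def)
qed

lemma L2_loc_integrable_mult:
  fixes f :: "'a::euclidean_space \<Rightarrow> 'b::euclidean_space"
  assumes f: "L2_loc f" and g: "g \<in> borel_measurable lebesgue" "\<And>x. \<bar>g x\<bar> \<le> M"
    and K: "compact K" "\<And>x. x \<notin> K \<Longrightarrow> g x = 0"
  shows "integrable lebesgue (\<lambda>x. g x *\<^sub>R f x)"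
proof (rule Bochner_Integration.integrable_bound)
  show "integrable lebesgue (\<lambda>x. M *\<^sub>R (indicator K x *\<^sub>R f x))"
    by (intro integrable_scaleR_right L2_loc_integrable f K)
  show "(\<lambda>x. g x *\<^sub>R f x) \<in> borel_measurable lebesgue"
    using f g(1) by (auto simp: L2_loc_def)
  have "norm (g x *\<^sub>R f x) \<le> norm (M *\<^sub>R (indicator K x *\<^sub>R f x))" for x
    using K(2)[of x] g(2)[of x] by (cases "x \<in> K") (auto intro!: mult_right_mono)
  then show "AE x in lebesgue. norm (g x *\<^sub>R f x) \<le> norm (M *\<^sub>R (indicator K x *\<^sub>R f x))"
    by simp
qed

lemma L2_loc_continuous:
  fixes f :: "'a::euclidean_space \<Rightarrow> real"
  assumes "continuous_on UNIV f"
  shows "L2_loc f"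
  unfolding L2_loc_def
proof (intro conjI allI impI)
  show "f \<in> borel_measurable lebesgue"
    using assms by (rule continuous_imp_lebesgue_measurable)
  fix K :: "'a set"
  assume K: "compact K"
  show "set_integrable lebesgue K (\<lambda>x. (norm (f x))\<^sup>2)"
  proof -
    have *: "(\<lambda>x. indicator K x *\<^sub>R (norm (f x))\<^sup>2) \<in> borel_measurable borel"
    proof -
      have [measurable]: "f \<in> borel_measurable borel" "K \<in> sets borel"
        using K assms by (auto intro: borel_measurable_continuous_onI dest: compact_imp_closed)
      show ?thesis by measurable
    qed
    have "continuous_on K (\<lambda>x. (norm (f x))\<^sup>2)"
      by (intro continuous_intros continuous_on_subset[OF assms]) auto
    from borel_integrable_compact[OF K this] show ?thesis
      unfolding set_integrable_def by (subst integrable_completion) (use * in \<open>auto simp: indicator_def if_distrib\<close>)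
  qed
qed

lemma test_function_continuous:
  "test_function \<phi> \<Longrightarrow> continuous_on UNIV \<phi>"
  unfolding test_function_def by (elim conjE allE[of _ 0]) simp

lemma test_function_bounded:
  assumes "test_function \<phi>"
  obtains M where "M > 0" "\<And>x. \<bar>\<phi> x\<bar> \<le> M"
proof -
  obtain K where K: "compact K" "\<And>x. x \<notin> K \<Longrightarrow> \<phi> x = 0"
    using test_function_support[OF assms] by blast
  show ?thesis
    by (rule bounded_of_compact_support[OF test_function_continuous[OF assms] K that])
qed

lemma test_function_integrable_mult:
  fixes f :: "'a::euclidean_space \<Rightarrow> 'b::euclidean_space"
  assumes "test_function \<phi>" "L2_loc f"
  shows "integrable lebesgue (\<lambda>x. \<phi> x *\<^sub>R f x)"
proof -
  obtain K where K: "compact K" "\<And>x. x \<notin> K \<Longrightarrow> \<phi> x = 0"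
    using test_function_support[OF assms(1)] by blast
  obtain M where M: "\<And>x. \<bar>\<phi> x\<bar> \<le> M"
    using test_function_bounded[OF assms(1)] by blast
  show ?thesis
  proof (rule L2_loc_integrable_mult[of f \<phi> M K])
    show "\<phi> \<in> borel_measurable lebesgue"
      by (intro continuous_imp_lebesgue_measurable test_function_continuous assms)
  qed (simp_all add: assms K M)
qed

section \<open>Integration by parts\<close>

text \<open>For Borel integrands the integrals over \<open>lebesgue\<close> and
  \<open>lborel\<close> agree, and on \<open>lborel\<close> the pushforward hypothesis applies.
  \<open>T\<close> will be a translation or a rotation.\<close>

lemma lebesgue_integral_measure_preserving:
  fixes f :: "'a::euclidean_space \<Rightarrow> 'b::{banach, second_countable_topology}" and T :: "'a \<Rightarrow> 'a"
  assumes "distr lborel borel T = lborel" and T: "T \<in> borel_measurable borel" and f: "f \<in> borel_measurable borel"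
  shows "(LINT x|lebesgue. f (T x)) = (LINT x|lebesgue. f x)"
    and "integrable lebesgue (\<lambda>x. f (T x)) \<longleftrightarrow> integrable lebesgue f"
proof -
  have fT: "(\<lambda>x. f (T x)) \<in> borel_measurable borel"
    using T f by (rule measurable_compose)
  have "(LINT x|lborel. f (T x)) = (LINT x|distr lborel borel T. f x)"
    by (subst integral_distr) (use T f in auto)
  then show "(LINT x|lebesgue. f (T x)) = (LINT x|lebesgue. f x)"
    using fT f by (simp add: assms(1) integral_completion)
  have "integrable lborel (\<lambda>x. f (T x)) \<longleftrightarrow> integrable (distr lborel borel T) f"
    by (subst integrable_distr_eq) (use T f in auto)
  then show "integrable lebesgue (\<lambda>x. f (T x)) \<longleftrightarrow> integrable lebesgue f"
    using fT f by (simp add: assms(1) integrable_completion)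
qed

lemma lebesgue_integral_translate:
  fixes f :: "'a::euclidean_space \<Rightarrow> 'b::{banach, second_countable_topology}"
  assumes "f \<in> borel_measurable borel"
  shows "(LINT x|lebesgue. f (c + x)) = (LINT x|lebesgue. f x)"
    and "integrable lebesgue (\<lambda>x. f (c + x)) \<longleftrightarrow> integrable lebesgue f"
  using lebesgue_integral_measure_preserving[OF lborel_distr_plus[of c] _ assms] by auto

text \<open>Difference quotients in direction \<open>b\<close> have integral 0 by translation
  invariance, and dominated convergence carries this over to the derivative. No iterated integrals
  are involved.\<close>

lemma integral_partial_derivative_eq_0:
  fixes f :: "'a::euclidean_space \<Rightarrow> real"
  assumes f: "test_function f" and b: "b \<in> Basis"
  shows "(LINT x|lebesgue. frechet_derivative f (at x) b) = 0"
proof -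
  define f' where "f' x = frechet_derivative f (at x) b" for x
  have f': "test_function f'"
    using test_function_partial[OF assms] by (simp add: f'_def[abs_def])
  obtain M where M: "M > 0" "\<And>x. \<bar>f' x\<bar> \<le> M"
    using test_function_bounded[OF f'] by blast
  obtain K where K: "compact K" "\<And>x. x \<notin> K \<Longrightarrow> f x = 0"
    using test_function_support[OF f] by blast
  then obtain R where R: "\<And>x. x \<in> K \<Longrightarrow> norm x \<le> R"
    by (meson bounded_iff compact_imp_bounded)
  have contf: "continuous_on UNIV f"
    by (rule test_function_continuous[OF f])
  have der: "(f has_derivative frechet_derivative f (at x)) (at x)" for x
    using f unfolding test_function_def by (elim conjE allE[of _ "Suc 0"]) (rule Ck_SucD)
  have line: "((\<lambda>t. f (x + t *\<^sub>R b)) has_real_derivative f' (x + t *\<^sub>R b)) (at t within S)" for x t S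
  proof -
    interpret bounded_linear "frechet_derivative f (at (x + t *\<^sub>R b))"
      using der has_derivative_bounded_linear by blast
    have "((\<lambda>t. f (x + t *\<^sub>R b)) has_derivative (\<lambda>h. frechet_derivative f (at (x + t *\<^sub>R b)) (h *\<^sub>R b))) (at t within S)"
      by (rule has_derivative_compose[OF _ der]) (auto intro!: derivative_eq_intros)
    moreover have "(\<lambda>h. frechet_derivative f (at (x + t *\<^sub>R b)) (h *\<^sub>R b)) = (*) (f' (x + t *\<^sub>R b))"
      by (simp add: fun_eq_iff scale f'_def mult.commute)
    ultimately show ?thesis
      by (simp only: has_field_derivative_def)
  qed
  define h where "h n = 1 / real (Suc n)" for n
  have h: "h n > 0" "h n \<le> 1" for n
    by (auto simp: h_def divide_simps)
  define g where "g n x = (f (h n *\<^sub>R b + x) - f x) / h n" for n x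
  have contg: "continuous_on UNIV (g n)" for n
    unfolding g_def using h(1)[of n] by (intro continuous_intros continuous_on_compose2[OF contf]) auto
  have intf: "integrable lebesgue f"
    using test_function_integrable_mult[OF f L2_loc_continuous[of "\<lambda>x. 1 :: real"]] by simp
  have "(LINT x|lebesgue. g n x) = 0" for n
  proof -
    have f_meas: "f \<in> borel_measurable borel"
      using contf by (rule borel_measurable_continuous_onI)
    have "(LINT x|lebesgue. f (h n *\<^sub>R b + x) - f x) = 0"
      by (subst Bochner_Integration.integral_diff)
        (use lebesgue_integral_translate[OF f_meas, of "h n *\<^sub>R b"] intf in auto)
    then show ?thesis by (simp add: g_def)
  qed
  moreover have "(\<lambda>n. LINT x|lebesgue. g n x) \<longlonglongrightarrow> (LINT x|lebesgue. f' x)"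
  proof (rule integral_dominated_convergence)
    \<comment> \<open>The shifts have length at most 1, so all difference quotients vanish outside
      the ball of radius \<open>R + 1\<close>; inside, the mean value inequality bounds them by
      \<open>M\<close>.\<close>
    show "integrable lebesgue (\<lambda>x. M * indicator (cball 0 (R + 1)) x :: real)"
      by (intro integrable_mult_right integrable_indicator_compact) auto
    show "AE x in lebesgue. (\<lambda>n. g n x) \<longlonglongrightarrow> f' x"
    proof (rule AE_I2)
      fix x :: 'a
      have "((\<lambda>t. (f (x + t *\<^sub>R b) - f x) / t) \<longlongrightarrow> f' x) (at 0)"
        using line[of x 0 UNIV] by (simp add: has_field_derivative_iff)
      moreover have "filterlim h (at 0) sequentially"
      proof (rule filterlim_atI)
        show "h \<longlonglongrightarrow> 0"
          unfolding h_def[abs_def] by real_asymp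
        show "\<forall>\<^sub>F n in sequentially. h n \<noteq> 0"
          using h(1) by (intro always_eventually allI) (metis less_irrefl)
      qed
      ultimately have "((\<lambda>n. (f (x + h n *\<^sub>R b) - f x) / h n) \<longlonglongrightarrow> f' x)"
        by (rule filterlim_compose)
      then show "(\<lambda>n. g n x) \<longlonglongrightarrow> f' x"
        by (simp add: g_def add.commute)
    qed
    show "AE x in lebesgue. norm (g n x) \<le> M * indicator (cball 0 (R + 1)) x" for n
    proof (rule AE_I2)
      fix x :: 'a
      show "norm (g n x) \<le> M * indicator (cball 0 (R + 1)) x"
      proof (cases "x \<in> cball 0 (R + 1)")
        case True
        have "norm (f (x + h n *\<^sub>R b) - f (x + 0 *\<^sub>R b)) \<le> M * norm (h n - 0)"
          by (rule field_differentiable_bound[of UNIV "\<lambda>t. f (x + t *\<^sub>R b)" "\<lambda>t. f' (x + t *\<^sub>R b)"])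
            (use line M(2) in auto)
        then show ?thesis
          using True h[of n] by (simp add: g_def divide_simps add.commute)
      next
        case False
        have "norm (h n *\<^sub>R b) \<le> 1"
          using h[of n] b by simp
        then have "norm (h n *\<^sub>R b + x) > R"
          using False norm_triangle_ineq4[of "h n *\<^sub>R b + x" "h n *\<^sub>R b"] by (simp del: norm_scaleR)
        then have "h n *\<^sub>R b + x \<notin> K"
          using R by (meson not_less)
        moreover have "x \<notin> K"
          using R[of x] False by auto
        ultimately show ?thesis
          using False K(2) by (simp add: g_def)
      qed
    qed
    show "g n \<in> borel_measurable lebesgue" "f' \<in> borel_measurable lebesgue" for n
      using contg test_function_continuous[OF f'] by (auto intro: continuous_imp_lebesgue_measurable)
  qed
  ultimately show ?thesis
    by (simp add: f'_def[symmetric] LIMSEQ_const_iff)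
qed

text \<open>The affine function times \<phi> is again a test function, so its partial derivative
  integrates to 0; expand it by the product rule.\<close>

lemma integral_affine_mult_partial:
  fixes \<phi> :: "'a::euclidean_space \<Rightarrow> real"
  assumes \<phi>: "test_function \<phi>" and b: "b \<in> Basis"
  shows "(LINT x|lebesgue. (v \<bullet> x + c) * frechet_derivative \<phi> (at x) b) = - (v \<bullet> b) * (LINT x|lebesgue. \<phi> x)"
proof -
  let ?f = "\<lambda>x. (v \<bullet> x + c) * \<phi> x"
  have f: "test_function ?f"
    by (intro test_function_mult \<phi> Ck_add Ck_inner Ck_const)
  have der: "(\<phi> has_derivative frechet_derivative \<phi> (at x)) (at x)" for x
    using \<phi> unfolding test_function_def by (elim conjE allE[of _ "Suc 0"]) (rule Ck_SucD)
  have "(?f has_derivative (\<lambda>h. (v \<bullet> x + c) * frechet_derivative \<phi> (at x) h + (v \<bullet> h) * \<phi> x)) (at x)" for x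
    by (rule has_derivative_mult[OF _ der]) (auto intro!: derivative_eq_intros)
  note eq = frechet_derivative_at[OF this, symmetric]
  have "0 = (LINT x|lebesgue. (v \<bullet> x + c) * frechet_derivative \<phi> (at x) b + (v \<bullet> b) * \<phi> x)"
    using integral_partial_derivative_eq_0[OF f b] by (simp add: eq)
  also have "\<dots> = (LINT x|lebesgue. (v \<bullet> x + c) * frechet_derivative \<phi> (at x) b) + (v \<bullet> b) * (LINT x|lebesgue. \<phi> x)"
  proof (subst Bochner_Integration.integral_add)
    show "integrable lebesgue (\<lambda>x. (v \<bullet> x + c) * frechet_derivative \<phi> (at x) b)"
      using test_function_integrable_mult[OF test_function_partial[OF \<phi> b] L2_loc_continuous[of "\<lambda>x. v \<bullet> x + c"]]
      by (simp add: mult.commute continuous_intros)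
    show "integrable lebesgue (\<lambda>x. (v \<bullet> b) * \<phi> x)"
      using test_function_integrable_mult[OF \<phi> L2_loc_continuous[of "\<lambda>x. v \<bullet> b"]]
      by (simp add: mult.commute)
  qed simp
  finally show ?thesis by simp
qed

section \<open>The transmission problem as a distributional identity\<close>

text \<open>These cutoffs localise a test function to \<Omega> without any regularity of the
  frontier. They are built from countably many balls whose closures lie in \<Omega> and which
  together cover it.\<close>

lemma open_smooth_exhaustion:
  fixes \<Omega> :: "'a::euclidean_space set"
  assumes "open \<Omega>"
  obtains \<psi> :: "nat \<Rightarrow> 'a \<Rightarrow> real" where
    "\<And>m n. Ck m (\<psi> n)" "\<And>n x. 0 \<le> \<psi> n x \<and> \<psi> n x \<le> 1"
    "\<And>n. \<exists>K. compact K \<and> K \<subseteq> \<Omega> \<and> (\<forall>x. x \<notin> K \<longrightarrow> \<psi> n x = 0)"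
    "\<And>x. (\<lambda>n. \<psi> n x) \<longlonglongrightarrow> indicator \<Omega> x"
proof -
  define \<F> where "\<F> = {ball y r | y r. cball y r \<subseteq> \<Omega>}"
  have "\<Union>\<F> = \<Omega>"
  proof (intro equalityI subsetI)
    fix x assume "x \<in> \<Omega>"
    then obtain r where "r > 0" "cball x r \<subseteq> \<Omega>"
      using assms open_contains_cball by blast
    then have "x \<in> ball x r" "ball x r \<in> \<F>"
      by (auto simp: \<F>_def)
    then show "x \<in> \<Union>\<F>"
      by (rule UnionI[rotated])
  next
    fix x assume "x \<in> \<Union>\<F>"
    then show "x \<in> \<Omega>"
      unfolding \<F>_def using ball_subset_cball by blast
  qed
  note Union\<F> = this
  have open\<F>: "open S" if "S \<in> \<F>" for S
    using that by (auto simp: \<F>_def)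
  obtain \<F>' where \<F>': "\<F>' \<subseteq> \<F>" "countable \<F>'" "\<Union>\<F>' = \<Union>\<F>"
    by (rule Lindelof[OF open\<F> that])
  \<comment> \<open>An empty ball is added to the cover so that the countable family is nonempty and
    can be enumerated by \<open>from_nat_into\<close>, even when \<Omega> is empty.\<close>
  have "cball (0::'a) (- 1) = {}"
    by simp
  then have "cball (0::'a) (- 1) \<subseteq> \<Omega>"
    by simp
  then have "ball 0 (- 1) \<in> \<F>"
    unfolding \<F>_def by blast
  moreover have "ball (0::'a) (- 1) = {}"
    by simp
  ultimately have "{} \<in> \<F>"
    by (simp only:)
  with \<F>' Union\<F> have \<F>': "insert {} \<F>' \<subseteq> \<F>" "countable (insert {} \<F>')" "\<Union>(insert {} \<F>') = \<Omega>"
    by simp_all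
  define B where "B = from_nat_into (insert {} \<F>')"
  have rangeB: "range B = insert {} \<F>'"
    unfolding B_def using \<F>'(2) by (intro range_from_nat_into) auto
  have "\<forall>j. \<exists>y r. B j = ball y r \<and> cball y r \<subseteq> \<Omega>"
  proof
    fix j
    have "B j \<in> insert {} \<F>'"
      unfolding B_def by (rule from_nat_into) simp
    with \<F>'(1) have "B j \<in> \<F>" by (rule subsetD)
    then show "\<exists>y r. B j = ball y r \<and> cball y r \<subseteq> \<Omega>"
      unfolding \<F>_def by (rule CollectD)
  qed
  from choice[OF this] obtain y where "\<forall>j. \<exists>r. B j = ball (y j) r \<and> cball (y j) r \<subseteq> \<Omega>" by (rule exE)
  from choice[OF this] obtain r where "\<forall>j. B j = ball (y j) (r j) \<and> cball (y j) (r j) \<subseteq> \<Omega>" by (rule exE)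
  then have yr: "B j = ball (y j) (r j)" "cball (y j) (r j) \<subseteq> \<Omega>" for j by simp_all
  have "\<Omega> = (\<Union>j. B j)"
    unfolding rangeB using \<F>'(3) by (rule sym)
  then have \<Omega>: "\<Omega> = (\<Union>j. ball (y j) (r j))"
    by (simp only: yr(1))
  \<comment> \<open>\<open>e n j\<close> is positive exactly on the \<open>j\<close>-th ball and tends to its indicator function.\<close>
  define e where "e n j x = bump 0 (real (Suc n) * ((max 0 (r j))\<^sup>2 - (norm (x - y j))\<^sup>2))" for n j and x :: 'a
  \<comment> \<open>A smooth substitute for the indicator function of a union: it stays in the unit
    interval, is at least \<open>e n j\<close> for every \<open>j < n\<close>, and vanishes off
    finitely many closed balls. The \<open>max 0\<close> in \<open>e\<close> makes balls of negative
    radius contribute 0.\<close>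
  define \<psi> where "\<psi> n x = 1 - (\<Prod>j<n. (1 - e n j x))" for n x
  have e01: "0 \<le> e n j x" "e n j x \<le> 1" for n j x
    by (auto simp: e_def bump_0)
  have e_out: "e n j x = 0" if "x \<notin> ball (y j) (r j)" for n j x
  proof -
    have "max 0 (r j) \<le> norm (x - y j)"
      using that by (simp add: dist_norm norm_minus_commute)
    then have "(max 0 (r j))\<^sup>2 \<le> (norm (x - y j))\<^sup>2"
      by (intro power_mono) auto
    then show ?thesis
      unfolding e_def by (intro bump_nonpos mult_nonneg_nonpos) auto
  qed
  show ?thesis
  proof (rule that)
    have Ck_e: "Ck m (e n j)" for m n j
      unfolding e_def
      by (intro Ck_chain[where S = UNIV and F = bump] bump_has_real_derivative Ck_mult Ck_diff
          Ck_norm_power2 Ck_const) auto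
    then show "Ck m (\<psi> n)" for m n
      unfolding \<psi>_def by (intro Ck_diff Ck_prod Ck_const) (simp add: Ck_e)
    show "0 \<le> \<psi> n x \<and> \<psi> n x \<le> 1" for n x
      unfolding \<psi>_def using e01 by (auto intro!: prod_le_1 prod_nonneg)
    show "\<exists>K. compact K \<and> K \<subseteq> \<Omega> \<and> (\<forall>x. x \<notin> K \<longrightarrow> \<psi> n x = 0)" for n
    proof (intro exI[of _ "\<Union>j<n. cball (y j) (r j)"] conjI allI impI)
      fix x assume "x \<notin> (\<Union>j<n. cball (y j) (r j))"
      then have "e n j x = 0" if "j < n" for j
        using e_out[of x j n] that by force
      then show "\<psi> n x = 0"
        by (simp add: \<psi>_def)
    qed (use yr(2) in auto)
    show "(\<lambda>n. \<psi> n x) \<longlonglongrightarrow> indicator \<Omega> x" for x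
    proof (cases "x \<in> \<Omega>")
      case True
      then obtain j where j: "x \<in> ball (y j) (r j)"
        using \<Omega> by blast
      define d where "d = (max 0 (r j))\<^sup>2 - (norm (x - y j))\<^sup>2"
      have "norm (x - y j) < r j"
        using j by (simp add: dist_norm norm_minus_commute)
      then have d: "d > 0"
        unfolding d_def using norm_ge_zero[of "x - y j"] by (simp add: power_strict_mono)
      have "(\<lambda>n. exp (- (1 / (real (Suc n) * d)))) \<longlonglongrightarrow> 1"
        using d by real_asymp
      then have "(\<lambda>n. e n j x) \<longlonglongrightarrow> 1"
        using d by (simp add: e_def bump_0 flip: d_def)
      moreover have "\<forall>\<^sub>F n in sequentially. e n j x \<le> \<psi> n x"
        using eventually_gt_at_top[of j]
      proof eventually_elim
        case (elim n)
        have "(\<Prod>i<n. (1 - e n i x)) = (1 - e n j x) * (\<Prod>i\<in>{..<n} - {j}. (1 - e n i x))"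
          using elim by (intro prod.remove) auto
        also have "\<dots> \<le> (1 - e n j x) * 1"
          using e01 by (intro mult_left_mono prod_le_1) auto
        finally show ?case by (simp add: \<psi>_def)
      qed
      moreover have "\<forall>\<^sub>F n in sequentially. \<psi> n x \<le> 1"
        unfolding \<psi>_def using e01 by (auto intro!: prod_nonneg always_eventually)
      ultimately have "(\<lambda>n. \<psi> n x) \<longlonglongrightarrow> 1"
        by (intro tendsto_sandwich[of "\<lambda>n. e n j x" "\<lambda>n. \<psi> n x" sequentially "\<lambda>n. 1" 1]) simp_all
      then show ?thesis using True by simp
    next
      case False
      then have "e n j x = 0" for n j
        by (intro e_out) (use False \<Omega> in auto)
      then show ?thesis using False by (simp add: \<psi>_def)
    qed
  qed
qed

text \<open>The identity \<open>G = b\<close> in \<Omega>, in integrated form. For the test function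
  \<open>\<psi> n * \<phi>\<close>, supported inside \<Omega>, \<open>u\<close> may be replaced by
  its affine formula and integrated by parts; then \<open>n\<close> tends to infinity.\<close>

lemma weak_gradient_affine:
  fixes \<Omega> :: "'a::euclidean_space set"
  assumes H1: "H1_loc_with_gradient u G" and "open \<Omega>"
    and u: "AE x in lebesgue. x \<in> \<Omega> \<longrightarrow> u x = b \<bullet> x + c"
    and \<phi>: "test_function \<phi>"
  shows "(LINT x|lebesgue. indicator \<Omega> x *\<^sub>R \<phi> x *\<^sub>R (G x - b)) = 0"
proof -
  have L2: "L2_loc u" "L2_loc G"
    and weak: "\<And>\<phi>. test_function \<phi> \<Longrightarrow>
        (LINT x|lebesgue. u x *\<^sub>R gradient \<phi> x) = - (LINT x|lebesgue. \<phi> x *\<^sub>R G x)"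
    using H1 by (auto simp: H1_loc_with_gradient_def)
  obtain \<psi> :: "nat \<Rightarrow> 'a \<Rightarrow> real" where Ck_\<psi>: "\<And>m n. Ck m (\<psi> n)" and \<psi>01: "\<And>n x. 0 \<le> \<psi> n x \<and> \<psi> n x \<le> 1"
    and supp: "\<And>n. \<exists>K. compact K \<and> K \<subseteq> \<Omega> \<and> (\<forall>x. x \<notin> K \<longrightarrow> \<psi> n x = 0)"
    and lim: "\<And>x. (\<lambda>n. \<psi> n x) \<longlonglongrightarrow> indicator \<Omega> x"
    by (rule open_smooth_exhaustion[OF \<open>open \<Omega>\<close> that])
  have L2': "L2_loc (\<lambda>x::'a. b)"
  proof -
    have "integrable lebesgue (\<lambda>x. indicator K x *\<^sub>R (norm b)\<^sup>2)" if "compact K" for K :: "'a set"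
      by (intro integrable_scaleR_left integrable_indicator_compact that)
    then show ?thesis
      unfolding L2_loc_def set_integrable_def by simp
  qed
  have int: "integrable lebesgue (\<lambda>x. \<phi> x *\<^sub>R (G x - b))"
    using test_function_integrable_mult[OF \<phi> L2(2)] test_function_integrable_mult[OF \<phi> L2']
    by (simp add: scaleR_diff_right)
  have "(LINT x|lebesgue. \<psi> n x *\<^sub>R \<phi> x *\<^sub>R (G x - b)) = 0" for n
  proof -
    define \<eta> where "\<eta> x = \<psi> n x * \<phi> x" for x
    have \<eta>: "test_function \<eta>"
      unfolding \<eta>_def by (rule test_function_mult[OF \<phi> Ck_\<psi>])
    obtain K where K: "compact K" "K \<subseteq> \<Omega>" "\<And>x. x \<notin> K \<Longrightarrow> \<psi> n x = 0"
      using supp by blast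
    \<comment> \<open>This allows \<open>u\<close> to be replaced by
      \<open>b \<bullet> x + c\<close> under an integral over the whole space, although the two
      agree only in \<Omega>.\<close>
    have grad0: "frechet_derivative \<eta> (at x) i = 0" if "x \<notin> \<Omega>" for x i
    proof -
      have "x \<notin> K" using K(2) that by auto
      then have "frechet_derivative \<eta> (at x) = (\<lambda>h. 0)"
        by (intro frechet_derivative_zero_outside[OF compact_imp_closed[OF K(1)]]) (simp_all add: \<eta>_def K(3))
      then show ?thesis by simp
    qed
    have "(LINT x|lebesgue. \<eta> x *\<^sub>R G x) = (LINT x|lebesgue. \<eta> x *\<^sub>R b)"
    proof (rule euclidean_eqI)
      fix i :: 'a assume i: "i \<in> Basis"
      have grad_i: "test_function (\<lambda>x. frechet_derivative \<eta> (at x) i)"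
        by (rule test_function_partial[OF \<eta> i])
      have int_grad: "integrable lebesgue (\<lambda>x. u x *\<^sub>R gradient \<eta> x)"
        unfolding gradient_def scaleR_sum_right
        by (intro Bochner_Integration.integrable_sum)
          (use test_function_integrable_mult[OF test_function_partial[OF \<eta>] L2(1)] in \<open>auto simp: mult.commute\<close>)
      have "(LINT x|lebesgue. \<eta> x *\<^sub>R G x) \<bullet> i = - ((LINT x|lebesgue. u x *\<^sub>R gradient \<eta> x) \<bullet> i)"
        by (simp add: weak[OF \<eta>])
      also have "\<dots> = - (LINT x|lebesgue. u x * frechet_derivative \<eta> (at x) i)"
        by (subst integral_inner_left[symmetric]) (auto simp: int_grad gradient_inner_Basis i)
      also have "(LINT x|lebesgue. u x * frechet_derivative \<eta> (at x) i)
          = (LINT x|lebesgue. (b \<bullet> x + c) * frechet_derivative \<eta> (at x) i)"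
      proof (rule integral_cong_AE)
        have "(\<lambda>x. frechet_derivative \<eta> (at x) i) \<in> borel_measurable lebesgue"
          by (intro continuous_imp_lebesgue_measurable test_function_continuous grad_i)
        moreover have "(\<lambda>x. b \<bullet> x + c) \<in> borel_measurable lebesgue"
          by (intro continuous_imp_lebesgue_measurable continuous_intros)
        ultimately show "(\<lambda>x. u x * frechet_derivative \<eta> (at x) i) \<in> borel_measurable lebesgue"
          "(\<lambda>x. (b \<bullet> x + c) * frechet_derivative \<eta> (at x) i) \<in> borel_measurable lebesgue"
          using L2(1) by (auto simp: L2_loc_def)
        show "AE x in lebesgue. u x * frechet_derivative \<eta> (at x) i = (b \<bullet> x + c) * frechet_derivative \<eta> (at x) i"
          using u by eventually_elim (use grad0 in auto)
      qed
      also have "\<dots> = - (b \<bullet> i) * (LINT x|lebesgue. \<eta> x)"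
        by (rule integral_affine_mult_partial[OF \<eta> i])
      also have "- (- (b \<bullet> i) * (LINT x|lebesgue. \<eta> x)) = (LINT x|lebesgue. \<eta> x *\<^sub>R b) \<bullet> i"
        using test_function_integrable_mult[OF \<eta> L2_loc_continuous[of "\<lambda>x. 1"]]
        by (simp add: mult.commute)
      finally show "(LINT x|lebesgue. \<eta> x *\<^sub>R G x) \<bullet> i = (LINT x|lebesgue. \<eta> x *\<^sub>R b) \<bullet> i" .
    qed
    then have "(LINT x|lebesgue. \<eta> x *\<^sub>R (G x - b)) = 0"
      using test_function_integrable_mult[OF \<eta> L2(2)] test_function_integrable_mult[OF \<eta> L2']
      by (simp add: scaleR_diff_right)
    then show ?thesis by (simp add: \<eta>_def)
  qed
  moreover have "(\<lambda>n. LINT x|lebesgue. \<psi> n x *\<^sub>R \<phi> x *\<^sub>R (G x - b))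
      \<longlonglongrightarrow> (LINT x|lebesgue. indicator \<Omega> x *\<^sub>R \<phi> x *\<^sub>R (G x - b))"
  proof (rule integral_dominated_convergence)
    show "integrable lebesgue (\<lambda>x. norm (\<phi> x *\<^sub>R (G x - b)))"
      using int by (rule integrable_norm)
    show "AE x in lebesgue. (\<lambda>n. \<psi> n x *\<^sub>R \<phi> x *\<^sub>R (G x - b)) \<longlonglongrightarrow> indicator \<Omega> x *\<^sub>R \<phi> x *\<^sub>R (G x - b)"
      by (intro AE_I2 tendsto_scaleR lim tendsto_const)
    have "norm (\<psi> n x *\<^sub>R v) \<le> norm v" for n x and v :: 'a
      using \<psi>01[of n x] by (simp add: mult_left_le_one_le)
    then show "AE x in lebesgue. norm (\<psi> n x *\<^sub>R \<phi> x *\<^sub>R (G x - b)) \<le> norm (\<phi> x *\<^sub>R (G x - b))" for n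
      by blast
    have "\<psi> n \<in> borel_measurable lebesgue" for n
      using Ck_\<psi>[of 0 n] by (intro continuous_imp_lebesgue_measurable) simp
    then show "(\<lambda>x. \<psi> n x *\<^sub>R \<phi> x *\<^sub>R (G x - b)) \<in> borel_measurable lebesgue" for n
      by (rule borel_measurable_scaleR[OF _ borel_measurable_integrable[OF int]])
    have "\<Omega> \<in> sets lebesgue"
      using \<open>open \<Omega>\<close> by auto
    then show "(\<lambda>x. indicator \<Omega> x *\<^sub>R \<phi> x *\<^sub>R (G x - b)) \<in> borel_measurable lebesgue"
      by (intro borel_measurable_scaleR[OF _ borel_measurable_integrable[OF int]] borel_measurable_indicator)
  qed
  ultimately show ?thesis
    by (simp add: LIMSEQ_const_iff)
qed

definition laplacian :: "('a::euclidean_space \<Rightarrow> real) \<Rightarrow> 'a \<Rightarrow> real" where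
  "laplacian f x = (\<Sum>i\<in>Basis. frechet_derivative (\<lambda>y. frechet_derivative f (at y) i) (at x) i)"

text \<open>Integration by parts puts \<open>- G \<bullet> gradient \<phi>\<close> on the left. The
  equation turns this into an integral over \<Omega> alone, where \<open>G\<close> may be replaced
  by \<open>b\<close>. Subtracting \<open>a \<bullet> x\<close> changes nothing, as affine functions
  are harmonic.\<close>

lemma transmission_weak_identity:
  fixes \<Omega> :: "'a::euclidean_space set"
  assumes sol: "weak_solution (\<lambda>x. 1 + (k - 1) * indicator \<Omega> x) u" and "open \<Omega>"
    and u: "AE x in lebesgue. x \<in> \<Omega> \<longrightarrow> u x = b \<bullet> x + c"
    and \<phi>: "test_function \<phi>"
  shows "(LINT x|lebesgue. (u x - a \<bullet> x) * laplacian \<phi> x)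
       = (k - 1) * (LINT x|lebesgue. indicator \<Omega> x * (b \<bullet> gradient \<phi> x))"
proof -
  obtain G where H1: "H1_loc_with_gradient u G"
    and sol: "\<And>\<phi>. test_function \<phi> \<Longrightarrow>
        (LINT x|lebesgue. (1 + (k - 1) * indicator \<Omega> x) * (G x \<bullet> gradient \<phi> x)) = 0"
    using sol by (auto simp: weak_solution_def)
  have L2: "L2_loc u" "L2_loc G"
    and weak: "\<And>\<phi>. test_function \<phi> \<Longrightarrow>
        (LINT x|lebesgue. u x *\<^sub>R gradient \<phi> x) = - (LINT x|lebesgue. \<phi> x *\<^sub>R G x)"
    using H1 by (auto simp: H1_loc_with_gradient_def)
  define D where "D i x = frechet_derivative \<phi> (at x) i" for i x
  define D2 where "D2 i x = frechet_derivative (D i) (at x) i" for i x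
  have D: "test_function (D i)" if "i \<in> Basis" for i
    unfolding D_def[abs_def] by (rule test_function_partial[OF \<phi> that])
  have D2: "test_function (D2 i)" if "i \<in> Basis" for i
    unfolding D2_def[abs_def] by (rule test_function_partial[OF D[OF that] that])
  have lap: "laplacian \<phi> x = (\<Sum>i\<in>Basis. D2 i x)" for x
    by (simp add: laplacian_def D2_def D_def[abs_def])
  have inner_grad: "v \<bullet> gradient \<phi> x = (\<Sum>i\<in>Basis. D i x * (v \<bullet> i))" for v x
    by (simp add: gradient_def D_def inner_sum_right mult.commute)
  have int_uD2: "integrable lebesgue (\<lambda>x. u x * D2 i x)" if "i \<in> Basis" for i
    using test_function_integrable_mult[OF D2[OF that] L2(1)] by (simp add: mult.commute)
  have int_aD2: "integrable lebesgue (\<lambda>x. (a \<bullet> x) * D2 i x)" if "i \<in> Basis" for i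
    using test_function_integrable_mult[OF D2[OF that] L2_loc_continuous[of "\<lambda>x. a \<bullet> x"]]
    by (simp add: mult.commute continuous_intros)
  have int_DG: "integrable lebesgue (\<lambda>x. D i x * (G x \<bullet> i))" if "i \<in> Basis" for i
    using integrable_inner_left[OF test_function_integrable_mult[OF D[OF that] L2(2)], of i]
    by simp
  have \<Omega>[measurable]: "\<Omega> \<in> sets lebesgue"
    using \<open>open \<Omega>\<close> by auto
  have int_\<Omega>: "integrable lebesgue (\<lambda>x. indicator \<Omega> x * f x)" if "integrable lebesgue f" for f :: "'a \<Rightarrow> real"
    using integrable_mult_indicator[OF \<Omega> that] by simp
  have int_D: "integrable lebesgue (\<lambda>x. D i x * d)" if "i \<in> Basis" for i d
    using test_function_integrable_mult[OF D[OF that] L2_loc_continuous[of "\<lambda>x. d"]] by simp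
  \<comment> \<open>The weak gradient is tested with the partial derivative \<open>D i\<close>
    instead of \<phi>, which puts a second derivative on the side of \<open>u\<close>.\<close>
  have uD2: "(LINT x|lebesgue. u x * D2 i x) = - (LINT x|lebesgue. D i x * (G x \<bullet> i))" if i: "i \<in> Basis" for i
  proof -
    have int_grad: "integrable lebesgue (\<lambda>x. u x *\<^sub>R gradient (D i) x)"
      unfolding gradient_def scaleR_sum_right
      by (intro Bochner_Integration.integrable_sum)
        (use test_function_integrable_mult[OF test_function_partial[OF D[OF i]] L2(1)] in \<open>auto simp: mult.commute\<close>)
    have "(LINT x|lebesgue. u x * D2 i x) = (LINT x|lebesgue. u x *\<^sub>R gradient (D i) x) \<bullet> i"
      by (subst integral_inner_left[symmetric]) (auto simp: int_grad gradient_inner_Basis i D2_def)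
    also have "\<dots> = - ((LINT x|lebesgue. D i x *\<^sub>R G x) \<bullet> i)"
      by (simp add: weak[OF D[OF i]])
    also have "\<dots> = - (LINT x|lebesgue. D i x * (G x \<bullet> i))"
      by (subst integral_inner_left[symmetric]) (auto simp: test_function_integrable_mult[OF D[OF i] L2(2)])
    finally show ?thesis .
  qed
  have aD2: "(LINT x|lebesgue. (a \<bullet> x) * D2 i x) = 0" if i: "i \<in> Basis" for i
    using integral_affine_mult_partial[OF D[OF i] i, of a 0] integral_partial_derivative_eq_0[OF \<phi> i]
    by (simp add: D2_def D_def[abs_def])
  have \<Omega>D: "(LINT x|lebesgue. indicator \<Omega> x * (D i x * (G x \<bullet> i)))
      = (LINT x|lebesgue. indicator \<Omega> x * (D i x * (b \<bullet> i)))" if i: "i \<in> Basis" for i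
  proof -
    have "integrable lebesgue (\<lambda>x. D i x *\<^sub>R (G x - b))"
    proof -
      have "integrable lebesgue (\<lambda>x. D i x *\<^sub>R b)"
        using int_D[OF i, of 1] by (intro integrable_scaleR_left) simp
      then show ?thesis
        using test_function_integrable_mult[OF D[OF i] L2(2)] by (simp add: scaleR_diff_right)
    qed
    then have int: "integrable lebesgue (\<lambda>x. indicator \<Omega> x *\<^sub>R D i x *\<^sub>R (G x - b))"
      by (rule integrable_mult_indicator[OF \<Omega>])
    have "0 = (LINT x|lebesgue. indicator \<Omega> x *\<^sub>R D i x *\<^sub>R (G x - b)) \<bullet> i"
      using weak_gradient_affine[OF H1 \<open>open \<Omega>\<close> u D[OF i]] by simp
    also have "\<dots> = (LINT x|lebesgue. indicator \<Omega> x * (D i x * (G x \<bullet> i)) - indicator \<Omega> x * (D i x * (b \<bullet> i)))"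
      by (subst integral_inner_left[OF int, symmetric]) (simp add: inner_diff_left algebra_simps)
    also have "\<dots> = (LINT x|lebesgue. indicator \<Omega> x * (D i x * (G x \<bullet> i)))
        - (LINT x|lebesgue. indicator \<Omega> x * (D i x * (b \<bullet> i)))"
      by (intro Bochner_Integration.integral_diff int_\<Omega> int_DG int_D i)
    finally show ?thesis by simp
  qed
  have "(LINT x|lebesgue. (u x - a \<bullet> x) * laplacian \<phi> x)
      = (LINT x|lebesgue. (\<Sum>i\<in>Basis. u x * D2 i x - (a \<bullet> x) * D2 i x))"
    by (simp add: lap sum_distrib_left left_diff_distrib)
  also have "\<dots> = (\<Sum>i\<in>Basis. (LINT x|lebesgue. u x * D2 i x) - (LINT x|lebesgue. (a \<bullet> x) * D2 i x))"
  proof (subst Bochner_Integration.integral_sum)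
    show "integrable lebesgue (\<lambda>x. u x * D2 i x - (a \<bullet> x) * D2 i x)" if "i \<in> Basis" for i
      by (intro Bochner_Integration.integrable_diff int_uD2 int_aD2 that)
  qed (intro sum.cong refl Bochner_Integration.integral_diff int_uD2 int_aD2)
  also have "\<dots> = - (\<Sum>i\<in>Basis. LINT x|lebesgue. D i x * (G x \<bullet> i))"
    by (simp add: uD2 aD2 sum_negf)
  finally have 1: "(LINT x|lebesgue. (u x - a \<bullet> x) * laplacian \<phi> x)
      = - (\<Sum>i\<in>Basis. LINT x|lebesgue. D i x * (G x \<bullet> i))" .
  have "(1 + (k - 1) * indicator \<Omega> x) * (G x \<bullet> gradient \<phi> x)
      = (\<Sum>i\<in>Basis. D i x * (G x \<bullet> i) + (k - 1) * (indicator \<Omega> x * (D i x * (G x \<bullet> i))))" for x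
    by (simp add: inner_grad sum.distrib distrib_right mult.assoc flip: sum_distrib_left)
  then have "0 = (LINT x|lebesgue. (\<Sum>i\<in>Basis. D i x * (G x \<bullet> i) + (k - 1) * (indicator \<Omega> x * (D i x * (G x \<bullet> i)))))"
    using sol[OF \<phi>] by simp
  also have "\<dots> = (\<Sum>i\<in>Basis. (LINT x|lebesgue. D i x * (G x \<bullet> i))
      + (k - 1) * (LINT x|lebesgue. indicator \<Omega> x * (D i x * (G x \<bullet> i))))"
  proof (subst Bochner_Integration.integral_sum)
    show "integrable lebesgue (\<lambda>x. D i x * (G x \<bullet> i) + (k - 1) * (indicator \<Omega> x * (D i x * (G x \<bullet> i))))"
      if "i \<in> Basis" for i
      by (intro Bochner_Integration.integrable_add integrable_mult_right int_DG int_\<Omega> that)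
  next
    show "(\<Sum>i\<in>Basis. LINT x|lebesgue. D i x * (G x \<bullet> i) + (k - 1) * (indicator \<Omega> x * (D i x * (G x \<bullet> i))))
      = (\<Sum>i\<in>Basis. (LINT x|lebesgue. D i x * (G x \<bullet> i))
        + (k - 1) * (LINT x|lebesgue. indicator \<Omega> x * (D i x * (G x \<bullet> i))))"
      by (intro sum.cong refl, subst Bochner_Integration.integral_add)
        (simp_all add: int_DG int_\<Omega>)
  qed
  also have "\<dots> = (\<Sum>i\<in>Basis. LINT x|lebesgue. D i x * (G x \<bullet> i))
      + (k - 1) * (\<Sum>i\<in>Basis. LINT x|lebesgue. indicator \<Omega> x * (D i x * (b \<bullet> i)))"
    by (simp add: sum.distrib sum_distrib_left \<Omega>D)
  also have "(\<Sum>i\<in>Basis. LINT x|lebesgue. indicator \<Omega> x * (D i x * (b \<bullet> i)))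
      = (LINT x|lebesgue. indicator \<Omega> x * (b \<bullet> gradient \<phi> x))"
    by (subst Bochner_Integration.integral_sum[symmetric])
      (rule int_\<Omega>, rule int_D, assumption, simp only: inner_grad sum_distrib_left)
  finally show ?thesis using 1 by simp
qed

section \<open>The exterior of a Lipschitz domain\<close>

text \<open>Below a Lipschitz graph lies a connected region, the image of a rectangle under the map
  that straightens the graph. It contains every exterior point near \<open>p\<close> and accumulates
  at every frontier point near \<open>p\<close>.\<close>

lemma graph_exterior_locally_connected:
  fixes \<Omega> :: "(real^2) set"
  assumes t: "norm t = 1" "norm n = 1" "t \<bullet> n = 0" and "r > 0"
    and lip: "L-lipschitz_on UNIV (g :: real \<Rightarrow> real)"
    and graph: "\<And>x. x \<in> ball p r \<Longrightarrow> x \<in> \<Omega> \<longleftrightarrow> (x - p) \<bullet> n > g ((x - p) \<bullet> t)"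
    and p: "p \<in> frontier \<Omega>"
  obtains \<rho> R where "\<rho> > 0" "connected R" "R \<subseteq> - closure \<Omega>" "ball p \<rho> - closure \<Omega> \<subseteq> R"
    "\<And>x. x \<in> frontier \<Omega> \<inter> ball p \<rho> \<Longrightarrow> x \<in> closure R"
proof -
  have L: "L \<ge> 0" and gL: "\<And>s s'. \<bar>g s - g s'\<bar> \<le> L * \<bar>s - s'\<bar>"
    using lip by (auto simp: lipschitz_on_def dist_real_def)
  have contg: "continuous_on UNIV g"
    using lip by (rule lipschitz_on_continuous_on)
  define \<gamma> where "\<gamma> x = (x - p) \<bullet> n - g ((x - p) \<bullet> t)" for x
  have cont\<gamma>: "continuous_on UNIV \<gamma>"
    unfolding \<gamma>_def by (intro continuous_intros continuous_on_compose2[OF contg]) auto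
  \<comment> \<open>Straightening coordinates: \<open>a\<close> is the tangential coordinate and
    \<open>s\<close> the depth below the graph, so that \<gamma> becomes \<open>- s\<close>.\<close>
  define \<Phi> where "\<Phi> = (\<lambda>(a::real, s). p + a *\<^sub>R t + (g a - s) *\<^sub>R n)"
  have tn: "t \<bullet> t = 1" "n \<bullet> n = 1" "n \<bullet> t = 0"
    using t by (auto simp: dot_square_norm inner_commute)
  \<comment> \<open>In the plane the two unit vectors \<open>t\<close> and \<open>n\<close> form an
    orthonormal basis; in components this is a polynomial identity.\<close>
  have coord: "x = p + ((x - p) \<bullet> t) *\<^sub>R t + ((x - p) \<bullet> n) *\<^sub>R n" for x
  proof -
    define y where "y = x - p"
    have "t $ 1 * t $ 1 + t $ 2 * t $ 2 = 1" "n $ 1 * n $ 1 + n $ 2 * n $ 2 = 1" "t $ 1 * n $ 1 + t $ 2 * n $ 2 = 0"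
      using tn t(3) by (auto simp: inner_vec_def sum_2)
    then have "y $ 1 = (y $ 1 * t $ 1 + y $ 2 * t $ 2) * t $ 1 + (y $ 1 * n $ 1 + y $ 2 * n $ 2) * n $ 1"
        "y $ 2 = (y $ 1 * t $ 1 + y $ 2 * t $ 2) * t $ 2 + (y $ 1 * n $ 1 + y $ 2 * n $ 2) * n $ 2"
      by algebra+
    then have "y = (y \<bullet> t) *\<^sub>R t + (y \<bullet> n) *\<^sub>R n"
      by (simp add: vec_eq_iff forall_2 inner_vec_def sum_2)
    then show ?thesis unfolding y_def by (metis add.assoc add_diff_cancel_left' diff_add_cancel add.commute)
  qed
  have \<gamma>\<Phi>: "\<gamma> (\<Phi> (a, s)) = - s" for a s
    using t(3) tn by (simp add: \<gamma>_def \<Phi>_def inner_add_left)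
  have \<Phi>\<gamma>: "\<Phi> ((x - p) \<bullet> t, - \<gamma> x) = x" for x
    using coord[of x] by (simp add: \<Phi>_def \<gamma>_def)
  have in_\<Omega>: "x \<in> \<Omega> \<longleftrightarrow> \<gamma> x > 0" if "x \<in> ball p r" for x
    using graph[OF that] by (simp add: \<gamma>_def)
  have cl: "\<gamma> x \<ge> 0" if "x \<in> closure \<Omega>" "x \<in> ball p r" for x
  proof (rule ccontr)
    assume "\<not> \<gamma> x \<ge> 0"
    define U where "U = ball p r \<inter> {x. \<gamma> x < 0}"
    have "open U"
      unfolding U_def by (intro open_Int open_ball open_Collect_less cont\<gamma> continuous_on_const)
    moreover have "x \<in> U"
      using that \<open>\<not> \<gamma> x \<ge> 0\<close> by (auto simp: U_def)
    moreover have "U \<inter> \<Omega> = {}"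
      using in_\<Omega> by (force simp: U_def)
    ultimately show False
      using that(1) open_Int_closure_eq_empty by blast
  qed
  \<comment> \<open>A point on or above the graph is a limit of points of \<Omega>: push it slightly
    along \<open>n\<close>.\<close>
  have ncl: "x \<in> closure \<Omega>" if "\<gamma> x \<ge> 0" "x \<in> ball p r" for x
  proof -
    define f where "f \<epsilon> = x + \<epsilon> *\<^sub>R n" for \<epsilon> :: real
    have \<gamma>f: "\<gamma> (f \<epsilon>) = \<gamma> x + \<epsilon>" for \<epsilon>
      using tn by (simp add: \<gamma>_def f_def inner_diff_left inner_add_left)
    have lim: "(\<lambda>k. f (1 / real (Suc k))) \<longlonglongrightarrow> x"
    proof -
      have "(\<lambda>k. 1 / real (Suc k)) \<longlonglongrightarrow> 0"
        by real_asymp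
      then show ?thesis unfolding f_def
        using tendsto_add[OF tendsto_const[of x] tendsto_scaleR[OF _ tendsto_const[of n]]] by fastforce
    qed
    have "\<forall>\<^sub>F k in sequentially. f (1 / real (Suc k)) \<in> ball p r"
      using lim that(2) topological_tendstoD open_ball by blast
    then have "\<forall>\<^sub>F k in sequentially. f (1 / real (Suc k)) \<in> \<Omega>"
    proof eventually_elim
      case (elim k)
      show ?case unfolding in_\<Omega>[OF elim] \<gamma>f using that(1) by (simp add: add_nonneg_pos)
    qed
    then have "\<forall>\<^sub>F k in sequentially. f (1 / real (Suc k)) \<in> closure \<Omega>"
      by (rule eventually_mono) (use closure_subset in blast)
    from Lim_in_closed_set[OF closed_closure this trivial_limit_sequentially lim] show ?thesis .
  qed
  have "\<gamma> p = 0"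
  proof -
    have "p \<in> closure \<Omega>" using p by (auto simp: frontier_def)
    then have "\<gamma> p \<ge> 0" using cl \<open>r > 0\<close> by auto
    moreover have "\<not> \<gamma> p > 0"
    proof
      assume "\<gamma> p > 0"
      have "open (ball p r \<inter> {x. 0 < \<gamma> x})"
        by (intro open_Int open_ball open_Collect_less cont\<gamma> continuous_on_const)
      moreover have "ball p r \<inter> {x. 0 < \<gamma> x} \<subseteq> \<Omega>"
        using in_\<Omega> by auto
      moreover have "p \<in> ball p r \<inter> {x. 0 < \<gamma> x}"
        using \<open>\<gamma> p > 0\<close> \<open>r > 0\<close> by auto
      ultimately have "p \<in> interior \<Omega>"
        by (meson interior_maximal subsetD)
      then show False using p by (auto simp: frontier_def)
    qed
    ultimately show ?thesis by linarith
  qed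
  then have g0: "g 0 = 0" by (simp add: \<gamma>_def)
  \<comment> \<open>A point of the curved box lies within
    \<open>\<bar>a\<bar> + L * \<bar>a\<bar> + s < (L + 2) * h = r / 2\<close> of \<open>p\<close>,
    so the box stays in the ball where the graph description holds. With \<rho> smaller by another
    factor \<open>L + 2\<close>, points of \<open>ball p \<rho>\<close> have both coordinates below
    \<open>h\<close>.\<close>
  define h where "h = r / (2 * (L + 2))"
  have h: "h > 0" "(L + 2) * h < r"
    using \<open>r > 0\<close> L by (auto simp: h_def field_simps add_nonneg_pos)
  define \<rho> where "\<rho> = h / (L + 2)"
  have \<rho>: "\<rho> > 0" "(L + 2) * \<rho> \<le> h"
    using h L by (auto simp: \<rho>_def field_simps)
  have \<rho>h: "\<rho> < h"
  proof -
    have "2 * \<rho> \<le> (L + 2) * \<rho>" using L \<rho>(1) by (intro mult_right_mono) auto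
    then show ?thesis using \<rho> by linarith
  qed
  have hr: "h < r"
  proof -
    have "2 * h \<le> (L + 2) * h" using L h(1) by (intro mult_right_mono) auto
    then show ?thesis using h by linarith
  qed
  define R where "R = \<Phi> ` ({-h<..<h} \<times> {0<..<h})"
  have \<Phi>_ball: "\<Phi> (a, s) \<in> ball p r" if "\<bar>a\<bar> < h" "0 \<le> s" "s < h" for a s
  proof -
    have "norm (\<Phi> (a, s) - p) \<le> norm (a *\<^sub>R t) + norm ((g a - s) *\<^sub>R n)"
      unfolding \<Phi>_def by (simp add: norm_triangle_ineq del: norm_scaleR)
    also have "\<dots> \<le> \<bar>a\<bar> + (\<bar>g a\<bar> + s)"
      using t that by simp
    also have "\<bar>g a\<bar> \<le> L * \<bar>a\<bar>" using gL[of a 0] g0 by simp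
    also have "\<bar>a\<bar> + (L * \<bar>a\<bar> + s) < h + (L * h + h)"
      using that L by (intro add_less_le_mono add_mono mult_left_mono) auto
    also have "\<dots> = (L + 2) * h" by (simp add: algebra_simps)
    finally show ?thesis using h by (simp add: dist_norm norm_minus_commute)
  qed
  have near: "\<bar>(x - p) \<bullet> t\<bar> < h \<and> - \<gamma> x < h" if "x \<in> ball p \<rho>" for x
  proof -
    have n: "norm (x - p) < \<rho>" using that by (simp add: dist_norm norm_minus_commute)
    have 1: "\<bar>(x - p) \<bullet> t\<bar> < \<rho>" "\<bar>(x - p) \<bullet> n\<bar> < \<rho>"
      using n Cauchy_Schwarz_ineq2[of "x - p" t] Cauchy_Schwarz_ineq2[of "x - p" n] t by auto
    have "\<bar>g ((x - p) \<bullet> t)\<bar> \<le> L * \<bar>(x - p) \<bullet> t\<bar>"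
      using gL[of "(x - p) \<bullet> t" 0] g0 by simp
    also have "\<dots> \<le> L * \<rho>" using 1 L by (intro mult_left_mono) auto
    finally have "- \<gamma> x < L * \<rho> + 2 * \<rho>" using 1 unfolding \<gamma>_def by linarith
    then show ?thesis using \<rho> \<rho>h 1 by (auto simp: algebra_simps)
  qed
  show ?thesis
  proof (rule that[OF \<rho>(1)])
    show "connected R"
      unfolding R_def \<Phi>_def case_prod_unfold
      by (intro connected_continuous_image connected_Times continuous_intros continuous_on_compose2[OF contg]) auto
    show "R \<subseteq> - closure \<Omega>"
    proof
      fix x assume "x \<in> R"
      then obtain a s where x: "x = \<Phi> (a, s)" "\<bar>a\<bar> < h" "0 < s" "s < h"
        by (auto simp: R_def)
      then have "x \<in> ball p r" "\<gamma> x < 0" using \<Phi>_ball \<gamma>\<Phi> by auto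
      then show "x \<in> - closure \<Omega>" using cl by force
    qed
    show "ball p \<rho> - closure \<Omega> \<subseteq> R"
    proof
      fix x assume x: "x \<in> ball p \<rho> - closure \<Omega>"
      then have "x \<in> ball p r" using \<rho>h hr by auto
      then have "\<gamma> x < 0" using ncl[of x] x by (meson DiffD2 not_le)
      then have "((x - p) \<bullet> t, - \<gamma> x) \<in> {-h<..<h} \<times> {0<..<h}"
        using near[of x] x by auto
      then show "x \<in> R" unfolding R_def using \<Phi>\<gamma>[of x] by (metis imageI)
    qed
    show "x \<in> closure R" if "x \<in> frontier \<Omega> \<inter> ball p \<rho>" for x
    proof -
      have xr: "x \<in> ball p r" using that \<rho>h hr by auto
      have "open (ball p r \<inter> {x. 0 < \<gamma> x})"
        by (intro open_Int open_ball open_Collect_less cont\<gamma> continuous_on_const)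
      moreover have "ball p r \<inter> {x. 0 < \<gamma> x} \<subseteq> \<Omega>"
        using in_\<Omega> by auto
      ultimately have "ball p r \<inter> {x. 0 < \<gamma> x} \<subseteq> interior \<Omega>"
        by (meson interior_maximal)
      then have "\<gamma> x \<le> 0"
        using that xr by (force simp: frontier_def)
      then have "\<gamma> x = 0"
        using cl[OF _ xr] that by (force simp: frontier_def)
      define a where "a = (x - p) \<bullet> t"
      have x: "x = \<Phi> (a, 0)" using \<Phi>\<gamma>[of x] \<open>\<gamma> x = 0\<close> by (simp add: a_def)
      have "\<bar>a\<bar> < h" using near[of x] that by (auto simp: a_def)
      \<comment> \<open>The denominators start at 2 because depths in \<open>R\<close> are strictly
        less than \<open>h\<close>.\<close>
      have lim: "(\<lambda>k. \<Phi> (a, h / real (Suc (Suc k)))) \<longlonglongrightarrow> \<Phi> (a, 0)"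
      proof -
        have "(\<lambda>k. h / real (Suc (Suc k))) \<longlonglongrightarrow> 0"
          by real_asymp
        moreover have "isCont (\<lambda>s. \<Phi> (a, s)) 0"
          unfolding \<Phi>_def by (auto intro!: continuous_intros)
        ultimately show ?thesis by (rule isCont_tendsto_compose[rotated])
      qed
      have "\<Phi> (a, h / real (Suc (Suc k))) \<in> R" for k
        unfolding R_def using \<open>\<bar>a\<bar> < h\<close> h(1) by (intro imageI) (auto simp: field_simps add_pos_nonneg)
      then show ?thesis
        unfolding x closure_sequential using lim
        by (intro exI[of _ "\<lambda>k. \<Phi> (a, h / real (Suc (Suc k)))"] conjI allI)
    qed
  qed
qed

text \<open>Were the exterior split into open parts \<open>A\<close> and \<open>B\<close>, their
  closures would meet at a frontier point. Near it the exterior lies in one connected subset of the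
  exterior, which cannot meet both parts.\<close>

lemma lipschitz_domain_exterior:
  assumes \<Omega>: "bounded_lipschitz_domain \<Omega>" and conn: "connected (- \<Omega>)"
  shows "connected (- closure \<Omega>)" "frontier \<Omega> \<subseteq> closure (- closure \<Omega>)"
proof -
  have loc: "\<exists>\<rho> R. \<rho> > 0 \<and> connected R \<and> R \<subseteq> - closure \<Omega> \<and> ball p \<rho> - closure \<Omega> \<subseteq> R \<and> p \<in> closure R"
    if p: "p \<in> frontier \<Omega>" for p
  proof -
    have "\<exists>t n r L g. norm t = 1 \<and> norm n = 1 \<and> t \<bullet> n = 0 \<and> r > 0 \<and> L-lipschitz_on UNIV (g :: real \<Rightarrow> real)
        \<and> (\<forall>x\<in>ball p r. x \<in> \<Omega> \<longleftrightarrow> (x - p) \<bullet> n > g ((x - p) \<bullet> t))"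
      using \<Omega> p unfolding bounded_lipschitz_domain_def by (elim conjE) (rule bspec)
    then obtain t n r L g where frame: "norm t = 1" "norm n = 1" "t \<bullet> n = 0" "r > 0"
        "L-lipschitz_on UNIV (g :: real \<Rightarrow> real)"
        and graph: "\<forall>x\<in>ball p r. x \<in> \<Omega> \<longleftrightarrow> (x - p) \<bullet> n > g ((x - p) \<bullet> t)"
      by (elim exE conjE) (rule that)
    obtain \<rho> R where "\<rho> > 0" "connected R" "R \<subseteq> - closure \<Omega>" "ball p \<rho> - closure \<Omega> \<subseteq> R"
      and "\<And>x. x \<in> frontier \<Omega> \<inter> ball p \<rho> \<Longrightarrow> x \<in> closure R"
      by (rule graph_exterior_locally_connected[OF frame bspec[OF graph] p that])
    then show ?thesis using p by (intro exI[of _ \<rho>] exI[of _ R]) auto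
  qed
  show front: "frontier \<Omega> \<subseteq> closure (- closure \<Omega>)"
  proof
    fix p assume "p \<in> frontier \<Omega>"
    from loc[OF this] obtain R where "R \<subseteq> - closure \<Omega>" "p \<in> closure R" by blast
    then show "p \<in> closure (- closure \<Omega>)" using closure_mono[of R] by blast
  qed
  show "connected (- closure \<Omega>)"
  proof (rule ccontr)
    assume "\<not> connected (- closure \<Omega>)"
    then obtain A' B' where AB': "open A'" "open B'" "- closure \<Omega> \<subseteq> A' \<union> B'" "A' \<inter> B' \<inter> - closure \<Omega> = {}"
        "A' \<inter> - closure \<Omega> \<noteq> {}" "B' \<inter> - closure \<Omega> \<noteq> {}"
      unfolding connected_def by blast
    define A where "A = A' \<inter> - closure \<Omega>"
    define B where "B = B' \<inter> - closure \<Omega>"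
    have AB: "open A" "open B" "A \<noteq> {}" "B \<noteq> {}" "A \<inter> B = {}" "A \<union> B = - closure \<Omega>"
      using AB' unfolding A_def B_def by (auto simp del: closed_closure intro!: open_Int open_Compl closed_closure)
    have open\<Omega>: "open \<Omega>" using \<Omega> by (simp add: bounded_lipschitz_domain_def)
    have sub: "closure A \<subseteq> - \<Omega>" "closure B \<subseteq> - \<Omega>"
      using AB(6) open\<Omega> closure_subset[of \<Omega>] by (intro closure_minimal; auto)+
    \<comment> \<open>Since the frontier is adherent to the exterior, the two closures cover all of
      \<open>- \<Omega>\<close>, and connectedness of that set makes them meet.\<close>
    have "- \<Omega> \<subseteq> closure A \<union> closure B"
    proof
      fix x assume "x \<in> - \<Omega>"
      then have "x \<in> - closure \<Omega> \<or> x \<in> frontier \<Omega>"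
        using open\<Omega> by (auto simp: frontier_def interior_open)
      then have "x \<in> closure (- closure \<Omega>)"
        using front closure_subset by blast
      then show "x \<in> closure A \<union> closure B"
        by (simp flip: AB(6))
    qed
    moreover have "closure A \<inter> - \<Omega> \<noteq> {}" "closure B \<inter> - \<Omega> \<noteq> {}"
      using AB(3,4) sub by (simp_all add: Int_absorb2)
    ultimately have "closure A \<inter> closure B \<inter> - \<Omega> \<noteq> {}"
      using connected_closedD[OF conn, of "closure A" "closure B"] by auto
    then obtain p where p: "p \<in> closure A" "p \<in> closure B"
      by auto
    have "A \<inter> closure B = {}" "B \<inter> closure A = {}"
      using AB(1,2,5) open_Int_closure_eq_empty[of A B] open_Int_closure_eq_empty[of B A] by auto
    then have "p \<notin> A" "p \<notin> B"
      using p by auto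
    then have "p \<in> frontier \<Omega>"
      using p sub AB(6) open\<Omega> by (auto simp: frontier_def interior_open)
    from loc[OF this] obtain \<rho> R where R: "\<rho> > 0" "connected R" "R \<subseteq> A \<union> B" "ball p \<rho> \<inter> (A \<union> B) \<subseteq> R"
      unfolding AB(6) Diff_eq by blast
    have "A \<inter> ball p \<rho> \<noteq> {}" "B \<inter> ball p \<rho> \<noteq> {}"
      using p R(1) open_Int_closure_eq_empty[OF open_ball, of p \<rho> A]
        open_Int_closure_eq_empty[OF open_ball, of p \<rho> B] centre_in_ball[of p \<rho>]
      by (metis Int_commute disjoint_iff)+
    then have "A \<inter> R \<noteq> {}" "B \<inter> R \<noteq> {}"
      using R(4) by auto
    then show False
      using connectedD[OF R(2) AB(1,2) _ R(3)] AB(5) by auto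
  qed
qed

section \<open>Bounded holomorphic functions on exterior domains\<close>

lemma norm_le_1_of_exterior_bounded:
  assumes "open D" and hol: "g holomorphic_on D" and cont: "continuous_on (closure D) g"
    and M: "\<And>z. z \<in> closure D \<Longrightarrow> norm (g z) \<le> M"
    and front: "\<And>z. z \<in> frontier D \<Longrightarrow> norm (g z) \<le> 1"
    and hole: "r > 0" "ball z0 r \<inter> D = {}" and z: "z \<in> D"
  shows "norm (g z) \<le> 1"
proof (rule ccontr)
  assume "\<not> norm (g z) \<le> 1"
  have far: "norm (w - z0) \<ge> r" if "w \<in> closure D" for w
  proof -
    have "ball z0 r \<inter> closure D = {}"
      using hole(2) open_Int_closure_eq_empty[OF open_ball] by blast
    then show ?thesis
      using that by (force simp: dist_norm norm_minus_commute)
  qed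
  \<comment> \<open>Phragmen-Lindelof: the factor \<open>r / (w - z0)\<close> vanishes at infinity and has modulus at most 1 on the
    frontier; its influence on the bound disappears as \<open>n\<close> grows.\<close>
  have bound: "norm (g z) ^ n \<le> norm (z - z0) / r" for n
  proof -
    define f where "f w = g w ^ n * (of_real r / (w - z0))" for w
    \<comment> \<open>Large enough for the disc to contain \<open>z\<close> and for
      \<open>M ^ n * r \<le> R\<close>, so that \<open>f\<close> is bounded by 1 on the outer circle
      as well.\<close>
    define R where "R = norm (z - z0) + r * max 0 M ^ n + 1"
    define S where "S = D \<inter> ball z0 R"
    have clS: "closure S \<subseteq> closure D" "interior S \<subseteq> D"
      unfolding S_def using interior_subset by (auto intro: closure_mono[THEN subsetD])
    have nz: "w \<noteq> z0" if "w \<in> closure D" for w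
      using far[OF that] hole(1) by auto
    have "norm (f z) \<le> 1"
    proof (rule maximum_modulus_frontier[of f S])
      show "f holomorphic_on interior S"
        unfolding f_def using clS nz closure_subset[of D]
        by (intro holomorphic_intros holomorphic_on_subset[OF hol]) auto
      show "continuous_on (closure S) f"
        unfolding f_def using clS nz by (intro continuous_intros continuous_on_subset[OF cont]) auto
      show "bounded S" unfolding S_def by (intro bounded_Int disjI2 bounded_ball)
      have "norm (z - z0) < R"
        unfolding R_def using hole(1) by (simp add: add_nonneg_pos)
      then show "z \<in> S" using z by (simp add: S_def dist_norm norm_minus_commute)
      fix w assume w: "w \<in> frontier S"
      then have wD: "w \<in> closure D" using clS by (auto simp: frontier_def)
      have nf: "norm (f w) = norm (g w) ^ n * r / norm (w - z0)"
        using hole(1) by (simp add: f_def norm_mult norm_divide norm_power)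
      have pos: "norm (w - z0) > 0" using nz[OF wD] by simp
      have "w \<in> frontier D \<or> w \<in> sphere z0 R"
        using w frontier_Int_subset[of D "ball z0 R"] hole(1) norm_ge_zero[of "z - z0"]
        \<open>norm (z - z0) < R\<close> by (auto simp: S_def)
      then show "norm (f w) \<le> 1"
      proof
        assume "w \<in> frontier D"
        then have "norm (g w) ^ n * r \<le> 1 * r"
          using front hole(1) by (intro mult_right_mono power_le_one) auto
        also have "\<dots> \<le> norm (w - z0)" using far[OF wD] by simp
        finally show ?thesis using pos by (simp add: nf)
      next
        assume "w \<in> sphere z0 R"
        then have wR: "norm (w - z0) = R" by (simp add: dist_norm norm_minus_commute)
        have "norm (g w) ^ n * r \<le> max 0 M ^ n * r"
          using M[OF wD] hole(1) by (intro mult_right_mono power_mono) auto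
        also have "\<dots> \<le> norm (w - z0)" unfolding wR R_def by (simp add: mult.commute)
        finally show ?thesis using pos by (simp add: nf)
      qed
    qed
    moreover have "z \<noteq> z0" using nz z closure_subset by blast
    ultimately show ?thesis
      using hole(1) by (simp add: f_def norm_mult norm_divide norm_power field_simps)
  qed
  obtain n where "norm (z - z0) / r < norm (g z) ^ n"
    using real_arch_pow \<open>\<not> norm (g z) \<le> 1\<close> by (meson not_le)
  with bound[of n] show False by simp
qed

text \<open>The functions \<open>exp (\<i> * Q)\<close> and \<open>exp (- \<i> * Q)\<close> are
  bounded and have modulus 1 on the frontier. The bound by 1 for both gives the two signs of
  \<open>Im (Q z)\<close>.\<close>

lemma Im_eq_0_of_exterior_bounded:
  assumes "open D" and hol: "Q holomorphic_on D" and cont: "continuous_on (closure D) Q"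
    and M: "\<And>z. z \<in> closure D \<Longrightarrow> norm (Q z) \<le> M"
    and front: "\<And>z. z \<in> frontier D \<Longrightarrow> Im (Q z) = 0"
    and hole: "r > 0" "ball z0 r \<inter> D = {}" and z: "z \<in> D"
  shows "Im (Q z) = 0"
proof -
  have "norm (exp (\<i> * of_real s * Q z)) \<le> 1" if s: "s \<in> {-1, 1}" for s :: real
  proof (rule norm_le_1_of_exterior_bounded[OF \<open>open D\<close> _ _ _ _ hole z])
    show "(\<lambda>z. exp (\<i> * of_real s * Q z)) holomorphic_on D"
      by (intro holomorphic_intros hol)
    show "continuous_on (closure D) (\<lambda>z. exp (\<i> * of_real s * Q z))"
      by (intro continuous_intros cont)
    show "norm (exp (\<i> * of_real s * Q w)) \<le> exp M" if "w \<in> closure D" for w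
      using M[OF that] abs_Im_le_cmod[of "Q w"] s by (auto simp: norm_exp_eq_Re)
    show "norm (exp (\<i> * of_real s * Q w)) \<le> 1" if "w \<in> frontier D" for w
      using front[OF that] by (simp add: norm_exp_eq_Re)
  qed
  from this[of 1] this[of "-1"] show ?thesis
    by (simp add: norm_exp_eq_Re)
qed

text \<open>By the open mapping theorem a nonconstant image would contain a disc, which is not
  contained in the real line.\<close>

lemma holomorphic_Im_eq_0_imp_constant:
  assumes hol: "f holomorphic_on S" and S: "open S" "connected S" and Im: "\<And>z. z \<in> S \<Longrightarrow> Im (f z) = 0"
  shows "f constant_on S"
proof (rule ccontr)
  assume nc: "\<not> f constant_on S"
  then have "S \<noteq> {}" by (auto simp: constant_on_def)
  have "open (f ` S)"
    using open_mapping_thm[OF hol S S(1) order_refl] nc by blast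
  moreover obtain z where z: "z \<in> S" using \<open>S \<noteq> {}\<close> by blast
  ultimately obtain e where e: "e > 0" "ball (f z) e \<subseteq> f ` S"
    by (meson image_eqI open_contains_ball)
  have "f z + \<i> * of_real (e / 2) \<in> ball (f z) e"
    using e(1) by (simp add: dist_norm norm_mult)
  then obtain w where "w \<in> S" "f z + \<i> * of_real (e / 2) = f w"
    using e(2) by blast
  then show False using Im[OF z] Im[of w] e(1) by (auto simp: complex_eq_iff)
qed

lemma quadratic_constant_on_frontier:
  fixes C :: "complex \<Rightarrow> complex"
  assumes "open \<Omega>" "bounded \<Omega>" "\<Omega> \<noteq> {}"
    and ext: "connected (- closure \<Omega>)" "frontier \<Omega> \<subseteq> closure (- closure \<Omega>)"
    and cont: "continuous_on UNIV C" and hol: "C holomorphic_on (- closure \<Omega>)"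
    and decay: "\<And>z. norm z \<ge> R \<Longrightarrow> norm (z * C z) \<le> K"
    and C: "\<And>z. z \<in> \<Omega> \<Longrightarrow> C z = cnj z + p * z + q"
  obtains \<gamma> where "\<And>z. z \<in> frontier \<Omega> \<Longrightarrow> (norm (cnj z + p * z + q))\<^sup>2 = \<gamma>"
proof -
  let ?D = "- closure \<Omega>"
  have clC: "C z = cnj z + p * z + q" if "z \<in> closure \<Omega>" for z
  proof -
    have "closed {z. C z = cnj z + p * z + q}"
      by (intro closed_Collect_eq cont continuous_intros)
    moreover have "\<Omega> \<subseteq> {z. C z = cnj z + p * z + q}" using C by auto
    ultimately have "closure \<Omega> \<subseteq> {z. C z = cnj z + p * z + q}"
      by (rule closure_minimal[rotated])
    then show ?thesis using that by blast
  qed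
  \<comment> \<open>On the frontier \<open>cnj z = C z - p z - q\<close>, which turns \<open>C * cnj C\<close> into a function that is
    holomorphic outside and bounded at infinity.\<close>
  define Q where "Q z = C z * (z + cnj p * (C z - p * z - q) + cnj q)" for z
  have Q_front: "Q z = of_real ((norm (cnj z + p * z + q))\<^sup>2)" if "z \<in> closure \<Omega>" for z
  proof -
    have "Q z = (cnj z + p * z + q) * cnj (cnj z + p * z + q)"
      using clC[OF that] by (simp add: Q_def)
    then show ?thesis by (simp only: complex_norm_square)
  qed
  have contQ: "continuous_on UNIV Q"
    unfolding Q_def by (intro continuous_intros cont)
  have holQ: "Q holomorphic_on ?D"
    unfolding Q_def by (intro holomorphic_intros hol)
  obtain M where M: "\<And>z. norm (Q z) \<le> M"
  proof -
    have "bounded (Q ` cball 0 (max R 1))"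
      by (intro compact_imp_bounded compact_continuous_image continuous_on_subset[OF contQ]) auto
    then obtain M1 where "\<forall>z\<in>cball 0 (max R 1). norm (Q z) \<le> M1"
      by (auto simp: bounded_iff)
    then have M1: "norm (Q z) \<le> M1" if "norm z \<le> max R 1" for z
      using that by simp
    have "norm (Q z) \<le> K + norm p * (K * K + norm p * K + norm q * K) + norm q * K" if z: "norm z \<ge> max R 1" for z
    proof -
      have zC: "norm (z * C z) \<le> K" using decay z by simp
      then have K: "K \<ge> 0" using norm_ge_zero order_trans by blast
      have "norm (C z) \<le> norm z * norm (C z)" using z mult_right_mono[of 1 "norm z" "norm (C z)"] by simp
      then have C1: "norm (C z) \<le> K" using zC by (simp add: norm_mult)
      \<comment> \<open>Grouped so that each factor \<open>z\<close> is paired with a factor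
        \<open>C z\<close>: all terms are products of constants with the bounded quantities
        \<open>z * C z\<close> and \<open>C z\<close>.\<close>
      have "Q z = z * C z + cnj p * (C z * C z - p * (z * C z) - q * C z) + cnj q * C z"
        by (simp add: Q_def algebra_simps)
      also have "norm \<dots> \<le> norm (z * C z) + norm (cnj p * (C z * C z - p * (z * C z) - q * C z)) + norm (cnj q * C z)"
        by (intro norm_triangle_mono order_refl)
      also have "\<dots> \<le> K + norm p * (K * K + norm p * K + norm q * K) + norm q * K"
      proof -
        have "norm (C z * C z - p * (z * C z) - q * C z) \<le> norm (C z * C z) + norm (p * (z * C z)) + norm (q * C z)"
          by (meson norm_triangle_ineq4 order_trans add_right_mono)
        also have "\<dots> \<le> K * K + norm p * K + norm q * K"
          unfolding norm_mult[of "C z"] norm_mult[of p] norm_mult[of q]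
          using zC C1 K by (intro add_mono mult_mono mult_left_mono) auto
        finally show ?thesis
          unfolding norm_mult[of "cnj p"] norm_mult[of "cnj q"]
          using zC C1 by (auto intro!: add_mono mult_left_mono)
      qed
      finally show ?thesis .
    qed
    then have "norm (Q z) \<le> max M1 (K + norm p * (K * K + norm p * K + norm q * K) + norm q * K)" for z
      using M1[of z] by (cases "norm z \<le> max R 1") (simp_all add: le_max_iff_disj)
    then show ?thesis using that by blast
  qed
  have openD: "open ?D" by auto
  have frontD: "frontier ?D \<subseteq> closure \<Omega>"
    using interior_subset[of "closure \<Omega>"] closed_closure[of \<Omega>]
    by (metis frontier_complement frontier_subset_closed)
  \<comment> \<open>Any disc inside \<Omega> is the hole that the maximum principle on the exterior
    requires.\<close>
  obtain z0 r where hole: "r > 0" "ball z0 r \<inter> ?D = {}"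
  proof -
    obtain z0 r where "r > 0" "ball z0 r \<subseteq> \<Omega>"
      using assms(1,3) open_contains_ball by blast
    then show ?thesis using that[of r z0] closure_subset[of \<Omega>] by blast
  qed
  have "Im (Q z) = 0" if "z \<in> ?D" for z
    by (rule Im_eq_0_of_exterior_bounded[OF openD holQ continuous_on_subset[OF contQ] M _ hole that])
      (use frontD Q_front in auto)
  then have "Q constant_on ?D"
    using holomorphic_Im_eq_0_imp_constant[OF holQ openD ext(1)] by blast
  then obtain c where c: "\<And>z. z \<in> ?D \<Longrightarrow> Q z = c"
    by (auto simp: constant_on_def)
  have "closed {z. Q z = c}"
    by (intro closed_Collect_eq contQ continuous_intros)
  moreover have "?D \<subseteq> {z. Q z = c}" using c by auto
  ultimately have "closure ?D \<subseteq> {z. Q z = c}"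
    by (rule closure_minimal[rotated])
  then have "Q z = c" if "z \<in> frontier \<Omega>" for z
    using that ext(2) by blast
  then have "(norm (cnj z + p * z + q))\<^sup>2 = Re c" if "z \<in> frontier \<Omega>" for z
    using that Q_front[of z] by (metis DiffD1 Re_complex_of_real frontier_def)
  then show ?thesis using that by blast
qed

section \<open>The Cauchy transform of a planar set\<close>

definition to_complex :: "real^2 \<Rightarrow> complex" where
  "to_complex x = Complex (x $ 1) (x $ 2)"

definition of_complex :: "complex \<Rightarrow> real^2" where
  "of_complex z = vector [Re z, Im z]"

lemma to_complex_of_complex [simp]: "to_complex (of_complex z) = z"
  by (simp add: to_complex_def of_complex_def)

lemma of_complex_to_complex [simp]: "of_complex (to_complex x) = x"
  by (simp add: to_complex_def of_complex_def vec_eq_iff forall_2)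

lemma linear_to_complex: "linear to_complex"
  by (rule linearI) (simp_all add: to_complex_def complex_eq_iff)

lemma linear_of_complex: "linear of_complex"
  by (rule linearI) (simp_all add: of_complex_def vec_eq_iff forall_2)

lemma norm_to_complex [simp]: "norm (to_complex x) = norm x"
  by (simp add: to_complex_def norm_vec_def L2_set_def sum_2 cmod_def)

lemma norm_of_complex [simp]: "norm (of_complex z) = norm z"
  using norm_to_complex[of "of_complex z"] by simp

lemmas to_complex_diff = linear_diff[OF linear_to_complex]

lemma continuous_on_to_complex [continuous_intros]:
  "continuous_on S f \<Longrightarrow> continuous_on S (\<lambda>x. to_complex (f x))"
  using linear_continuous_on[of to_complex UNIV] linear_to_complex
  by (auto simp: linear_conv_bounded_linear intro: continuous_on_compose2)

lemma continuous_on_of_complex [continuous_intros]: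
  "continuous_on S f \<Longrightarrow> continuous_on S (\<lambda>x. of_complex (f x))"
  using linear_continuous_on[of of_complex UNIV] linear_of_complex
  by (auto simp: linear_conv_bounded_linear intro: continuous_on_compose2)

lemma to_complex_measurable [measurable]: "to_complex \<in> borel_measurable borel"
  by (intro borel_measurable_continuous_onI continuous_intros)

lemma dyadic_shell:
  fixes t \<delta> :: real
  assumes "0 < t" "t < \<delta>"
  obtains j where "\<delta> / 2 ^ Suc j \<le> t" "t < \<delta> / 2 ^ j"
proof -
  obtain n where n: "\<delta> / t < 2 ^ n"
    using real_arch_pow[of 2 "\<delta> / t"] by auto
  define m where "m = (LEAST n. \<delta> / 2 ^ n \<le> t)"
  have ex: "\<delta> / 2 ^ n \<le> t"
    using n assms by (simp add: field_simps)
  then have m: "\<delta> / 2 ^ m \<le> t"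
    unfolding m_def by (rule LeastI)
  then have "m \<noteq> 0" using assms by (intro notI) simp
  then obtain j where j: "m = Suc j" by (cases m) auto
  then have "\<not> \<delta> / 2 ^ j \<le> t"
    using not_less_Least[of j "\<lambda>n. \<delta> / 2 ^ n \<le> t"] by (simp add: m_def)
  with m j show ?thesis using that by auto
qed

text \<open>On the \<open>j\<close>-th dyadic shell the integrand is at most
  \<open>2 ^ Suc j / \<delta>\<close>, and the shell lies in a disc of area
  \<open>pi * \<delta>\<^sup>2 / 4 ^ j\<close>; the series is geometric. The exact value is
  \<open>2 * pi * \<delta>\<close>, but only the linear decay in \<delta> matters.\<close>

lemma nn_integral_inverse_norm_ball:
  assumes "\<delta> > 0"
  shows "(\<integral>\<^sup>+x. ennreal (indicator (ball 0 \<delta>) x / norm (x :: real^2)) \<partial>lborel) \<le> ennreal (4 * pi * \<delta>)"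
proof -
  have "(\<integral>\<^sup>+x. ennreal (indicator (ball 0 \<delta>) x / norm (x :: real^2)) \<partial>lborel)
      \<le> (\<integral>\<^sup>+x. (\<Sum>j. ennreal (2 ^ Suc j / \<delta>) * indicator (ball 0 (\<delta> / 2 ^ j) :: (real^2) set) x) \<partial>lborel)"
  proof (rule nn_integral_mono)
    fix x :: "real^2"
    show "ennreal (indicator (ball 0 \<delta>) x / norm x) \<le> (\<Sum>j. ennreal (2 ^ Suc j / \<delta>) * indicator (ball 0 (\<delta> / 2 ^ j)) x)"
    proof (cases "x \<in> ball 0 \<delta> \<and> x \<noteq> 0")
      case True
      then obtain j where j: "\<delta> / 2 ^ Suc j \<le> norm x" "norm x < \<delta> / 2 ^ j"
        using dyadic_shell[of "norm x" \<delta>] by auto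
      have "1 / norm x \<le> 2 ^ Suc j / \<delta>"
        using j(1) assms True by (simp add: field_simps)
      define F where "F j = ennreal (2 ^ Suc j / \<delta>) * indicator (ball 0 (\<delta> / 2 ^ j)) x" for j
      have "ennreal (indicator (ball 0 \<delta>) x / norm x) \<le> F j"
        using j(2) True \<open>1 / norm x \<le> 2 ^ Suc j / \<delta>\<close> by (simp add: F_def ennreal_leI)
      also have "F j = sum F {j}"
        by simp
      also have "\<dots> \<le> (\<Sum>i. F i)"
        by (rule sum_le_suminf) auto
      finally show ?thesis unfolding F_def .
    qed auto
  qed
  also have "\<dots> = (\<Sum>j. \<integral>\<^sup>+x. ennreal (2 ^ Suc j / \<delta>) * indicator (ball 0 (\<delta> / 2 ^ j) :: (real^2) set) x \<partial>lborel)"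
    by (rule nn_integral_suminf) (intro borel_measurable_times_ennreal borel_measurable_const borel_measurable_indicator, simp)
  also have "\<dots> = (\<Sum>j. ennreal (4 * pi * \<delta> * (1 / 2) ^ Suc j))"
  proof (rule suminf_cong)
    fix j :: nat
    have "2 ^ Suc j / \<delta> * (pi * (\<delta> / 2 ^ j)\<^sup>2) = 4 * pi * \<delta> * (1 / 2) ^ Suc j"
      using assms by (simp add: power2_eq_square power_one_over field_simps)
    then show "(\<integral>\<^sup>+x. ennreal (2 ^ Suc j / \<delta>) * indicator (ball 0 (\<delta> / 2 ^ j) :: (real^2) set) x \<partial>lborel)
        = ennreal (4 * pi * \<delta> * (1 / 2) ^ Suc j)"
      using assms by (subst nn_integral_cmult_indicator)
        (simp_all add: emeasure_ball unit_ball_vol_2 flip: ennreal_mult del: power_Suc)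
  qed
  also have "\<dots> = ennreal (4 * pi * \<delta> * 1)"
    using assms by (intro suminf_ennreal_eq sums_mult power_half_series) auto
  finally show ?thesis by simp
qed

lemma inverse_norm_ball:
  fixes z :: "real^2"
  assumes "\<delta> > 0"
  shows "integrable lebesgue (\<lambda>x. indicator (ball z \<delta>) x / norm (x - z))"
    and "(LINT x|lebesgue. indicator (ball z \<delta>) x / norm (x - z)) \<le> 4 * pi * \<delta>"
proof -
  define f where "f x = indicator (ball 0 \<delta>) x / norm x" for x :: "real^2"
  have f_meas: "f \<in> borel_measurable borel"
    unfolding f_def by (intro borel_measurable_divide borel_measurable_indicator
        borel_measurable_continuous_onI continuous_intros) auto
  have nn: "(\<integral>\<^sup>+x. ennreal (f x) \<partial>lborel) \<le> ennreal (4 * pi * \<delta>)"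
    unfolding f_def by (rule nn_integral_inverse_norm_ball[OF assms])
  have f0: "f x \<ge> 0" for x by (simp add: f_def)
  have int: "integrable lborel f"
    using f_meas nn f0 by (intro integrableI_nonneg) (auto intro: le_less_trans)
  have "ennreal (LINT x|lborel. f x) = (\<integral>\<^sup>+x. ennreal (f x) \<partial>lborel)"
    by (rule nn_integral_eq_integral[OF int, symmetric]) (simp add: f0)
  with nn have "ennreal (LINT x|lborel. f x) \<le> ennreal (4 * pi * \<delta>)" by simp
  then have le: "(LINT x|lborel. f x) \<le> 4 * pi * \<delta>"
    using assms by (subst (asm) ennreal_le_iff) auto
  have eq: "(\<lambda>x. f (- z + x)) = (\<lambda>x. indicator (ball z \<delta>) x / norm (x - z))"
    by (auto simp: f_def indicator_def dist_norm norm_minus_commute)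
  note tr = lebesgue_integral_translate[OF f_meas, of "- z"]
  show "integrable lebesgue (\<lambda>x. indicator (ball z \<delta>) x / norm (x - z))"
    using tr(2) int f_meas unfolding eq by (simp add: integrable_completion)
  show "(LINT x|lebesgue. indicator (ball z \<delta>) x / norm (x - z)) \<le> 4 * pi * \<delta>"
    using tr(1) le f_meas unfolding eq by (simp add: integral_completion)
qed

lemma bounded_measurable_integrable_indicator:
  fixes A :: "'a::euclidean_space set"
  assumes "A \<in> sets lebesgue" "bounded A"
  shows "integrable lebesgue (indicator A :: 'a \<Rightarrow> real)"
  using bounded_set_imp_lmeasurable[OF assms(2,1)] by (auto simp: fmeasurable_def)

text \<open>Integration stays on \<open>real^2\<close>, where \<Omega> lives, while the argument is
  complex so that holomorphy makes sense. The convention \<open>1 / 0 = 0\<close> at the pole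
  concerns a single point \<open>y\<close>. There is no factor \<open>1 / pi\<close>; it is supplied
  at the end.\<close>

definition cauchy_transform :: "(real^2) set \<Rightarrow> complex \<Rightarrow> complex" where
  "cauchy_transform A z = (LINT y|lebesgue. indicator A y *\<^sub>R (1 / (z - to_complex y)))"

lemma norm_kernel: "norm (1 / (z - to_complex y)) = 1 / norm (y - of_complex z)"
proof -
  have "norm (z - to_complex y) = norm (of_complex z - y)"
    using norm_to_complex[of "of_complex z - y"] by (simp add: to_complex_diff)
  then show ?thesis by (simp add: norm_divide norm_minus_commute)
qed

lemma kernel_measurable: "(\<lambda>y. 1 / (z - to_complex y)) \<in> borel_measurable lebesgue"
  by (intro measurable_completion) measurable

text \<open>Within distance 1 of \<open>z\<close> the singularity is integrable in the plane;
  farther away the integrand is at most the indicator function of \<open>A\<close>.\<close>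

lemma integrable_inverse_norm:
  fixes A :: "(real^2) set"
  assumes A: "A \<in> sets lebesgue" "bounded A"
  shows "integrable lebesgue (\<lambda>y. indicator A y / norm (y - z))"
proof (rule Bochner_Integration.integrable_bound)
  show "integrable lebesgue (\<lambda>y. indicator (ball z 1) y / norm (y - z) + indicator A y)"
    by (intro Bochner_Integration.integrable_add inverse_norm_ball bounded_measurable_integrable_indicator A) simp
  have "(\<lambda>y. norm (y - z)) \<in> borel_measurable lebesgue"
    by (intro continuous_imp_lebesgue_measurable continuous_intros)
  with A(1) show "(\<lambda>y. indicator A y / norm (y - z)) \<in> borel_measurable lebesgue"
    by (intro borel_measurable_divide borel_measurable_indicator)
  have "indicator A y / norm (y - z) \<le> indicator (ball z 1) y / norm (y - z) + indicator A y" for y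
  proof (cases "y \<in> ball z 1")
    case False
    then have "norm (y - z) \<ge> 1" by (simp add: dist_norm norm_minus_commute)
    then show ?thesis by (auto simp: indicator_def divide_simps)
  qed (auto simp: indicator_def)
  then show "AE y in lebesgue. norm (indicator A y / norm (y - z))
      \<le> norm (indicator (ball z 1) y / norm (y - z) + indicator A y)"
    by (intro AE_I2) (simp add: indicator_def)
qed

lemma integrable_kernel:
  assumes A: "A \<in> sets lebesgue" "bounded A"
  shows "integrable lebesgue (\<lambda>y. indicator A y *\<^sub>R (1 / (z - to_complex y)))"
proof (rule Bochner_Integration.integrable_bound[OF integrable_inverse_norm[OF A, of "of_complex z"]])
  show "(\<lambda>y. indicator A y *\<^sub>R (1 / (z - to_complex y))) \<in> borel_measurable lebesgue"
    using A(1) by (intro borel_measurable_scaleR borel_measurable_indicator kernel_measurable)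
  show "AE y in lebesgue. norm (indicator A y *\<^sub>R (1 / (z - to_complex y)))
      \<le> norm (indicator A y / norm (y - of_complex z))"
    by (simp only: norm_scaleR norm_kernel) simp
qed

lemma norm_cauchy_transform_le:
  assumes A: "A \<in> sets lebesgue" "bounded A"
  shows "norm (cauchy_transform A z) \<le> (LINT y|lebesgue. indicator A y / norm (y - of_complex z))"
proof -
  have "norm (cauchy_transform A z) \<le> (LINT y|lebesgue. norm (indicator A y *\<^sub>R (1 / (z - to_complex y))))"
    unfolding cauchy_transform_def by (rule integral_norm_bound)
  also have "\<dots> = (LINT y|lebesgue. indicator A y / norm (y - of_complex z))"
    by (simp only: norm_scaleR norm_kernel) simp
  finally show ?thesis .
qed

lemma cauchy_transform_Un:
  assumes "A \<in> sets lebesgue" "bounded A" "B \<in> sets lebesgue" "bounded B" "A \<inter> B = {}"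
  shows "cauchy_transform (A \<union> B) z = cauchy_transform A z + cauchy_transform B z"
proof -
  have "indicator (A \<union> B) y *\<^sub>R (1 / (z - to_complex y))
      = indicator A y *\<^sub>R (1 / (z - to_complex y)) + indicator B y *\<^sub>R (1 / (z - to_complex y))" for y
    using assms(5) by (auto simp: indicator_def)
  then show ?thesis
    unfolding cauchy_transform_def
    by (simp only:) (intro Bochner_Integration.integral_add integrable_kernel assms)
qed

text \<open>Truncating the kernel near its pole leaves a bounded continuous kernel, whose transform
  is continuous by dominated convergence. The error is at most \<open>4 * pi * \<delta>\<close>,
  uniformly in \<open>z\<close>, so the transform is a uniform limit of continuous
  functions.\<close>

lemma continuous_on_cauchy_transform:
  assumes A: "A \<in> sets lebesgue" "bounded A"
  shows "continuous_on UNIV (cauchy_transform A)"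
proof -
  \<comment> \<open>truncated kernel, equal to \<open>1 / w\<close> for \<open>norm w \<ge> \<delta>\<close>\<close>
  define k where "k \<delta> w = cnj w / of_real ((max (norm w) \<delta>)\<^sup>2)" for \<delta> :: real and w :: complex
  have contk: "continuous_on UNIV (k \<delta>)" if "\<delta> > 0" for \<delta>
    unfolding k_def using that by (intro continuous_intros) (auto simp: max_def)
  have k_le: "norm (k \<delta> w) \<le> 1 / \<delta>" if "\<delta> > 0" for \<delta> w
  proof -
    have "norm (k \<delta> w) = norm w / (max (norm w) \<delta> * max (norm w) \<delta>)"
      by (simp add: k_def norm_divide power2_eq_square norm_mult)
    also have "\<dots> \<le> max (norm w) \<delta> / (max (norm w) \<delta> * max (norm w) \<delta>)"
      by (intro divide_right_mono) auto
    also have "\<dots> \<le> 1 / \<delta>"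
      using that by (simp add: field_simps max_def)
    finally show ?thesis .
  qed
  have k_diff: "norm (1 / w - k \<delta> w) \<le> indicator (ball 0 \<delta>) w / norm w" if "\<delta> > 0" for \<delta> w
  proof (cases "norm w < \<delta>")
    case False
    then have "k \<delta> w = 1 / w"
      using complex_norm_square[of w] by (cases "w = 0") (auto simp: k_def max_absorb1 divide_simps mult.commute)
    then show ?thesis by simp
  next
    case True
    show ?thesis
    proof (cases "w = 0")
      case False
      have eq: "1 / w - k \<delta> w = of_real (1 - (norm w)\<^sup>2 / \<delta>\<^sup>2) * (1 / w)"
      proof -
        have "of_real ((norm w)\<^sup>2) = w * cnj w" by (rule complex_norm_square)
        then have "of_real ((norm w)\<^sup>2 / \<delta>\<^sup>2) * (1 / w) = cnj w / of_real (\<delta>\<^sup>2)"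
          using False by simp
        then show ?thesis using True by (simp add: k_def max_absorb2 left_diff_distrib diff_divide_distrib)
      qed
      have "(norm w)\<^sup>2 \<le> \<delta>\<^sup>2" using True by (intro power_mono) auto
      then have "\<bar>1 - (norm w)\<^sup>2 / \<delta>\<^sup>2\<bar> \<le> 1"
        using that by (simp add: divide_simps abs_le_iff)
      then have "norm (1 / w - k \<delta> w) \<le> 1 * norm (1 / w)"
        unfolding eq norm_mult norm_of_real by (intro mult_right_mono) auto
      then show ?thesis using True by (simp add: norm_divide)
    qed (simp add: k_def)
  qed
  define C where "C \<delta> z = (LINT y|lebesgue. indicator A y *\<^sub>R k \<delta> (z - to_complex y))" for \<delta> z
  have int_A: "integrable lebesgue (\<lambda>y. indicator A y * c)" for c :: real
    by (intro integrable_mult_left bounded_measurable_integrable_indicator A)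
  have meas: "(\<lambda>y. indicator A y *\<^sub>R k \<delta> (z - to_complex y)) \<in> borel_measurable lebesgue" if "\<delta> > 0" for \<delta> z
    using A(1) that
    by (intro borel_measurable_scaleR borel_measurable_indicator continuous_imp_lebesgue_measurable
        continuous_on_compose2[OF contk] continuous_intros) auto
  have le_A: "norm (indicator A y *\<^sub>R k \<delta> (z - to_complex y)) \<le> indicator A y * (1 / \<delta>)" if "\<delta> > 0" for \<delta> z y
    using k_le[OF that] by (auto simp: indicator_def)
  have contC: "continuous_on UNIV (C \<delta>)" if "\<delta> > 0" for \<delta>
    unfolding continuous_on_sequentially
  proof (intro ballI allI impI)
    fix x and z :: complex
    assume "z \<in> UNIV" "(\<forall>n. x n \<in> UNIV) \<and> x \<longlonglongrightarrow> z"
    then have x: "x \<longlonglongrightarrow> z" by blast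
    have "(\<lambda>n. C \<delta> (x n)) \<longlonglongrightarrow> C \<delta> z"
      unfolding C_def
    proof (rule integral_dominated_convergence[OF meas[OF that] meas[OF that] int_A[of "1 / \<delta>"]])
      have "isCont (k \<delta>) w" for w
        using contk[OF that] continuous_on_eq_continuous_at open_UNIV by blast
      then have "(\<lambda>n. k \<delta> (x n - to_complex y)) \<longlonglongrightarrow> k \<delta> (z - to_complex y)" for y
        by (rule isCont_tendsto_compose) (intro tendsto_intros x)
      then show "AE y in lebesgue. (\<lambda>n. indicator A y *\<^sub>R k \<delta> (x n - to_complex y)) \<longlonglongrightarrow> indicator A y *\<^sub>R k \<delta> (z - to_complex y)"
        by (intro AE_I2 tendsto_scaleR tendsto_const)
    qed (use le_A[OF that] in auto)
    then show "(C \<delta> \<circ> x) \<longlonglongrightarrow> C \<delta> z" by (simp add: comp_def)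
  qed
  have diff: "norm (C \<delta> z - cauchy_transform A z) \<le> 4 * pi * \<delta>" if "\<delta> > 0" for \<delta> z
  proof -
    have int_k: "integrable lebesgue (\<lambda>y. indicator A y *\<^sub>R k \<delta> (z - to_complex y))"
      by (rule Bochner_Integration.integrable_bound[OF int_A[of "1 / \<delta>"] meas[OF that]])
        (use le_A[OF that] that in \<open>auto simp: indicator_def\<close>)
    have pt: "norm (1 / (z - to_complex y) - k \<delta> (z - to_complex y))
        \<le> indicator (ball (of_complex z) \<delta>) y / norm (y - of_complex z)" for y
    proof -
      have "norm (z - to_complex y) = norm (y - of_complex z)"
        using norm_to_complex[of "of_complex z - y"] by (simp add: to_complex_diff norm_minus_commute)
      then have "indicator (ball 0 \<delta>) (z - to_complex y) / norm (z - to_complex y)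
          = (indicator (ball (of_complex z) \<delta>) y / norm (y - of_complex z) :: real)"
        by (simp add: indicator_def dist_norm norm_minus_commute)
      with k_diff[OF that, of "z - to_complex y"] show ?thesis by simp
    qed
    have "norm (C \<delta> z - cauchy_transform A z) = norm (LINT y|lebesgue. indicator A y *\<^sub>R (1 / (z - to_complex y))
          - indicator A y *\<^sub>R k \<delta> (z - to_complex y))"
      unfolding C_def cauchy_transform_def
      by (subst Bochner_Integration.integral_diff) (auto intro: integrable_kernel A int_k simp: norm_minus_commute)
    also have "\<dots> \<le> (LINT y|lebesgue. norm (indicator A y *\<^sub>R (1 / (z - to_complex y))
          - indicator A y *\<^sub>R k \<delta> (z - to_complex y)))"
      by (rule integral_norm_bound)
    also have "\<dots> \<le> (LINT y|lebesgue. indicator (ball (of_complex z) \<delta>) y / norm (y - of_complex z))"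
    proof (rule integral_mono)
      show "integrable lebesgue (\<lambda>y. norm (indicator A y *\<^sub>R (1 / (z - to_complex y))
          - indicator A y *\<^sub>R k \<delta> (z - to_complex y)))"
        by (intro integrable_norm Bochner_Integration.integrable_diff integrable_kernel A int_k)
      show "norm (indicator A y *\<^sub>R (1 / (z - to_complex y)) - indicator A y *\<^sub>R k \<delta> (z - to_complex y))
          \<le> indicator (ball (of_complex z) \<delta>) y / norm (y - of_complex z)" for y
        using pt[of y] by (cases "y \<in> A") auto
    qed (rule inverse_norm_ball[OF that])
    also have "\<dots> \<le> 4 * pi * \<delta>" by (rule inverse_norm_ball[OF that])
    finally show ?thesis .
  qed
  show ?thesis
  proof (rule uniform_limit_theorem[OF _ _ trivial_limit_sequentially])
    show "\<forall>\<^sub>F n in sequentially. continuous_on UNIV (C (1 / real (Suc n)))"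
      by (intro always_eventually allI contC) simp
    show "uniform_limit UNIV (\<lambda>n. C (1 / real (Suc n))) (cauchy_transform A) sequentially"
      unfolding uniform_limit_iff
    proof (intro allI impI)
      fix e :: real assume "e > 0"
      have "(\<lambda>n. 4 * pi * (1 / real (Suc n))) \<longlonglongrightarrow> 0" by real_asymp
      then have "\<forall>\<^sub>F n in sequentially. 4 * pi * (1 / real (Suc n)) < e"
        using \<open>e > 0\<close> by (rule order_tendstoD)
      then show "\<forall>\<^sub>F n in sequentially. \<forall>z\<in>UNIV. dist (C (1 / real (Suc n)) z) (cauchy_transform A z) < e"
      proof eventually_elim
        case (elim n)
        show ?case
        proof
          fix z
          have "norm (C (1 / real (Suc n)) z - cauchy_transform A z) \<le> 4 * pi * (1 / real (Suc n))"
            by (rule diff) simp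
          with elim show "dist (C (1 / real (Suc n)) z) (cauchy_transform A z) < e"
            unfolding dist_norm by linarith
        qed
      qed
    qed
  qed
qed

text \<open>Differentiation under the integral, done by hand: the difference quotient differs from
  the expected derivative by exactly \<open>w - z\<close> times an integral that stays bounded
  because \<open>A\<close> is at positive distance.\<close>

lemma cauchy_transform_holomorphic:
  assumes A: "A \<in> sets lebesgue" "bounded A"
  shows "cauchy_transform A holomorphic_on - closure (to_complex ` A)"
proof -
  have "\<exists>D. (cauchy_transform A has_field_derivative D) (at z)" if z: "z \<in> - closure (to_complex ` A)" for z
  proof -
    obtain d' where "d' > 0" "ball z d' \<subseteq> - closure (to_complex ` A)"
      using z open_contains_ball[of "- closure (to_complex ` A)"] by auto
    \<comment> \<open>Half the radius, so that every \<open>w\<close> in \<open>ball z d\<close>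
      still has distance at least \<open>d\<close> from \<open>A\<close>.\<close>
    define d where "d = d' / 2"
    have d: "d > 0" "ball z (2 * d) \<subseteq> - closure (to_complex ` A)"
      using \<open>d' > 0\<close> \<open>ball z d' \<subseteq> - closure (to_complex ` A)\<close> by (simp_all add: d_def)
    have far: "norm (w - to_complex y) \<ge> d" if "w \<in> ball z d" "y \<in> A" for w y
    proof -
      have "to_complex y \<in> closure (to_complex ` A)"
        by (rule subsetD[OF closure_subset imageI[OF that(2)]])
      then have "to_complex y \<notin> ball z (2 * d)" using d(2) by (auto dest: subsetD)
      then have "2 * d \<le> norm (z - to_complex y)" by (simp add: dist_norm)
      also have "\<dots> \<le> norm (z - w) + norm (w - to_complex y)"
        using norm_triangle_ineq[of "z - w" "w - to_complex y"] by simp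
      finally show ?thesis using that(1) by (simp add: dist_norm)
    qed
    have zball: "z \<in> ball z d" using d by simp
    \<comment> \<open>One family for both integrals that occur: \<open>- I 1 z\<close> is the
      derivative and \<open>I 2 w\<close> the factor of \<open>w - z\<close> in the
      remainder.\<close>
    define I where "I n w = (LINT y|lebesgue. indicator A y *\<^sub>R (1 / (w - to_complex y) * (1 / (z - to_complex y)) ^ n))" for n w
    have int_A: "integrable lebesgue (\<lambda>y. indicator A y * c)" for c :: real
      by (intro integrable_mult_left bounded_measurable_integrable_indicator A)
    have le: "norm (indicator A y *\<^sub>R (1 / (w - to_complex y) * (1 / (z - to_complex y)) ^ n))
        \<le> indicator A y * (1 / d ^ Suc n)" if "w \<in> ball z d" for w y n
    proof (cases "y \<in> A")
      case True
      have "1 / norm (w - to_complex y) \<le> 1 / d" "1 / norm (z - to_complex y) \<le> 1 / d"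
        using far[OF that True] far[OF zball True] d(1) by (simp_all add: frac_le)
      then have "1 / norm (w - to_complex y) * (1 / norm (z - to_complex y)) ^ n \<le> 1 / d * (1 / d) ^ n"
        using d(1) by (intro mult_mono power_mono) simp_all
      then show ?thesis
        using True by (simp add: norm_mult norm_divide norm_power power_one_over)
    qed simp
    have int: "integrable lebesgue (\<lambda>y. indicator A y *\<^sub>R (1 / (w - to_complex y) * (1 / (z - to_complex y)) ^ n))"
      if "w \<in> ball z d" for w n
    proof (rule Bochner_Integration.integrable_bound[OF int_A[of "1 / d ^ Suc n"]])
      show "(\<lambda>y. indicator A y *\<^sub>R (1 / (w - to_complex y) * (1 / (z - to_complex y)) ^ n)) \<in> borel_measurable lebesgue"
        using A(1) by (intro borel_measurable_scaleR borel_measurable_indicator borel_measurable_times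
            borel_measurable_power kernel_measurable)
      show "AE y in lebesgue. norm (indicator A y *\<^sub>R (1 / (w - to_complex y) * (1 / (z - to_complex y)) ^ n))
          \<le> norm (indicator A y * (1 / d ^ Suc n))"
        by (intro AE_I2 order_trans[OF le[OF that]]) (simp only: real_norm_def abs_ge_self)
    qed
    have quot: "norm ((cauchy_transform A w - cauchy_transform A z) / (w - z) - (- I 1 z))
        \<le> norm (w - z) * (LINT y|lebesgue. indicator A y * (1 / d ^ 3))"
      if w: "w \<in> ball z d" "w \<noteq> z" for w
    proof -
      have "(1 / (w - to_complex y) - 1 / (z - to_complex y)) / (w - z) + 1 / (z - to_complex y) * (1 / (z - to_complex y))
          = (w - z) * (1 / (w - to_complex y) * (1 / (z - to_complex y)) ^ 2)" if "y \<in> A" for y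
      proof -
        have nz: "w - to_complex y \<noteq> 0" "z - to_complex y \<noteq> 0" "w - z \<noteq> 0"
          using far[OF w(1) that] far[OF zball that] d(1) w(2) by auto
        have 1: "(1 / a - 1 / b) / (a - b) = - (1 / a * (1 / b))"
          if "a \<noteq> 0" "b \<noteq> 0" "a - b \<noteq> 0" for a b :: complex
          using that by (simp add: divide_simps)
        have 2: "- (1 / a * (1 / b)) + 1 / b * (1 / b) = (a - b) * (1 / a * (1 / b) ^ 2)"
          if "a \<noteq> 0" "b \<noteq> 0" for a b :: complex
          using that by (simp add: divide_simps power2_eq_square)
        show ?thesis
          using 1[OF nz(1,2)] 2[OF nz(1,2)] nz(3) by simp
      qed
      then have eq: "indicator A y *\<^sub>R ((1 / (w - to_complex y) - 1 / (z - to_complex y)) / (w - z) + 1 / (z - to_complex y) * (1 / (z - to_complex y)))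
          = (w - z) * (indicator A y *\<^sub>R (1 / (w - to_complex y) * (1 / (z - to_complex y)) ^ 2))" for y
        by (cases "y \<in> A") auto
      have "(cauchy_transform A w - cauchy_transform A z) / (w - z) - (- I 1 z) = (LINT y|lebesgue.
         indicator A y *\<^sub>R ((1 / (w - to_complex y) - 1 / (z - to_complex y)) / (w - z) + 1 / (z - to_complex y) * (1 / (z - to_complex y))))"
      proof -
        have e1: "indicator A y *\<^sub>R ((1 / (w - to_complex y) - 1 / (z - to_complex y)) / (w - z) + 1 / (z - to_complex y) * (1 / (z - to_complex y)))
          = (indicator A y *\<^sub>R (1 / (w - to_complex y)) - indicator A y *\<^sub>R (1 / (z - to_complex y))) / (w - z)
            + indicator A y *\<^sub>R (1 / (z - to_complex y) * (1 / (z - to_complex y)) ^ 1)" for y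
          by (cases "y \<in> A") auto
        note ints = integrable_kernel[OF A, of w] integrable_kernel[OF A, of z]
        note ints' = integrable_divide_zero[OF Bochner_Integration.integrable_diff[OF ints], of "w - z"]
        show ?thesis
          unfolding e1 Bochner_Integration.integral_add[OF ints' int[OF zball]] integral_divide_zero
            Bochner_Integration.integral_diff[OF ints]
          by (simp only: cauchy_transform_def I_def minus_minus diff_minus_eq_add)
      qed
      also have "\<dots> = (w - z) * I 2 w"
        unfolding eq I_def by (rule integral_mult_right_zero)
      also have "norm \<dots> \<le> norm (w - z) * (LINT y|lebesgue. indicator A y * (1 / d ^ 3))"
        unfolding norm_mult I_def
      proof (intro mult_left_mono order_trans[OF integral_norm_bound] integral_mono)
        show "integrable lebesgue (\<lambda>y. norm (indicator A y *\<^sub>R (1 / (w - to_complex y) * (1 / (z - to_complex y)) ^ 2)))"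
          by (rule integrable_norm[OF int[OF w(1)]])
        show "norm (indicator A y *\<^sub>R (1 / (w - to_complex y) * (1 / (z - to_complex y)) ^ 2)) \<le> indicator A y * (1 / d ^ 3)" for y
          using le[OF w(1), of y 2] by (simp add: numeral_eq_Suc)
      qed (simp_all only: int_A norm_ge_zero)
      finally show ?thesis .
    qed
    have bd: "\<forall>\<^sub>F w in at z. norm ((cauchy_transform A w - cauchy_transform A z) / (w - z) - (- I 1 z))
        \<le> norm (w - z) * (LINT y|lebesgue. indicator A y * (1 / d ^ 3))"
      unfolding eventually_at
    proof (intro exI[of _ d] conjI ballI impI d(1))
      fix w assume "w \<noteq> z \<and> dist w z < d"
      then show "norm ((cauchy_transform A w - cauchy_transform A z) / (w - z) - (- I 1 z))
          \<le> norm (w - z) * (LINT y|lebesgue. indicator A y * (1 / d ^ 3))"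
        by (intro quot) (simp_all add: dist_commute)
    qed
    have "((\<lambda>w. norm (w - z) * (LINT y|lebesgue. indicator A y * (1 / d ^ 3))) \<longlongrightarrow> norm (z - z) * (LINT y|lebesgue. indicator A y * (1 / d ^ 3))) (at z)"
      by (intro tendsto_intros)
    then have "((\<lambda>w. norm (w - z) * (LINT y|lebesgue. indicator A y * (1 / d ^ 3))) \<longlongrightarrow> 0) (at z)"
      by simp
    from Lim_null_comparison[OF bd this]
    have "((\<lambda>w. (cauchy_transform A w - cauchy_transform A z) / (w - z)) \<longlongrightarrow> - I 1 z) (at z)"
      by (rule LIM_zero_cancel)
    then show ?thesis
      unfolding has_field_derivative_iff by (rule exI)
  qed
  then show ?thesis
    unfolding holomorphic_on_open[OF open_Compl[OF closed_closure]] by (rule ballI)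
qed

text \<open>If \<open>A\<close> lies in the disc of radius \<open>r\<close> and
  \<open>norm z \<ge> 2 * r\<close>, then all points of \<open>A\<close> have distance at least
  \<open>norm z / 2\<close> from \<open>z\<close>. Hence \<open>K\<close> can be twice the area of
  \<open>A\<close>.\<close>

lemma cauchy_transform_decay:
  assumes A: "A \<in> sets lebesgue" "bounded A"
  obtains R K where "\<And>z. norm z \<ge> R \<Longrightarrow> norm (z * cauchy_transform A z) \<le> K"
proof -
  obtain r where r: "r > 0" "\<And>y. y \<in> A \<Longrightarrow> norm y \<le> r"
    using A(2) by (auto simp: bounded_pos)
  have "norm (z * cauchy_transform A z) \<le> (LINT y|lebesgue. indicator A y * 2)" if z: "norm z \<ge> 2 * r" for z
  proof -
    have pt: "norm z * (indicator A y / norm (y - of_complex z)) \<le> indicator A y * 2" for y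
    proof (cases "y \<in> A")
      case True
      have "norm z \<le> norm (y - of_complex z) + norm y"
        using norm_triangle_ineq4[of y "y - of_complex z"] by simp
      then have "norm z \<le> 2 * norm (y - of_complex z)" using r(2)[OF True] z by linarith
      moreover have "norm (y - of_complex z) > 0"
        using r z calculation by linarith
      ultimately show ?thesis using True by (simp add: field_simps)
    qed simp
    have "norm (z * cauchy_transform A z) \<le> norm z * (LINT y|lebesgue. indicator A y / norm (y - of_complex z))"
      unfolding norm_mult by (intro mult_left_mono norm_cauchy_transform_le A) simp
    also have "\<dots> = (LINT y|lebesgue. norm z * (indicator A y / norm (y - of_complex z)))"
      by (rule integral_mult_right_zero[symmetric])
    also have "\<dots> \<le> (LINT y|lebesgue. indicator A y * 2)"
      by (intro integral_mono integrable_mult_right integrable_mult_left integrable_inverse_norm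
          bounded_measurable_integrable_indicator A pt)
    finally show ?thesis .
  qed
  then show ?thesis using that by blast
qed

section \<open>The Cauchy transform inside the set\<close>

definition rotation :: "complex \<Rightarrow> real^2 \<Rightarrow> real^2" where
  "rotation \<omega> y = of_complex (\<omega> * to_complex y)"

lemma to_complex_rotation [simp]: "to_complex (rotation \<omega> y) = \<omega> * to_complex y"
  by (simp add: rotation_def)

lemma norm_rotation [simp]: "norm \<omega> = 1 \<Longrightarrow> norm (rotation \<omega> y) = norm y"
  by (simp add: rotation_def norm_mult)

lemma orthogonal_transformation_rotation:
  assumes "norm \<omega> = 1"
  shows "orthogonal_transformation (rotation \<omega>)"
proof -
  have "linear (rotation \<omega>)"
    unfolding rotation_def
    by (rule linearI) (simp_all add: linear_add[OF linear_to_complex] linear_add[OF linear_of_complex]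
        linear_cmul[OF linear_to_complex] linear_cmul[OF linear_of_complex] distrib_left)
  then show ?thesis
    using assms by (simp add: orthogonal_transformation)
qed

text \<open>Lebesgue measure is determined by its values on boxes. The preimage of a box is its
  image under the inverse rotation, and orthogonal maps preserve measure.\<close>

lemma lborel_distr_rotation:
  assumes \<omega>: "norm \<omega> = 1"
  shows "distr lborel borel (rotation \<omega>) = lborel"
proof (rule lborel_eqI[symmetric])
  have meas [measurable]: "rotation \<omega> \<in> borel_measurable borel"
    unfolding rotation_def by (intro borel_measurable_continuous_onI continuous_intros)
  fix l u :: "real^2" assume lu: "\<And>b. b \<in> Basis \<Longrightarrow> l \<bullet> b \<le> u \<bullet> b"
  have \<omega>': "norm (inverse \<omega>) = 1" "\<omega> \<noteq> 0" using \<omega> by (auto simp: norm_inverse)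
  have vim: "rotation \<omega> -` box l u = rotation (inverse \<omega>) ` box l u"
  proof (intro equalityI subsetI)
    fix y assume "y \<in> rotation \<omega> -` box l u"
    then have "rotation (inverse \<omega>) (rotation \<omega> y) \<in> rotation (inverse \<omega>) ` box l u"
      by (intro imageI) simp
    moreover have "rotation (inverse \<omega>) (rotation \<omega> y) = y"
      using \<omega>'(2) by (simp add: rotation_def flip: mult.assoc)
    ultimately show "y \<in> rotation (inverse \<omega>) ` box l u" by simp
  next
    fix y assume "y \<in> rotation (inverse \<omega>) ` box l u"
    then obtain x where "x \<in> box l u" "y = rotation (inverse \<omega>) x" by (rule imageE)
    moreover have "rotation \<omega> (rotation (inverse \<omega>) x) = x"
      using \<omega>'(2) by (simp add: rotation_def flip: mult.assoc)
    ultimately show "y \<in> rotation \<omega> -` box l u" by simp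
  qed
  have lm: "box l u \<in> lmeasurable" by simp
  note orth = orthogonal_transformation_rotation[OF \<omega>'(1)]
  have "emeasure (distr lborel borel (rotation \<omega>)) (box l u) = emeasure lborel (rotation (inverse \<omega>) ` box l u)"
    using emeasure_distr[of "rotation \<omega>" lborel borel "box l u"] meas by (simp flip: vim)
  also have "\<dots> = emeasure lebesgue (rotation (inverse \<omega>) ` box l u)"
    proof -
      have "rotation \<omega> -` box l u \<in> sets borel"
        using measurable_sets[OF meas, of "box l u"] by simp
      then show ?thesis by (simp flip: vim)
    qed
  also have "\<dots> = ennreal (measure lebesgue (box l u))"
    unfolding measure_orthogonal_image[OF orth lm, symmetric]
    by (rule emeasure_eq_measure2[OF measurable_orthogonal_image[OF orth lm]])
  also have "\<dots> = ennreal (\<Prod>b\<in>Basis. (u - l) \<bullet> b)"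
    using lu by (simp add: measure_lborel_box_eq inner_diff_left)
  finally show "emeasure (distr lborel borel (rotation \<omega>)) (box l u) = ennreal (\<Prod>b\<in>Basis. (u - l) \<bullet> b)" .
qed simp

lemma kernel_borel_measurable:
  "A \<in> sets borel \<Longrightarrow> (\<lambda>y. indicator A y *\<^sub>R (1 / (z - to_complex y))) \<in> borel_measurable borel"
  by (intro borel_measurable_scaleR borel_measurable_indicator, assumption) measurable

text \<open>Substitute \<open>\<omega> * y\<close> for \<open>y\<close>. Consequently
  \<open>w * C w\<close>, with \<open>C\<close> the transform of a rotation invariant set, depends
  only on \<open>norm w\<close>; this takes the place of polar coordinates.\<close>

lemma cauchy_transform_rotation:
  assumes \<omega>: "norm \<omega> = 1" and A: "A \<in> sets borel" "\<And>y. rotation \<omega> y \<in> A \<longleftrightarrow> y \<in> A"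
  shows "\<omega> * cauchy_transform A (\<omega> * z) = cauchy_transform A z"
proof -
  have \<omega>0: "\<omega> \<noteq> 0" using \<omega> by auto
  have meas: "rotation \<omega> \<in> borel_measurable borel"
    unfolding rotation_def by (intro borel_measurable_continuous_onI continuous_intros)
  have "cauchy_transform A (\<omega> * z)
      = (LINT y|lebesgue. indicator A (rotation \<omega> y) *\<^sub>R (1 / (\<omega> * z - to_complex (rotation \<omega> y))))"
    unfolding cauchy_transform_def
    by (rule lebesgue_integral_measure_preserving(1)[OF lborel_distr_rotation[OF \<omega>] meas
          kernel_borel_measurable[OF A(1)], symmetric])
  also have "\<dots> = (LINT y|lebesgue. (1 / \<omega>) * (indicator A y *\<^sub>R (1 / (z - to_complex y))))"
  proof (rule Bochner_Integration.integral_cong[OF refl])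
    fix y
    have "indicator A (rotation \<omega> y) = (indicator A y :: real)"
      using A(2)[of y] by (simp add: indicator_def)
    moreover have "1 / (\<omega> * z - to_complex (rotation \<omega> y)) = (1 / \<omega>) * (1 / (z - to_complex y))"
      by (simp flip: right_diff_distrib)
    ultimately show "indicator A (rotation \<omega> y) *\<^sub>R (1 / (\<omega> * z - to_complex (rotation \<omega> y)))
        = (1 / \<omega>) * (indicator A y *\<^sub>R (1 / (z - to_complex y)))"
      by (simp only: mult_scaleR_right)
  qed
  also have "\<dots> = (1 / \<omega>) * cauchy_transform A z"
    unfolding cauchy_transform_def by (rule integral_mult_right_zero)
  finally show ?thesis using \<omega>0 by simp
qed

text \<open>\<open>G\<close> takes one value on the whole circle through \<open>z0\<close>, a set
  with limit points, so the identity theorem applies.\<close>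

lemma radial_holomorphic_constant:
  assumes hol: "G holomorphic_on S" and S: "open S" "connected S"
    and rad: "\<And>\<omega>. norm \<omega> = 1 \<Longrightarrow> \<omega> * z0 \<in> S \<and> G (\<omega> * z0) = G z0"
    and "z0 \<noteq> 0" "z \<in> S"
  shows "G z = G z0"
proof -
  have sphere: "w \<in> S \<and> G w = G z0" if "w \<in> sphere (0::complex) (norm z0)" for w
  proof -
    have "norm (w / z0) = 1" "w = w / z0 * z0"
      using that \<open>z0 \<noteq> 0\<close> by (auto simp: norm_divide)
    then show ?thesis using rad[of "w / z0"] by simp
  qed
  have "- z0 \<noteq> z0" using \<open>z0 \<noteq> 0\<close> by (simp add: neg_equal_iff_equal)
  then have "sphere (0::complex) (norm z0) \<noteq> {x}" for x
  proof -
    have "z0 \<in> sphere (0::complex) (norm z0)" "- z0 \<in> sphere (0::complex) (norm z0)" by auto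
    then show ?thesis
      using \<open>- z0 \<noteq> z0\<close> by (intro notI) (simp only: singleton_iff)
  qed
  then have lim: "z0 islimpt sphere (0::complex) (norm z0)"
    by (intro connected_imp_perfect connected_sphere) auto
  have "(\<lambda>z. G z - G z0) holomorphic_on S"
    by (intro holomorphic_intros hol)
  moreover have "sphere (0::complex) (norm z0) \<subseteq> S"
    using sphere by (intro subsetI) (rule conjunct1)
  moreover have "z0 \<in> S"
    using sphere[of z0] by simp
  moreover have "G w - G z0 = 0" if "w \<in> sphere 0 (norm z0)" for w
    using conjunct2[OF sphere[OF that]] by (rule right_minus_eq[THEN iffD2])
  ultimately have "G z - G z0 = 0"
    by (rule analytic_continuation[OF _ S _ _ lim _ \<open>z \<in> S\<close>])
  then show ?thesis by (rule right_minus_eq[THEN iffD1])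
qed

text \<open>Outside the disc \<open>w * C w\<close> is holomorphic and rotation invariant, hence
  constant. Its limit at infinity is the area of the disc, and continuity of the transform adds the
  boundary circle.\<close>

lemma cauchy_transform_disc_outside:
  assumes \<rho>: "\<rho> > 0" and z: "norm z \<ge> \<rho>"
  shows "z * cauchy_transform (ball 0 \<rho>) z = of_real (pi * \<rho>\<^sup>2)"
proof -
  let ?C = "cauchy_transform (ball 0 \<rho>)"
  define S where "S = - cball (0::complex) \<rho>"
  have meas: "ball (0::real^2) \<rho> \<in> sets lebesgue" "bounded (ball (0::real^2) \<rho>)"
    by auto
  have S: "open S" "connected S"
    unfolding S_def by (auto intro!: connected_complement_bounded_convex)
  have "closure (to_complex ` ball 0 \<rho>) \<subseteq> cball 0 \<rho>"
    by (rule closure_minimal) auto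
  then have "?C holomorphic_on S"
    unfolding S_def by (intro holomorphic_on_subset[OF cauchy_transform_holomorphic[OF meas]]) auto
  then have hol: "(\<lambda>w. w * ?C w) holomorphic_on S"
    by (intro holomorphic_intros)
  have rot: "\<omega> * w * ?C (\<omega> * w) = w * ?C w" if "norm \<omega> = 1" for \<omega> w
    using cauchy_transform_rotation[OF that, of "ball 0 \<rho>" w] that
    by (simp add: mult.assoc mult.left_commute[of \<omega>])
  define c where "c = of_real (2 * \<rho>) * ?C (of_real (2 * \<rho>))"
  have const: "w * ?C w = c" if "w \<in> S" for w
    unfolding c_def
  proof (rule radial_holomorphic_constant[OF hol S _ _ that])
    show "\<omega> * of_real (2 * \<rho>) \<in> S \<and> \<omega> * of_real (2 * \<rho>) * ?C (\<omega> * of_real (2 * \<rho>))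
        = of_real (2 * \<rho>) * ?C (of_real (2 * \<rho>))" if "norm \<omega> = 1" for \<omega>
      using rot[OF that, of "of_real (2 * \<rho>)"] that \<rho> by (simp add: S_def norm_mult)
  qed (use \<rho> in auto)
  have "c = of_real (pi * \<rho>\<^sup>2)"
  proof -
    \<comment> \<open>Points tending to infinity along the real axis. Starting at
      \<open>2 * \<rho>\<close> keeps their distance from every \<open>y\<close> in the disc at
      least \<open>norm (w n) / 2\<close>, so 2 is a dominating constant.\<close>
    define w where "w n = complex_of_real (2 * \<rho> + real n)" for n
    have w: "norm (w n) = 2 * \<rho> + real n" for n
      using \<rho> unfolding w_def norm_of_real by simp
    have "(\<lambda>n. LINT y|lebesgue. indicator (ball 0 \<rho>) y *\<^sub>R (w n * (1 / (w n - to_complex y))))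
        \<longlonglongrightarrow> (LINT y|lebesgue. indicator (ball (0::real^2) \<rho>) y *\<^sub>R 1)"
    proof (rule integral_dominated_convergence)
      show "integrable lebesgue (\<lambda>y. indicator (ball 0 \<rho> :: (real^2) set) y * 2 :: real)"
        by (intro integrable_mult_left bounded_measurable_integrable_indicator meas)
      show "(\<lambda>y. indicator (ball 0 \<rho>) y *\<^sub>R (w n * (1 / (w n - to_complex y)))) \<in> borel_measurable lebesgue" for n
        by (intro borel_measurable_scaleR borel_measurable_indicator borel_measurable_times kernel_measurable meas borel_measurable_const)
      show "(\<lambda>y. indicator (ball 0 \<rho> :: (real^2) set) y *\<^sub>R (1::complex)) \<in> borel_measurable lebesgue"
        by (intro borel_measurable_scaleR borel_measurable_indicator meas borel_measurable_const)
      have far: "norm (w n - to_complex y) \<ge> norm (w n) / 2" if "y \<in> ball 0 \<rho>" for n y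
        using norm_triangle_ineq2[of "w n" "to_complex y"] that w[of n] by (simp add: field_simps)
      show "AE y in lebesgue. norm (indicator (ball 0 \<rho>) y *\<^sub>R (w n * (1 / (w n - to_complex y)))) \<le> indicator (ball 0 \<rho>) y * 2" for n
      proof (rule AE_I2)
        fix y :: "real^2"
        show "norm (indicator (ball 0 \<rho>) y *\<^sub>R (w n * (1 / (w n - to_complex y)))) \<le> indicator (ball 0 \<rho>) y * 2"
        proof (cases "y \<in> ball 0 \<rho>")
          case True
          have "norm (w n) / norm (w n - to_complex y) \<le> norm (w n) / (norm (w n) / 2)"
            using far[OF True, of n] w[of n] \<rho> by (intro divide_left_mono mult_pos_pos) auto
          also have "\<dots> \<le> 2" by simp
          finally show ?thesis using True by (simp add: norm_mult norm_divide)
        qed simp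
      qed
      show "AE y in lebesgue. (\<lambda>n. indicator (ball 0 \<rho>) y *\<^sub>R (w n * (1 / (w n - to_complex y)))) \<longlonglongrightarrow> indicator (ball 0 \<rho>) y *\<^sub>R 1"
      proof (intro AE_I2 tendsto_scaleR tendsto_const)
        fix y :: "real^2"
        have inf: "filterlim w at_infinity sequentially"
          unfolding filterlim_at_infinity_conv_norm_at_top w by real_asymp
        then have "((\<lambda>n. to_complex y / w n) \<longlonglongrightarrow> 0)"
          by (intro tendsto_divide_0[OF tendsto_const])
        then have "(\<lambda>n. 1 / (1 - to_complex y / w n)) \<longlonglongrightarrow> 1 / (1 - 0)"
          by (intro tendsto_intros) auto
        moreover have "w n * (1 / (w n - to_complex y)) = 1 / (1 - to_complex y / w n)" for n
        proof -
          have "w n \<noteq> 0" using w[of n] \<rho> by auto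
          then have "1 - to_complex y / w n = (w n - to_complex y) / w n" by (simp add: diff_divide_distrib)
          then show ?thesis by simp
        qed
        ultimately show "(\<lambda>n. w n * (1 / (w n - to_complex y))) \<longlonglongrightarrow> 1"
          by simp
      qed
    qed
    moreover have "(LINT y|lebesgue. indicator (ball 0 \<rho>) y *\<^sub>R (w n * (1 / (w n - to_complex y)))) = w n * ?C (w n)" for n
      unfolding cauchy_transform_def
      by (subst integral_mult_right_zero[symmetric]) (simp only: mult_scaleR_right)
    moreover have "w n * ?C (w n) = c" for n
      using w[of n] \<rho> by (intro const) (simp add: S_def)
    moreover have "(LINT y|lebesgue. indicator (ball (0::real^2) \<rho>) y *\<^sub>R (1::complex)) = of_real (pi * \<rho>\<^sup>2)"
    proof -
      have "(LINT y|lebesgue. indicator (ball (0::real^2) \<rho>) y *\<^sub>R (1::complex))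
          = (LINT y|lebesgue. indicator (ball (0::real^2) \<rho>) y) *\<^sub>R (1::complex)"
        by (intro integral_scaleR_left bounded_measurable_integrable_indicator meas)
      then show ?thesis
        using \<rho> by (simp add: content_ball unit_ball_vol_2 scaleR_conv_of_real)
    qed
    ultimately show ?thesis by (simp add: LIMSEQ_const_iff)
  qed
  moreover have "z * ?C z = c"
  proof -
    \<comment> \<open>\<open>z\<close> may lie on the circle itself, so it is approached from
      strictly outside.\<close>
    define t where "t n = of_real (1 + 1 / real (Suc n)) * z" for n
    have lim1: "(\<lambda>n. complex_of_real (1 + 1 / real (Suc n))) \<longlonglongrightarrow> of_real 1"
      by (intro tendsto_of_real) real_asymp
    have t: "t \<longlonglongrightarrow> z"
      using tendsto_mult[OF lim1 tendsto_const[of z]] by (simp add: t_def[abs_def])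
    have "continuous_on UNIV (\<lambda>w. w * ?C w)"
      by (intro continuous_intros continuous_on_cauchy_transform meas)
    then have "isCont (\<lambda>w. w * ?C w) z"
      by (simp add: continuous_on_eq_continuous_at)
    from isCont_tendsto_compose[OF this t] have "(\<lambda>n. t n * ?C (t n)) \<longlonglongrightarrow> z * ?C z" .
    moreover have "t n * ?C (t n) = c" for n
    proof (rule const)
      have "norm (t n) = (1 + 1 / real (Suc n)) * norm z"
        unfolding t_def norm_mult norm_of_real by (simp add: add_pos_pos)
      also have "\<dots> > 1 * norm z"
        using z \<rho> by (intro mult_strict_right_mono) auto
      finally show "t n \<in> S" using z by (simp add: S_def)
    qed
    ultimately show ?thesis by (simp add: LIMSEQ_const_iff)
  qed
  ultimately show ?thesis by simp
qed

text \<open>Planar form of Newton's shell theorem: the annulus beyond \<open>norm z\<close> exerts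
  no force at \<open>z\<close>, and the inner disc acts like its total mass at the centre. With
  \<open>\<rho> = norm z\<close> this gives \<open>pi * \<rho>\<^sup>2 / z\<close>, which is
  \<open>pi * cnj z\<close>.\<close>

lemma cauchy_transform_disc_inside:
  assumes z: "norm z < r"
  shows "cauchy_transform (ball 0 r) z = of_real pi * cnj z"
proof (cases "z = 0")
  case True
  \<comment> \<open>Invariance under the half turn makes the transform at the centre equal to its
    own negative.\<close>
  have "- 1 * cauchy_transform (ball 0 r) (- 1 * 0) = cauchy_transform (ball 0 r) 0"
    by (rule cauchy_transform_rotation) auto
  then show ?thesis using True by (simp add: equal_neg_zero)
next
  case False
  define \<rho> where "\<rho> = norm z"
  define A where "A = ball (0::real^2) r - ball 0 \<rho>"
  have \<rho>: "\<rho> > 0" using False by (simp add: \<rho>_def)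
  have A: "A \<in> sets lebesgue" "bounded A" "A \<in> sets borel"
    by (auto simp: A_def)
  have "ball 0 r = ball 0 \<rho> \<union> A" using z by (auto simp: A_def \<rho>_def)
  then have split: "cauchy_transform (ball 0 r) z = cauchy_transform (ball 0 \<rho>) z + cauchy_transform A z"
    using A by (simp only:) (intro cauchy_transform_Un, auto simp: A_def)
  have "closure (to_complex ` A) \<subseteq> - ball 0 \<rho>"
    by (rule closure_minimal) (auto simp: A_def)
  then have "cauchy_transform A holomorphic_on ball 0 \<rho>"
    by (intro holomorphic_on_subset[OF cauchy_transform_holomorphic[OF A(1,2)]]) auto
  then have hol: "(\<lambda>w. w * cauchy_transform A w) holomorphic_on ball 0 \<rho>"
    by (intro holomorphic_intros)
  have rot: "\<omega> * w * cauchy_transform A (\<omega> * w) = w * cauchy_transform A w" if "norm \<omega> = 1" for \<omega> w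
    using cauchy_transform_rotation[OF that A(3), of w] that
    by (simp add: A_def mult.assoc mult.left_commute[of \<omega>])
  have const: "w * cauchy_transform A w = w0 * cauchy_transform A w0"
    if "w0 \<in> ball 0 \<rho>" "w0 \<noteq> 0" "w \<in> ball 0 \<rho>" for w w0
  proof (rule radial_holomorphic_constant[OF hol _ _ _ that(2,3)])
    show "\<omega> * w0 \<in> ball 0 \<rho> \<and> \<omega> * w0 * cauchy_transform A (\<omega> * w0) = w0 * cauchy_transform A w0"
      if "norm \<omega> = 1" for \<omega>
      using rot[OF that, of w0] that \<open>w0 \<in> ball 0 \<rho>\<close> by (simp add: norm_mult)
  qed auto
  \<comment> \<open>The constant value of \<open>w * C w\<close> inside the annulus is its value at
    \<open>w = 0\<close>, where the factor \<open>w\<close> vanishes.\<close>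
  have zero: "cauchy_transform A w = 0" if "w \<in> ball 0 \<rho>" "w \<noteq> 0" for w
    using const[OF that, of 0] that(2) \<rho> by simp
  have "cauchy_transform A z = 0"
  proof -
    \<comment> \<open>\<open>z\<close> lies on the inner circle of the annulus and is approached
      from inside. The denominators start at 2 so that no \<open>t n\<close> is 0.\<close>
    define t where "t n = of_real (1 - 1 / real (Suc (Suc n))) * z" for n
    have lim1: "(\<lambda>n. complex_of_real (1 - 1 / real (Suc (Suc n)))) \<longlonglongrightarrow> of_real 1"
      by (intro tendsto_of_real) real_asymp
    have t: "t \<longlonglongrightarrow> z"
      using tendsto_mult[OF lim1 tendsto_const[of z]] by (simp add: t_def[abs_def])
    have "isCont (cauchy_transform A) z"
      using continuous_on_cauchy_transform[OF A(1,2)] by (simp add: continuous_on_eq_continuous_at)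
    from isCont_tendsto_compose[OF this t] have "(\<lambda>n. cauchy_transform A (t n)) \<longlonglongrightarrow> cauchy_transform A z" .
    moreover have "cauchy_transform A (t n) = 0" for n
    proof (rule zero)
      have c: "0 < 1 - 1 / real (Suc (Suc n))" "1 - 1 / real (Suc (Suc n)) < 1"
        by (auto simp: field_simps)
      then have "norm (t n) = (1 - 1 / real (Suc (Suc n))) * norm z"
        unfolding t_def norm_mult norm_of_real by simp
      also have "\<dots> < 1 * norm z"
        using c False by (intro mult_strict_right_mono) auto
      finally show "t n \<in> ball 0 \<rho>" by (simp add: \<rho>_def)
      show "t n \<noteq> 0" unfolding t_def using c(1) False by (simp only: mult_eq_0_iff of_real_eq_0_iff) simp
    qed
    ultimately show ?thesis by (simp add: LIMSEQ_const_iff)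
  qed
  moreover have "z * cauchy_transform (ball 0 \<rho>) z = of_real (pi * \<rho>\<^sup>2)"
    by (rule cauchy_transform_disc_outside[OF \<rho>]) (simp add: \<rho>_def)
  ultimately have "z * cauchy_transform (ball 0 r) z = of_real pi * of_real (\<rho>\<^sup>2)"
    by (simp add: split)
  also have "of_real (\<rho>\<^sup>2) = z * cnj z"
    unfolding \<rho>_def by (rule complex_norm_square)
  finally have "z * cauchy_transform (ball 0 r) z = z * (of_real pi * cnj z)"
    by (simp add: mult.left_commute)
  then show ?thesis using False by (simp only: mult_cancel_left) simp
qed

lemma cauchy_transform_translate:
  "cauchy_transform (ball c r) z = cauchy_transform (ball 0 r) (z - to_complex c)"
proof -
  have "cauchy_transform (ball c r) z
      = (LINT y|lebesgue. indicator (ball c r) (c + y) *\<^sub>R (1 / (z - to_complex (c + y))))"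
    unfolding cauchy_transform_def
    by (rule lebesgue_integral_translate(1)[OF kernel_borel_measurable, symmetric]) simp
  also have "\<dots> = cauchy_transform (ball 0 r) (z - to_complex c)"
    unfolding cauchy_transform_def
    by (simp add: linear_add[OF linear_to_complex] indicator_def dist_norm diff_diff_eq)
  finally show ?thesis .
qed

text \<open>Around each point \<open>c\<close> split off a small disc. It contributes exactly
  \<open>pi * cnj (z - c)\<close>, with \<open>c\<close> read as a complex number, while the
  transform of the rest of \<Omega> is holomorphic in that disc.\<close>

lemma cauchy_transform_interior:
  assumes "open \<Omega>" "bounded \<Omega>"
  shows "(\<lambda>z. cauchy_transform \<Omega> z - of_real pi * cnj z) holomorphic_on to_complex ` \<Omega>"
proof -
  have "(\<lambda>z. cauchy_transform \<Omega> z - of_real pi * cnj z) field_differentiable (at (to_complex c))" if c: "c \<in> \<Omega>" for c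
  proof -
    obtain r where r: "r > 0" "ball c r \<subseteq> \<Omega>"
      using assms(1) c by (auto simp: open_contains_ball)
    define A where "A = \<Omega> - ball c r"
    have A: "A \<in> sets lebesgue" "bounded A"
      using assms by (auto simp: A_def bounded_diff)
    have "ball c r \<union> A = \<Omega>" using r(2) by (auto simp: A_def)
    moreover have "ball c r \<inter> A = {}" by (auto simp: A_def)
    ultimately have split: "cauchy_transform \<Omega> z = cauchy_transform (ball c r) z + cauchy_transform A z" for z
      using cauchy_transform_Un[of "ball c r" A z] A by simp
    have "closure (to_complex ` A) \<subseteq> - ball (to_complex c) r"
    proof (rule closure_minimal)
      show "to_complex ` A \<subseteq> - ball (to_complex c) r"
        by (auto simp: A_def dist_norm simp flip: to_complex_diff)
    qed auto
    then have "cauchy_transform A holomorphic_on ball (to_complex c) r"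
      by (intro holomorphic_on_subset[OF cauchy_transform_holomorphic[OF A]]) auto
    then have "(\<lambda>z. cauchy_transform A z - of_real pi * cnj (to_complex c)) holomorphic_on ball (to_complex c) r"
      by (intro holomorphic_intros)
    then have "(\<lambda>z. cauchy_transform \<Omega> z - of_real pi * cnj z) holomorphic_on ball (to_complex c) r"
    proof (rule holomorphic_transform)
      fix z assume "z \<in> ball (to_complex c) r"
      then have "cauchy_transform (ball c r) z = of_real pi * cnj (z - to_complex c)"
        by (subst cauchy_transform_translate, intro cauchy_transform_disc_inside)
          (simp add: dist_norm norm_minus_commute)
      then show "cauchy_transform A z - of_real pi * cnj (to_complex c) = cauchy_transform \<Omega> z - of_real pi * cnj z"
        by (simp add: split algebra_simps)
    qed
    then show ?thesis
      by (rule holomorphic_on_imp_differentiable_at) (use r(1) in auto)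
  qed
  then show ?thesis
    unfolding holomorphic_on_def by (auto intro: field_differentiable_at_within)
qed

section \<open>Testing with a truncated logarithm\<close>

text \<open>Radial functions are written in terms of the squared distance, which is smooth at the
  centre, unlike the distance itself.\<close>

lemma radial_has_derivative:
  fixes z :: "'a::euclidean_space"
  assumes "\<And>s. s \<ge> 0 \<Longrightarrow> (A has_real_derivative A' s) (at s)"
  shows "((\<lambda>x. A ((norm (x - z))\<^sup>2)) has_derivative
    (\<lambda>h. A' ((norm (x - z))\<^sup>2) * (2 * ((x - z) \<bullet> h)))) (at x)"
proof -
  have sq: "((\<lambda>x. (norm (x - z))\<^sup>2) has_derivative (\<lambda>h. 2 * ((x - z) \<bullet> h))) (at x)"
    unfolding power2_norm_eq_inner
    by (auto intro!: derivative_eq_intros simp: inner_commute)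
  have "(A has_derivative (*) (A' ((norm (x - z))\<^sup>2))) (at ((norm (x - z))\<^sup>2))"
    using assms[of "(norm (x - z))\<^sup>2"] by (simp add: has_field_derivative_def)
  from has_derivative_compose[OF sq this] show ?thesis .
qed

lemma gradient_radial:
  fixes z :: "'a::euclidean_space"
  assumes "\<And>s. s \<ge> 0 \<Longrightarrow> (A has_real_derivative A' s) (at s)"
  shows "gradient (\<lambda>x. A ((norm (x - z))\<^sup>2)) x = (2 * A' ((norm (x - z))\<^sup>2)) *\<^sub>R (x - z)"
proof (rule gradient_eqI)
  show "((\<lambda>x. A ((norm (x - z))\<^sup>2)) has_derivative (\<bullet>) ((2 * A' ((norm (x - z))\<^sup>2)) *\<^sub>R (x - z))) (at x)"
  proof -
    have "(\<lambda>h. A' ((norm (x - z))\<^sup>2) * (2 * ((x - z) \<bullet> h))) = (\<bullet>) ((2 * A' ((norm (x - z))\<^sup>2)) *\<^sub>R (x - z))"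
      by (simp add: fun_eq_iff)
    then show ?thesis
      using radial_has_derivative[of A A' z x, OF assms] by (simp only:)
  qed
qed

lemma laplacian_radial:
  fixes z :: "'a::euclidean_space"
  assumes A: "\<And>s. s \<ge> 0 \<Longrightarrow> (A has_real_derivative A' s) (at s)"
    and A': "\<And>s. s \<ge> 0 \<Longrightarrow> (A' has_real_derivative A'' s) (at s)"
  shows "laplacian (\<lambda>x. A ((norm (x - z))\<^sup>2)) x
    = 4 * (norm (x - z))\<^sup>2 * A'' ((norm (x - z))\<^sup>2) + 2 * real DIM('a) * A' ((norm (x - z))\<^sup>2)"
proof -
  define s where "s x = (norm (x - z))\<^sup>2" for x
  have d1: "frechet_derivative (\<lambda>x. A (s x)) (at y) i = A' (s y) * (2 * ((y - z) \<bullet> i))" for y i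
    using frechet_derivative_at[OF radial_has_derivative[of A A' z y, OF A]] unfolding s_def by metis
  have d2: "frechet_derivative (\<lambda>y. A' (s y) * (2 * ((y - z) \<bullet> i))) (at x) i
      = A'' (s x) * (4 * ((x - z) \<bullet> i)\<^sup>2) + A' (s x) * 2" if i: "i \<in> Basis" for i
  proof -
    have "((\<lambda>y. A' (s y) * (2 * ((y - z) \<bullet> i))) has_derivative
        (\<lambda>h. A' (s x) * (2 * (h \<bullet> i)) + A'' (s x) * (2 * ((x - z) \<bullet> h)) * (2 * ((x - z) \<bullet> i)))) (at x)"
      unfolding s_def
      by (rule has_derivative_mult[OF radial_has_derivative[OF A']]) (auto intro!: derivative_eq_intros)
    from frechet_derivative_at[OF this] have "frechet_derivative (\<lambda>y. A' (s y) * (2 * ((y - z) \<bullet> i))) (at x)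
        = (\<lambda>h. A' (s x) * (2 * (h \<bullet> i)) + A'' (s x) * (2 * ((x - z) \<bullet> h)) * (2 * ((x - z) \<bullet> i)))" ..
    then show ?thesis using i by (simp add: power2_eq_square)
  qed
  have "laplacian (\<lambda>x. A (s x)) x = (\<Sum>i\<in>Basis. A'' (s x) * (4 * ((x - z) \<bullet> i)\<^sup>2) + A' (s x) * 2)"
    unfolding laplacian_def d1 by (rule sum.cong[OF refl]) (rule d2)
  also have "\<dots> = 4 * s x * A'' (s x) + 2 * real DIM('a) * A' (s x)"
  proof -
    have "s x = (\<Sum>i\<in>Basis. ((x - z) \<bullet> i)\<^sup>2)"
      unfolding s_def power2_norm_eq_inner euclidean_inner[of "x - z" "x - z"] by (simp add: power2_eq_square)
    then have "(\<Sum>i\<in>Basis. A'' (s x) * (4 * ((x - z) \<bullet> i)\<^sup>2)) = 4 * s x * A'' (s x)"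
      by (simp add: sum_distrib_left mult_ac)
    then show ?thesis by (simp add: sum.distrib)
  qed
  finally show ?thesis unfolding s_def .
qed

text \<open>The factor \<open>exp 1\<close> makes the cutoff \<open>exp 1 * bump 0 (1 - s / R^2)\<close> tend to 1 as \<open>R\<close> grows.\<close>

definition log_cutoff :: "real \<Rightarrow> real \<Rightarrow> real \<Rightarrow> real" where
  "log_cutoff \<epsilon> R s = exp 1 * (ln (s + \<epsilon>\<^sup>2) * bump 0 (1 - s / R\<^sup>2))"

definition log_cutoff' :: "real \<Rightarrow> real \<Rightarrow> real \<Rightarrow> real" where
  "log_cutoff' \<epsilon> R s = exp 1 * (bump 0 (1 - s / R\<^sup>2) / (s + \<epsilon>\<^sup>2) - ln (s + \<epsilon>\<^sup>2) * bump 1 (1 - s / R\<^sup>2) / R\<^sup>2)"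

definition log_cutoff'' :: "real \<Rightarrow> real \<Rightarrow> real \<Rightarrow> real" where
  "log_cutoff'' \<epsilon> R s = exp 1 * (- bump 0 (1 - s / R\<^sup>2) / (s + \<epsilon>\<^sup>2)\<^sup>2
     - 2 * bump 1 (1 - s / R\<^sup>2) / ((s + \<epsilon>\<^sup>2) * R\<^sup>2) + ln (s + \<epsilon>\<^sup>2) * bump 2 (1 - s / R\<^sup>2) / R ^ 4)"

lemma bump_cutoff_has_real_derivative:
  "((\<lambda>s. bump i (1 - s / R\<^sup>2)) has_real_derivative - bump (Suc i) (1 - s / R\<^sup>2) / R\<^sup>2) (at s)"
proof -
  have "((\<lambda>s. 1 - 1 / R\<^sup>2 * s) has_real_derivative 0 - 1 / R\<^sup>2 * 1) (at s)"
    by (intro DERIV_diff DERIV_const DERIV_cmult DERIV_ident)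
  then have "((\<lambda>s. 1 - s / R\<^sup>2) has_real_derivative - (1 / R\<^sup>2)) (at s)"
    by simp
  from DERIV_chain2[OF bump_has_real_derivative this, of i] show ?thesis by simp
qed

lemma log_cutoff_has_real_derivative:
  assumes "\<epsilon> > 0" "R > 0" "s \<ge> 0"
  shows "(log_cutoff \<epsilon> R has_real_derivative log_cutoff' \<epsilon> R s) (at s)"
    and "(log_cutoff' \<epsilon> R has_real_derivative log_cutoff'' \<epsilon> R s) (at s)"
proof -
  have pos: "s + \<epsilon>\<^sup>2 > 0" using assms by (simp add: add_nonneg_pos)
  have ln: "((\<lambda>s. ln (s + \<epsilon>\<^sup>2)) has_real_derivative 1 / (s + \<epsilon>\<^sup>2)) (at s)"
    using pos by (auto intro!: derivative_eq_intros)
  have inv: "((\<lambda>s. 1 / (s + \<epsilon>\<^sup>2)) has_real_derivative - (1 / (s + \<epsilon>\<^sup>2)\<^sup>2)) (at s)"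
    using pos by (auto intro!: derivative_eq_intros simp: power2_eq_square)
  note b = bump_cutoff_has_real_derivative[of _ R s]
  have "(log_cutoff \<epsilon> R has_real_derivative exp 1 *
      (1 / (s + \<epsilon>\<^sup>2) * bump 0 (1 - s / R\<^sup>2) + - bump (Suc 0) (1 - s / R\<^sup>2) / R\<^sup>2 * ln (s + \<epsilon>\<^sup>2))) (at s)"
    unfolding log_cutoff_def[abs_def] by (intro DERIV_cmult DERIV_mult ln b)
  moreover have "exp 1 * (1 / (s + \<epsilon>\<^sup>2) * bump 0 (1 - s / R\<^sup>2) + - bump (Suc 0) (1 - s / R\<^sup>2) / R\<^sup>2 * ln (s + \<epsilon>\<^sup>2))
      = log_cutoff' \<epsilon> R s"
    by (simp add: log_cutoff'_def)
  ultimately show "(log_cutoff \<epsilon> R has_real_derivative log_cutoff' \<epsilon> R s) (at s)" by (simp only:)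
  have "((\<lambda>s. exp 1 * (1 / (s + \<epsilon>\<^sup>2) * bump 0 (1 - s / R\<^sup>2) - (1 / R\<^sup>2) * (ln (s + \<epsilon>\<^sup>2) * bump 1 (1 - s / R\<^sup>2))))
      has_real_derivative exp 1 *
      ((- (1 / (s + \<epsilon>\<^sup>2)\<^sup>2) * bump 0 (1 - s / R\<^sup>2) + - bump (Suc 0) (1 - s / R\<^sup>2) / R\<^sup>2 * (1 / (s + \<epsilon>\<^sup>2)))
       - (1 / R\<^sup>2) * (1 / (s + \<epsilon>\<^sup>2) * bump 1 (1 - s / R\<^sup>2) + - bump (Suc 1) (1 - s / R\<^sup>2) / R\<^sup>2 * ln (s + \<epsilon>\<^sup>2)))) (at s)"
    by (intro DERIV_cmult DERIV_mult DERIV_diff ln inv b)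
  moreover have "(\<lambda>s. exp 1 * (1 / (s + \<epsilon>\<^sup>2) * bump 0 (1 - s / R\<^sup>2) - (1 / R\<^sup>2) * (ln (s + \<epsilon>\<^sup>2) * bump 1 (1 - s / R\<^sup>2))))
      = log_cutoff' \<epsilon> R"
    by (simp add: log_cutoff'_def fun_eq_iff)
  moreover have "exp 1 *
      ((- (1 / (s + \<epsilon>\<^sup>2)\<^sup>2) * bump 0 (1 - s / R\<^sup>2) + - bump (Suc 0) (1 - s / R\<^sup>2) / R\<^sup>2 * (1 / (s + \<epsilon>\<^sup>2)))
       - (1 / R\<^sup>2) * (1 / (s + \<epsilon>\<^sup>2) * bump 1 (1 - s / R\<^sup>2) + - bump (Suc 1) (1 - s / R\<^sup>2) / R\<^sup>2 * ln (s + \<epsilon>\<^sup>2)))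
      = log_cutoff'' \<epsilon> R s"
  proof -
    define b0 b1 b2 where b: "b0 = bump 0 (1 - s / R\<^sup>2)" "b1 = bump 1 (1 - s / R\<^sup>2)" "b2 = bump 2 (1 - s / R\<^sup>2)"
    define l where "l = ln (s + \<epsilon>\<^sup>2)"
    define p where "p = s + \<epsilon>\<^sup>2"
    have "(- (1 / p\<^sup>2) * b0 + - b1 / R\<^sup>2 * (1 / p)) - (1 / R\<^sup>2) * (1 / p * b1 + - b2 / R\<^sup>2 * l)
        = - b0 / p\<^sup>2 - 2 * b1 / (p * R\<^sup>2) + l * b2 / R ^ 4"
      using pos assms(2) by (simp add: p_def[symmetric] divide_simps power2_eq_square power4_eq_xxxx)
        (simp add: algebra_simps)
    then show ?thesis
      unfolding log_cutoff''_def b l_def p_def by (simp add: numeral_2_eq_2)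
  qed
  ultimately show "(log_cutoff' \<epsilon> R has_real_derivative log_cutoff'' \<epsilon> R s) (at s)" by (simp only:)
qed

lemma Ck_ln_norm:
  assumes "\<epsilon> > 0"
  shows "Ck n (\<lambda>x. ln ((norm (x - z))\<^sup>2 + \<epsilon>\<^sup>2))"
proof -
  \<comment> \<open>\<open>F i\<close> is the \<open>i\<close>-th derivative of
    \<open>ln (s + \<epsilon>\<^sup>2)\<close> in closed form, valid where the argument of the
    logarithm is positive.\<close>
  define F :: "nat \<Rightarrow> real \<Rightarrow> real" where
    "F i = (case i of 0 \<Rightarrow> (\<lambda>s. ln (s + \<epsilon>\<^sup>2)) | Suc j \<Rightarrow> (\<lambda>s. (- 1) ^ j * fact j * inverse (s + \<epsilon>\<^sup>2) ^ Suc j))" for i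
  have "(F i has_real_derivative F (Suc i) s) (at s)" if "s \<in> {- (\<epsilon>\<^sup>2)<..}" for i s
  proof (cases i)
    case 0
    then show ?thesis using that by (auto simp: F_def inverse_eq_divide intro!: derivative_eq_intros)
  next
    case (Suc j)
    have "((\<lambda>s. inverse (s + \<epsilon>\<^sup>2)) has_real_derivative - (inverse (s + \<epsilon>\<^sup>2))\<^sup>2) (at s)"
      using that by (auto intro!: derivative_eq_intros simp: power2_eq_square)
    from DERIV_power[OF this, of "Suc j"]
    have "((\<lambda>s. inverse (s + \<epsilon>\<^sup>2) ^ Suc j) has_real_derivative
        real (Suc j) * (- (inverse (s + \<epsilon>\<^sup>2))\<^sup>2 * inverse (s + \<epsilon>\<^sup>2) ^ j)) (at s)"
      by simp
    from DERIV_cmult[OF this, of "(- 1) ^ j * fact j"]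
    have "(F (Suc j) has_real_derivative
        (- 1) ^ j * fact j * (real (Suc j) * (- (inverse (s + \<epsilon>\<^sup>2))\<^sup>2 * inverse (s + \<epsilon>\<^sup>2) ^ j))) (at s)"
      by (simp only: F_def nat.case)
    moreover have "(- 1) ^ j * fact j * (real (Suc j) * (- (inverse (s + \<epsilon>\<^sup>2))\<^sup>2 * inverse (s + \<epsilon>\<^sup>2) ^ j)) = F (Suc (Suc j)) s"
      by (simp add: F_def power2_eq_square algebra_simps)
    ultimately show ?thesis by (simp only: Suc)
  qed
  then have "Ck n (\<lambda>x. F 0 ((norm (x - z))\<^sup>2))"
  proof (rule Ck_chain[OF _ Ck_norm_power2])
    have "- (\<epsilon>\<^sup>2) < (norm (x - z))\<^sup>2" for x
      by (rule less_le_trans[of _ 0]) (use assms in simp_all)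
    then show "range (\<lambda>x. (norm (x - z))\<^sup>2) \<subseteq> {- (\<epsilon>\<^sup>2)<..}"
      by (simp add: image_subset_iff)
  qed
  then show ?thesis by (simp add: F_def)
qed

lemma test_function_log_cutoff:
  fixes z :: "'a::euclidean_space"
  assumes "\<epsilon> > 0" "R > 0"
  shows "test_function (\<lambda>x. log_cutoff \<epsilon> R ((norm (x - z))\<^sup>2))"
proof (rule test_functionI)
  show "compact (cball z R)" by simp
  have "Ck n (\<lambda>x. bump 0 (1 - 1 / R\<^sup>2 * (norm (x - z))\<^sup>2))" for n
  proof (rule Ck_chain[where S = UNIV and F = bump])
    show "Ck n (\<lambda>x. 1 - 1 / R\<^sup>2 * (norm (x - z))\<^sup>2)"
      by (intro Ck_diff Ck_mult Ck_const Ck_norm_power2)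
  qed (simp_all add: bump_has_real_derivative)
  then show "Ck n (\<lambda>x. log_cutoff \<epsilon> R ((norm (x - z))\<^sup>2))" for n
    unfolding log_cutoff_def
    by (intro Ck_mult Ck_const Ck_ln_norm assms) simp
  fix x assume "x \<notin> cball z R"
  then have "R\<^sup>2 \<le> (norm (x - z))\<^sup>2"
    using assms by (intro power_mono) (auto simp: dist_norm norm_minus_commute)
  then show "log_cutoff \<epsilon> R ((norm (x - z))\<^sup>2) = 0"
    using assms by (simp add: log_cutoff_def)
qed

section \<open>An approximate Dirac mass in the plane\<close>

lemma lebesgue_integral_dilate:
  fixes f :: "'a::euclidean_space \<Rightarrow> real"
  assumes f: "f \<in> borel_measurable borel" and "c > 0"
  shows "(LINT x|lebesgue. f x) = c ^ DIM('a) * (LINT x|lebesgue. f (t + c *\<^sub>R x))"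
    and "integrable lebesgue f \<longleftrightarrow> integrable lebesgue (\<lambda>x. f (t + c *\<^sub>R x))"
proof -
  let ?T = "\<lambda>x. t + c *\<^sub>R x"
  have T: "?T \<in> borel_measurable borel"
    by (intro borel_measurable_continuous_onI continuous_intros)
  have fT: "(\<lambda>x. f (?T x)) \<in> borel_measurable borel"
    using T f by (rule measurable_compose)
  have lb: "lborel = density (distr lborel borel ?T) (\<lambda>_. ennreal (c ^ DIM('a)))"
    using lborel_affine[of c t] \<open>c > 0\<close> by simp
  have "(LINT x|lborel. f x) = (LINT x|density (distr lborel borel ?T) (\<lambda>_. ennreal (c ^ DIM('a))). f x)"
    using lb by simp
  also have "\<dots> = (LINT x|distr lborel borel ?T. c ^ DIM('a) * f x)"
    using \<open>c > 0\<close> f by (subst integral_density) auto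
  also have "\<dots> = (LINT x|lborel. c ^ DIM('a) * f (?T x))"
    using f T by (subst integral_distr) auto
  finally show "(LINT x|lebesgue. f x) = c ^ DIM('a) * (LINT x|lebesgue. f (?T x))"
    using f fT by (simp add: integral_completion)
  have "integrable lborel f \<longleftrightarrow> integrable (density (distr lborel borel ?T) (\<lambda>_. ennreal (c ^ DIM('a)))) f"
    using lb by simp
  also have "\<dots> \<longleftrightarrow> integrable (distr lborel borel ?T) (\<lambda>x. c ^ DIM('a) * f x)"
    using \<open>c > 0\<close> f by (subst integrable_density) auto
  also have "\<dots> \<longleftrightarrow> integrable lborel (\<lambda>x. c ^ DIM('a) * f (?T x))"
    using f T by (subst integrable_distr_eq) auto
  also have "\<dots> \<longleftrightarrow> integrable lborel (\<lambda>x. f (?T x))"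
    using \<open>c > 0\<close> by simp
  finally show "integrable lebesgue f \<longleftrightarrow> integrable lebesgue (\<lambda>x. f (?T x))"
    using f fT by (simp add: integrable_completion)
qed

text \<open>For \<open>2 ^ j \<le> norm x < 2 ^ Suc j\<close> the kernel is at most
  \<open>(1 / 16) ^ j\<close>, and discs of radius \<open>2 ^ Suc j\<close> have area
  \<open>4 * pi * 4 ^ j\<close>; the resulting series has ratio 1/4. The unit disc is taken with
  \<open>j = 0\<close>.\<close>

lemma integrable_standard_kernel:
  "integrable lebesgue (\<lambda>x::real^2. 1 / ((norm x)\<^sup>2 + 1)\<^sup>2)"
proof -
  have meas: "(\<lambda>x::real^2. 1 / ((norm x)\<^sup>2 + 1)\<^sup>2) \<in> borel_measurable borel"
  proof (intro borel_measurable_continuous_onI continuous_intros ballI)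
    fix x :: "real^2"
    have "(norm x)\<^sup>2 + 1 > 0" by (simp add: add_nonneg_pos)
    then show "((norm x)\<^sup>2 + 1)\<^sup>2 \<noteq> 0" by simp
  qed
  have "(\<integral>\<^sup>+x. ennreal (1 / ((norm (x::real^2))\<^sup>2 + 1)\<^sup>2) \<partial>lborel)
      \<le> (\<integral>\<^sup>+x. (\<Sum>j. ennreal ((1 / 16) ^ j) * indicator (ball 0 (2 ^ Suc j) :: (real^2) set) x) \<partial>lborel)"
  proof (rule nn_integral_mono)
    fix x :: "real^2"
    define F where "F j = ennreal ((1 / 16) ^ j) * indicator (ball 0 (2 ^ Suc j)) x" for j :: nat
    obtain j where j: "norm x < 2 ^ Suc j" "1 / ((norm x)\<^sup>2 + 1)\<^sup>2 \<le> (1 / 16) ^ j"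
    proof (cases "norm x < 1")
      case True
      have "1 \<le> ((norm x)\<^sup>2 + 1)\<^sup>2" by (intro one_le_power) simp
      then have "1 / ((norm x)\<^sup>2 + 1)\<^sup>2 \<le> 1" by (simp add: divide_le_eq_1)
      then show ?thesis using that[of 0] True by simp
    next
      case False
      obtain n where n: "norm x < 2 ^ n"
        using real_arch_pow[of 2 "norm x"] by auto
      define m where "m = (LEAST n. norm x < 2 ^ n)"
      have m: "norm x < 2 ^ m" unfolding m_def by (rule LeastI[of _ n]) (rule n)
      with False have "m \<noteq> 0" by (intro notI) simp
      then obtain j where j: "m = Suc j" by (cases m) auto
      then have "\<not> norm x < 2 ^ j"
        using not_less_Least[of j "\<lambda>n. norm x < 2 ^ n"] by (simp add: m_def)
      then have "(2 ^ j)\<^sup>2 \<le> (norm x)\<^sup>2" by (intro power_mono) auto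
      then have "(2 ^ j)\<^sup>2 \<le> (norm x)\<^sup>2 + 1" by linarith
      then have "((2 ^ j)\<^sup>2)\<^sup>2 \<le> ((norm x)\<^sup>2 + 1)\<^sup>2" by (rule power_mono) simp
      moreover have "((2 ^ j)\<^sup>2)\<^sup>2 = (16::real) ^ j"
      proof -
        have "(16::real) ^ j = (2 ^ 4) ^ j" by simp
        then show ?thesis unfolding power_mult[symmetric] by (simp add: mult.commute)
      qed
      ultimately have "1 / ((norm x)\<^sup>2 + 1)\<^sup>2 \<le> 1 / 16 ^ j"
        by (intro frac_le) simp_all
      then show ?thesis using that[of j] m j by (simp add: power_one_over)
    qed
    have "ennreal (1 / ((norm x)\<^sup>2 + 1)\<^sup>2) \<le> F j"
      using j by (simp add: F_def ennreal_leI)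
    also have "F j = sum F {j}" by simp
    also have "\<dots> \<le> (\<Sum>i. F i)" by (rule sum_le_suminf) auto
    finally show "ennreal (1 / ((norm x)\<^sup>2 + 1)\<^sup>2) \<le> (\<Sum>j. ennreal ((1 / 16) ^ j) * indicator (ball 0 (2 ^ Suc j)) x)"
      unfolding F_def .
  qed
  also have "\<dots> = (\<Sum>j. \<integral>\<^sup>+x. ennreal ((1 / 16) ^ j) * indicator (ball 0 (2 ^ Suc j) :: (real^2) set) x \<partial>lborel)"
    by (rule nn_integral_suminf) (intro borel_measurable_times_ennreal borel_measurable_const borel_measurable_indicator, simp)
  also have "\<dots> = (\<Sum>j. ennreal (16 * pi / 3 * (3 / 4 * (1 / 4) ^ j)))"
  proof (rule suminf_cong)
    fix j :: nat
    have "(1 / 16) ^ j * (pi * (2 ^ Suc j)\<^sup>2) = 16 * pi / 3 * (3 / 4 * (1 / 4) ^ j)"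
    proof -
      have "((2::real) ^ j)\<^sup>2 = 4 ^ j" by (simp add: power_mult[symmetric] mult.commute[of j] power_mult)
      moreover have "(16::real) ^ j = 4 ^ j * 4 ^ j" by (simp add: power_mult_distrib[symmetric])
      ultimately show ?thesis by (simp add: power_mult_distrib power_divide)
    qed
    then show "(\<integral>\<^sup>+x. ennreal ((1 / 16) ^ j) * indicator (ball 0 (2 ^ Suc j) :: (real^2) set) x \<partial>lborel)
        = ennreal (16 * pi / 3 * (3 / 4 * (1 / 4) ^ j))"
      by (subst nn_integral_cmult_indicator)
        (simp_all add: emeasure_ball unit_ball_vol_2 flip: ennreal_mult del: power_Suc)
  qed
  also have "\<dots> = ennreal (16 * pi / 3 * 1)"
  proof (intro suminf_ennreal_eq sums_mult)
    have "(\<lambda>j. (1 / 4) ^ j) sums (1 / (1 - 1 / 4 :: real))"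
      by (rule geometric_sums) simp
    from sums_mult[OF this, of "3 / 4"] show "(\<lambda>j. 3 / 4 * (1 / 4) ^ j :: real) sums 1" by simp
  qed simp
  finally have "(\<integral>\<^sup>+x. ennreal (1 / ((norm (x::real^2))\<^sup>2 + 1)\<^sup>2) \<partial>lborel) < \<infinity>"
    by (rule le_less_trans) simp
  then have "integrable lborel (\<lambda>x::real^2. 1 / ((norm x)\<^sup>2 + 1)\<^sup>2)"
    using meas by (intro integrableI_nonneg) auto
  then show ?thesis using meas by (simp add: integrable_completion)
qed

text \<open>\<open>4 * approx_delta\<close> is the Laplacian of \<open>ln ((norm (x - z))^2 + \<epsilon>^2)\<close>.\<close>

definition approx_delta :: "real \<Rightarrow> real^2 \<Rightarrow> real^2 \<Rightarrow> real" where
  "approx_delta \<epsilon> z x = \<epsilon>\<^sup>2 / ((norm (x - z))\<^sup>2 + \<epsilon>\<^sup>2)\<^sup>2"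

text \<open>The value is \<pi>. The argument needs only that it is positive, so it is kept as an
  abstract constant.\<close>

definition delta_mass :: real where
  "delta_mass = (LINT x|lebesgue. 1 / ((norm (x::real^2))\<^sup>2 + 1)\<^sup>2)"

lemma approx_delta_nonneg [simp]: "approx_delta \<epsilon> z x \<ge> 0"
  by (simp add: approx_delta_def)

lemma continuous_on_approx_delta:
  assumes "\<epsilon> > 0"
  shows "continuous_on UNIV (approx_delta \<epsilon> z)"
proof -
  have "(norm (x - z))\<^sup>2 + \<epsilon>\<^sup>2 \<noteq> 0" for x
    using assms by (simp add: add_nonneg_eq_0_iff)
  then show ?thesis
    unfolding approx_delta_def[abs_def] by (intro continuous_intros) auto
qed

lemma approx_delta_integral:
  assumes "\<epsilon> > 0"
  shows "integrable lebesgue (approx_delta \<epsilon> z)" "(LINT x|lebesgue. approx_delta \<epsilon> z x) = delta_mass"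
proof -
  have meas: "approx_delta \<epsilon> z \<in> borel_measurable borel"
    by (intro borel_measurable_continuous_onI continuous_on_approx_delta assms)
  have eq: "approx_delta \<epsilon> z (z + \<epsilon> *\<^sub>R x) = (1 / \<epsilon>\<^sup>2) * (1 / ((norm x)\<^sup>2 + 1)\<^sup>2)" for x
  proof -
    have "(norm (z + \<epsilon> *\<^sub>R x - z))\<^sup>2 + \<epsilon>\<^sup>2 = \<epsilon>\<^sup>2 * ((norm x)\<^sup>2 + 1)"
      using assms by (simp add: power_mult_distrib algebra_simps)
    then have "approx_delta \<epsilon> z (z + \<epsilon> *\<^sub>R x) = \<epsilon>\<^sup>2 / (\<epsilon>\<^sup>2 * ((norm x)\<^sup>2 + 1))\<^sup>2"
      by (simp only: approx_delta_def)
    also have "\<dots> = (1 / \<epsilon>\<^sup>2) * (1 / ((norm x)\<^sup>2 + 1)\<^sup>2)"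
      using assms by (simp add: power_mult_distrib power2_eq_square)
    finally show ?thesis .
  qed
  show "integrable lebesgue (approx_delta \<epsilon> z)"
    unfolding lebesgue_integral_dilate(2)[OF meas assms, of z] eq
    by (intro integrable_mult_right integrable_standard_kernel)
  show "(LINT x|lebesgue. approx_delta \<epsilon> z x) = delta_mass"
    unfolding lebesgue_integral_dilate(1)[OF meas assms, of z] eq integral_mult_right_zero delta_mass_def
    using assms by simp
qed

lemma delta_mass_pos: "delta_mass > 0"
proof -
  have "(LINT x|lebesgue. indicator (ball 0 1 :: (real^2) set) x * (1 / 4)) \<le> delta_mass"
    unfolding delta_mass_def
  proof (rule integral_mono[OF _ integrable_standard_kernel])
    show "integrable lebesgue (\<lambda>x. indicator (ball 0 1 :: (real^2) set) x * (1 / 4) :: real)"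
      by (intro integrable_mult_left bounded_measurable_integrable_indicator) auto
    fix x :: "real^2"
    show "indicator (ball 0 1) x * (1 / 4) \<le> 1 / ((norm x)\<^sup>2 + 1)\<^sup>2"
    proof (cases "norm x < 1")
      case True
      have "(norm x)\<^sup>2 \<le> 1" using True by (simp add: power_le_one)
      then have "((norm x)\<^sup>2 + 1)\<^sup>2 \<le> 2\<^sup>2" by (intro power_mono) auto
      moreover have "((norm x)\<^sup>2 + 1)\<^sup>2 > 0"
        by (intro zero_less_power add_nonneg_pos) auto
      ultimately have "1 / 4 \<le> 1 / ((norm x)\<^sup>2 + 1)\<^sup>2"
        by (intro divide_left_mono mult_pos_pos) auto
      then show ?thesis using True by simp
    qed simp
  qed
  moreover have "(LINT x|lebesgue. indicator (ball 0 1 :: (real^2) set) x * (1 / 4)) = pi / 4"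
    by (simp add: content_ball unit_ball_vol_2)
  ultimately show ?thesis using pi_gt_zero by linarith
qed

lemma abs_ln_le:
  fixes p q r :: real
  assumes "0 < p" "p \<le> q" "q \<le> r"
  shows "\<bar>ln q\<bar> \<le> \<bar>ln p\<bar> + \<bar>ln r\<bar>"
proof -
  have "ln p \<le> ln q" "ln q \<le> ln r" using assms by simp_all
  then show ?thesis by linarith
qed

section \<open>Full logarithms as limits of truncated ones, for a function decaying like
  \<open>1 / norm x\<close>\<close>

context
  fixes h :: "real^2 \<Rightarrow> real" and R0 M :: real
  assumes h_meas: "h \<in> borel_measurable lebesgue"
    and h_int: "\<And>K. compact K \<Longrightarrow> integrable lebesgue (\<lambda>x. indicator K x * h x)"
    and h_far: "AE x in lebesgue. R0 \<le> norm x \<longrightarrow> \<bar>h x\<bar> \<le> M / norm x"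
    and R0: "R0 > 0" and M: "M \<ge> 0"
begin

lemma h_abs_int: "compact K \<Longrightarrow> integrable lebesgue (\<lambda>x. indicator K x * \<bar>h x\<bar>)"
  using integrable_abs[OF h_int[of K]] by (simp add: abs_mult)

text \<open>In the plane the integral of \<open>1 / norm x\<close> over a disc grows linearly in the
  radius; the part of \<open>h\<close> near the origin adds a constant. Linear growth is slow enough
  to be beaten by the cutoff error in \<open>smoothed_identity\<close>.\<close>

lemma mass_growth:
  obtains \<alpha> \<beta> where "\<And>R. R > 0 \<Longrightarrow> (LINT x|lebesgue. indicator (cball z R) x * \<bar>h x\<bar>) \<le> \<alpha> + \<beta> * R"
proof -
  define \<alpha>0 where "\<alpha>0 = (LINT x|lebesgue. indicator (cball 0 R0) x * \<bar>h x\<bar>)"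
  have "(LINT x|lebesgue. indicator (cball z R) x * \<bar>h x\<bar>) \<le> (\<alpha>0 + M * (4 * pi * (norm z + 1))) + M * (4 * pi) * R"
    if "R > 0" for R
  proof -
    \<comment> \<open>Chosen so that \<open>cball z R\<close> lies in the open ball of radius \<rho>
      about 0, where the bound for \<open>1 / norm x\<close> is available.\<close>
    define \<rho> where "\<rho> = R + norm z + 1"
    have \<rho>: "\<rho> > 0" using that by (simp add: \<rho>_def add_pos_nonneg)
    have int2: "integrable lebesgue (\<lambda>x. indicator (ball 0 \<rho>) x / norm (x::real^2))"
      using inverse_norm_ball(1)[OF \<rho>, of 0] by simp
    have le2: "(LINT x|lebesgue. indicator (ball 0 \<rho>) x / norm (x::real^2)) \<le> 4 * pi * \<rho>"
      using inverse_norm_ball(2)[OF \<rho>, of 0] by simp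
    have "(LINT x|lebesgue. indicator (cball z R) x * \<bar>h x\<bar>)
        \<le> (LINT x|lebesgue. indicator (cball 0 R0) x * \<bar>h x\<bar> + M * (indicator (ball 0 \<rho>) x / norm x))"
    proof (rule integral_mono_AE)
      show "integrable lebesgue (\<lambda>x. indicator (cball z R) x * \<bar>h x\<bar>)"
        by (rule h_abs_int) simp
      show "integrable lebesgue (\<lambda>x. indicator (cball 0 R0) x * \<bar>h x\<bar> + M * (indicator (ball 0 \<rho>) x / norm x))"
        by (intro Bochner_Integration.integrable_add integrable_mult_right int2 h_abs_int) simp
      show "AE x in lebesgue. indicator (cball z R) x * \<bar>h x\<bar>
          \<le> indicator (cball 0 R0) x * \<bar>h x\<bar> + M * (indicator (ball 0 \<rho>) x / norm x)"
        using h_far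
      proof eventually_elim
        case (elim x)
        have inb: "x \<in> ball 0 \<rho>" if "x \<in> cball z R"
        proof -
          have "norm x \<le> norm (x - z) + norm z" using norm_triangle_ineq[of "x - z" z] by simp
          then show ?thesis using that by (simp add: \<rho>_def dist_norm norm_minus_commute)
        qed
        show ?case
        proof (cases "x \<in> cball z R \<and> R0 \<le> norm x")
          case True
          then have "\<bar>h x\<bar> \<le> M * (1 / norm x)" using elim by simp
          moreover have "0 \<le> indicator (cball 0 R0) x * \<bar>h x\<bar>" by simp
          moreover have "indicator (cball z R) x = (1::real)" "indicator (ball 0 \<rho>) x = (1::real)"
            using inb True by simp_all
          ultimately show ?thesis by (simp add: add_increasing)
        next
          case False
          have "0 \<le> M * (indicator (ball 0 \<rho>) x / norm x)" using M by simp
          then show ?thesis using False by (auto simp: indicator_def)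
        qed
      qed
    qed
    also have "\<dots> = \<alpha>0 + M * (LINT x|lebesgue. indicator (ball 0 \<rho>) x / norm (x::real^2))"
      unfolding \<alpha>0_def integral_mult_right_zero[symmetric]
      by (intro Bochner_Integration.integral_add integrable_mult_right int2 h_abs_int) simp
    also have "\<dots> \<le> \<alpha>0 + M * (4 * pi * \<rho>)"
      using le2 M by (intro add_left_mono mult_left_mono)
    also have "\<dots> = (\<alpha>0 + M * (4 * pi * (norm z + 1))) + M * (4 * pi) * R"
      by (simp add: \<rho>_def algebra_simps)
    finally show ?thesis .
  qed
  then show ?thesis by (rule that)
qed

lemma approx_delta_le:
  assumes "\<epsilon> > 0"
  shows "approx_delta \<epsilon> z x \<le> 1 / \<epsilon>\<^sup>2"
proof -
  have "(\<epsilon>\<^sup>2)\<^sup>2 \<le> ((norm (x - z))\<^sup>2 + \<epsilon>\<^sup>2)\<^sup>2" by (intro power_mono) auto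
  then have "approx_delta \<epsilon> z x \<le> \<epsilon>\<^sup>2 / (\<epsilon>\<^sup>2)\<^sup>2"
    unfolding approx_delta_def using assms by (intro frac_le) auto
  also have "\<dots> = 1 / \<epsilon>\<^sup>2" using assms by (simp add: power2_eq_square)
  finally show ?thesis .
qed

text \<open>Within radius \<open>R0\<close> the kernel is bounded and \<open>h\<close> is
  integrable; beyond it \<open>h\<close> is bounded by \<open>M / R0\<close> and the kernel is
  integrable.\<close>

lemma integrable_mult_approx_delta:
  assumes \<epsilon>: "\<epsilon> > 0"
  shows "integrable lebesgue (\<lambda>x. h x * approx_delta \<epsilon> z x)"
proof (rule Bochner_Integration.integrable_bound)
  show "integrable lebesgue (\<lambda>x. indicator (cball 0 R0) x * \<bar>h x\<bar> * (1 / \<epsilon>\<^sup>2) + M / R0 * approx_delta \<epsilon> z x)"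
    by (intro Bochner_Integration.integrable_add integrable_mult_left integrable_mult_right h_abs_int approx_delta_integral \<epsilon>) simp
  show "(\<lambda>x. h x * approx_delta \<epsilon> z x) \<in> borel_measurable lebesgue"
    by (intro borel_measurable_times h_meas continuous_imp_lebesgue_measurable continuous_on_approx_delta \<epsilon>)
  show "AE x in lebesgue. norm (h x * approx_delta \<epsilon> z x)
      \<le> norm (indicator (cball 0 R0) x * \<bar>h x\<bar> * (1 / \<epsilon>\<^sup>2) + M / R0 * approx_delta \<epsilon> z x)"
    using h_far
  proof eventually_elim
    case (elim x)
    have nn: "0 \<le> indicator (cball 0 R0) x * \<bar>h x\<bar> * (1 / \<epsilon>\<^sup>2)" "0 \<le> M / R0 * approx_delta \<epsilon> z x"
      using M R0 by simp_all
    have "\<bar>h x\<bar> * approx_delta \<epsilon> z x \<le> indicator (cball 0 R0) x * \<bar>h x\<bar> * (1 / \<epsilon>\<^sup>2) + M / R0 * approx_delta \<epsilon> z x"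
    proof (cases "R0 \<le> norm x")
      case True
      have "M / norm x \<le> M / R0" using True R0 M by (intro divide_left_mono mult_pos_pos) auto
      then have "\<bar>h x\<bar> \<le> M / R0" using elim True by linarith
      then have "\<bar>h x\<bar> * approx_delta \<epsilon> z x \<le> M / R0 * approx_delta \<epsilon> z x"
        by (intro mult_right_mono) auto
      then show ?thesis using nn by linarith
    next
      case False
      have "\<bar>h x\<bar> * approx_delta \<epsilon> z x \<le> \<bar>h x\<bar> * (1 / \<epsilon>\<^sup>2)"
        by (intro mult_left_mono approx_delta_le \<epsilon>) simp
      then show ?thesis using nn False by simp
    qed
    then show ?case using nn by (simp only: real_norm_def abs_mult abs_of_nonneg[OF approx_delta_nonneg] abs_of_nonneg[OF add_nonneg_nonneg[OF nn]])
  qed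
qed

text \<open>The weak identity is tested with the logarithm cut off at radius \<open>R n\<close>, and
  \<open>n\<close> tends to infinity at fixed \<epsilon>. On the left the cutoff error vanishes
  because its size is of order ln R / R^2 and the mass of \<open>h\<close> is O(R); on the right
  \<Omega> is bounded, so only convergence on a bounded set matters.\<close>

lemma smoothed_identity:
  fixes \<Omega> :: "(real^2) set" and b :: "real^2"
  assumes \<Omega>: "\<Omega> \<in> sets lebesgue" "bounded \<Omega>" and \<epsilon>: "\<epsilon> > 0"
    and weak: "\<And>\<phi>. test_function \<phi> \<Longrightarrow> (LINT x|lebesgue. h x * laplacian \<phi> x)
        = c * (LINT x|lebesgue. indicator \<Omega> x * (b \<bullet> gradient \<phi> x))"
  shows "4 * (LINT x|lebesgue. h x * approx_delta \<epsilon> z x)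
      = c * (LINT x|lebesgue. indicator \<Omega> x * (2 * (b \<bullet> (x - z)) / ((norm (x - z))\<^sup>2 + \<epsilon>\<^sup>2)))"
proof -
  define R where "R n = real n + 1" for n
  have R: "R n > 0" "R n \<ge> 1" for n by (auto simp: R_def)
  define s where "s x = (norm (x - z))\<^sup>2" for x
  have s0: "s x \<ge> 0" for x by (simp add: s_def)
  have sp: "s x + \<epsilon>\<^sup>2 > 0" for x using \<epsilon> s0[of x] by (simp add: add_nonneg_pos)
  have conts: "continuous_on UNIV s" unfolding s_def by (intro continuous_intros)
  define B where "B i n x = bump i (1 - s x / (R n)\<^sup>2)" for i n x
  have contB: "continuous_on UNIV (B i n)" for i n
    unfolding B_def using R(1)[of n]
    by (intro continuous_on_compose2[OF continuous_on_bump[of UNIV i]] continuous_intros conts) auto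
  have contL: "continuous_on UNIV (\<lambda>x. ln (s x + \<epsilon>\<^sup>2))"
    using sp by (intro continuous_intros conts) (auto simp: less_imp_neq[symmetric])
  define \<phi> where "\<phi> n x = log_cutoff \<epsilon> (R n) (s x)" for n x
  have \<phi>: "test_function (\<phi> n)" for n
    unfolding \<phi>_def s_def by (rule test_function_log_cutoff[OF \<epsilon> R(1)])
  define E where "E n x = exp 1 * B 0 n x" for n x
  \<comment> \<open>All terms of the Laplacian, up to the factor 4, in which a derivative falls on
    the cutoff. The remaining terms combine to the cutoff times the kernel
    \<open>approx_delta\<close>.\<close>
  define err where "err n x = exp 1 * (- (B 1 n x / (R n)\<^sup>2 * (ln (s x + \<epsilon>\<^sup>2) + 2 * s x / (s x + \<epsilon>\<^sup>2)))
      + ln (s x + \<epsilon>\<^sup>2) * s x * B 2 n x / R n ^ 4)" for n x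
  have lap: "laplacian (\<phi> n) x = 4 * (E n x * approx_delta \<epsilon> z x) + 4 * err n x" for n x
  proof -
    have "laplacian (\<phi> n) x = 4 * s x * log_cutoff'' \<epsilon> (R n) (s x) + 2 * real (DIM(real^2)) * log_cutoff' \<epsilon> (R n) (s x)"
      unfolding \<phi>_def s_def
      by (rule laplacian_radial) (rule log_cutoff_has_real_derivative[OF \<epsilon> R(1)], assumption)+
    also have "\<dots> = 4 * (s x * log_cutoff'' \<epsilon> (R n) (s x) + log_cutoff' \<epsilon> (R n) (s x))"
      by simp
    also have "s x * log_cutoff'' \<epsilon> (R n) (s x) + log_cutoff' \<epsilon> (R n) (s x) = E n x * approx_delta \<epsilon> z x + err n x"
    proof -
      define p l q where pl: "p = s x + \<epsilon>\<^sup>2" "l = ln (s x + \<epsilon>\<^sup>2)" "q = (R n)\<^sup>2"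
      have q4: "R n ^ 4 = q * q" by (simp add: pl(3) power2_eq_square power4_eq_xxxx)
      have nz: "p \<noteq> 0" "q \<noteq> 0" using sp[of x] R(1)[of n] by (auto simp: pl)
      have e2: "\<epsilon>\<^sup>2 = p - s x" by (simp add: pl)
      show ?thesis
        unfolding log_cutoff''_def log_cutoff'_def E_def err_def approx_delta_def
        unfolding B_def[symmetric]
        unfolding s_def[symmetric] pl[symmetric] q4 e2
        using nz by (simp add: field_simps power2_eq_square)
    qed
    finally show ?thesis by simp
  qed
  have grad: "gradient (\<phi> n) x = (2 * log_cutoff' \<epsilon> (R n) (s x)) *\<^sub>R (x - z)" for n x
    unfolding \<phi>_def s_def by (rule gradient_radial) (rule log_cutoff_has_real_derivative(1)[OF \<epsilon> R(1)])
  have E01: "0 \<le> E n x" "E n x \<le> 1" for n x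
  proof -
    have "1 - s x / (R n)\<^sup>2 \<le> 1" using s0 by simp
    then have "bump 0 (1 - s x / (R n)\<^sup>2) \<le> exp (- 1)"
      by (auto simp: bump_0 divide_simps)
    then have "exp 1 * bump 0 (1 - s x / (R n)\<^sup>2) \<le> exp 1 * exp (- 1)" by (intro mult_left_mono) auto
    then show "E n x \<le> 1" unfolding E_def B_def by (simp flip: exp_add)
    show "0 \<le> E n x" unfolding E_def B_def by (simp add: bump_0)
  qed
  have R_inf: "filterlim R at_top sequentially" unfolding R_def by real_asymp
  have B_lim: "(\<lambda>n. B i n x) \<longlonglongrightarrow> bump i 1" for i x
  proof -
    have "(\<lambda>n. s x / (R n)\<^sup>2) \<longlonglongrightarrow> 0"
      by (intro tendsto_divide_0[OF tendsto_const] filterlim_at_top_imp_at_infinity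
          filterlim_pow_at_top R_inf) simp
    then have "(\<lambda>n. 1 - s x / (R n)\<^sup>2) \<longlonglongrightarrow> 1 - 0"
      by (intro tendsto_intros)
    moreover have "isCont (bump i) (1 - 0)"
      using DERIV_isCont[OF bump_has_real_derivative] .
    ultimately show ?thesis
      unfolding B_def using isCont_tendsto_compose by fastforce
  qed
  have E_lim: "(\<lambda>n. E n x) \<longlonglongrightarrow> 1" for x
  proof -
    have "(\<lambda>n. exp 1 * B 0 n x) \<longlonglongrightarrow> exp 1 * bump 0 1"
      by (intro tendsto_intros B_lim)
    then show ?thesis by (simp add: E_def bump_0 flip: exp_add)
  qed
  note h\<delta> = integrable_mult_approx_delta[OF \<epsilon>, of z]
  have measE: "(\<lambda>x. h x * (E n x * approx_delta \<epsilon> z x)) \<in> borel_measurable lebesgue" for n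
    unfolding E_def
    by (intro borel_measurable_times h_meas borel_measurable_const continuous_imp_lebesgue_measurable
        continuous_on_approx_delta \<epsilon> contB)
  have leE: "norm (h x * (E n x * approx_delta \<epsilon> z x)) \<le> norm (h x * approx_delta \<epsilon> z x)" for n x
  proof -
    have "norm (h x * (E n x * approx_delta \<epsilon> z x)) = E n x * norm (h x * approx_delta \<epsilon> z x)"
      using E01[of n x] by (simp add: abs_mult)
    also have "\<dots> \<le> 1 * norm (h x * approx_delta \<epsilon> z x)"
      by (intro mult_right_mono E01) simp
    finally show ?thesis by simp
  qed
  have intE: "integrable lebesgue (\<lambda>x. h x * (E n x * approx_delta \<epsilon> z x))" for n
    by (rule Bochner_Integration.integrable_bound[OF h\<delta> measE]) (use leE in simp)
  have limE: "(\<lambda>n. LINT x|lebesgue. h x * (E n x * approx_delta \<epsilon> z x)) \<longlonglongrightarrow> (LINT x|lebesgue. h x * approx_delta \<epsilon> z x)"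
  proof (rule integral_dominated_convergence[OF _ measE integrable_norm[OF h\<delta>]])
    show "(\<lambda>x. h x * approx_delta \<epsilon> z x) \<in> borel_measurable lebesgue"
      by (rule borel_measurable_integrable[OF h\<delta>])
    show "AE x in lebesgue. (\<lambda>n. h x * (E n x * approx_delta \<epsilon> z x)) \<longlonglongrightarrow> h x * approx_delta \<epsilon> z x"
    proof (rule AE_I2)
      fix x
      have "(\<lambda>n. h x * (E n x * approx_delta \<epsilon> z x)) \<longlonglongrightarrow> h x * (1 * approx_delta \<epsilon> z x)"
        by (intro tendsto_intros E_lim)
      then show "(\<lambda>n. h x * (E n x * approx_delta \<epsilon> z x)) \<longlonglongrightarrow> h x * approx_delta \<epsilon> z x" by simp
    qed
    show "AE x in lebesgue. norm (h x * (E n x * approx_delta \<epsilon> z x)) \<le> norm (h x * approx_delta \<epsilon> z x)" for n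
      by (intro AE_I2 leE)
  qed
  obtain K1 where K1: "K1 > 0" "\<And>t. t \<le> 1 \<Longrightarrow> \<bar>bump 1 t\<bar> \<le> K1" by (rule bump_bounded[where i = 1, OF that])
  obtain K2 where K2: "K2 > 0" "\<And>t. t \<le> 1 \<Longrightarrow> \<bar>bump 2 t\<bar> \<le> K2" by (rule bump_bounded[where i = 2, OF that])
  have B1: "\<bar>B 1 n x\<bar> \<le> K1" and B2: "\<bar>B 2 n x\<bar> \<le> K2" for n x
    unfolding B_def using K1(2) K2(2) s0 by simp_all
  \<comment> \<open>On \<open>cball z (R n)\<close> the argument of the logarithm lies between
    \<open>\<epsilon>\<^sup>2\<close> and \<open>(R n)\<^sup>2 + \<epsilon>\<^sup>2\<close>; the
    logarithm may be negative, hence both end values enter.\<close>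
  define L where "L n = \<bar>ln (\<epsilon>\<^sup>2)\<bar> + \<bar>ln ((R n)\<^sup>2 + \<epsilon>\<^sup>2)\<bar>" for n
  define w where "w n = exp 1 * (K1 + K2) * (L n + 2) / (R n)\<^sup>2" for n
  have w0: "w n \<ge> 0" for n
    unfolding w_def L_def using K1(1) K2(1) by (intro divide_nonneg_nonneg mult_nonneg_nonneg add_nonneg_nonneg) auto
  have err_le: "\<bar>err n x\<bar> \<le> w n * indicator (cball z (R n)) x" for n x
  proof (cases "x \<in> cball z (R n)")
    case False
    then have "(R n)\<^sup>2 \<le> s x"
      unfolding s_def using R(1)[of n] by (intro power_mono) (auto simp: dist_norm norm_minus_commute)
    then have "1 - s x / (R n)\<^sup>2 \<le> 0" using R(1)[of n] by simp
    then show ?thesis using False by (simp add: err_def B_def)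
  next
    case True
    define l where "l = ln (s x + \<epsilon>\<^sup>2)"
    have sR: "s x \<le> (R n)\<^sup>2"
      unfolding s_def using True by (intro power_mono) (auto simp: dist_norm norm_minus_commute)
    have l: "\<bar>l\<bar> \<le> L n"
      unfolding l_def L_def using \<epsilon> sR s0[of x] by (intro abs_ln_le) auto
    have q: "0 \<le> 2 * s x / (s x + \<epsilon>\<^sup>2)" "2 * s x / (s x + \<epsilon>\<^sup>2) \<le> 2"
      using s0[of x] sp[of x] by (simp_all add: divide_simps)
    have t1: "\<bar>B 1 n x / (R n)\<^sup>2 * (l + 2 * s x / (s x + \<epsilon>\<^sup>2))\<bar> \<le> K1 / (R n)\<^sup>2 * (L n + 2)"
      unfolding abs_mult abs_divide using B1[of n x] l q K1(1) R(1)[of n]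
      by (intro mult_mono divide_mono) (auto intro: order_trans[OF abs_triangle_ineq])
    have "s x / R n ^ 4 \<le> (R n)\<^sup>2 / R n ^ 4" using sR by (intro divide_right_mono) auto
    also have "\<dots> = 1 / (R n)\<^sup>2" using R(1)[of n] by (simp add: power2_eq_square power4_eq_xxxx)
    finally have sR4: "s x / R n ^ 4 \<le> 1 / (R n)\<^sup>2" .
    have "\<bar>l * s x * B 2 n x / R n ^ 4\<bar> = \<bar>l\<bar> * \<bar>B 2 n x\<bar> * (s x / R n ^ 4)"
      using s0[of x] by (simp add: abs_mult)
    also have "\<dots> \<le> L n * K2 * (1 / (R n)\<^sup>2)"
      using l B2[of n x] sR4 s0[of x] K2(1) by (intro mult_mono) auto
    also have "\<dots> \<le> K2 / (R n)\<^sup>2 * (L n + 2)"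
      using K2(1) by (simp add: divide_simps algebra_simps)
    finally have t2: "\<bar>l * s x * B 2 n x / R n ^ 4\<bar> \<le> K2 / (R n)\<^sup>2 * (L n + 2)" .
    have "\<bar>err n x\<bar> = exp 1 * \<bar>- (B 1 n x / (R n)\<^sup>2 * (l + 2 * s x / (s x + \<epsilon>\<^sup>2))) + l * s x * B 2 n x / R n ^ 4\<bar>"
      by (simp add: err_def l_def abs_mult)
    also have "\<dots> \<le> exp 1 * (K1 / (R n)\<^sup>2 * (L n + 2) + K2 / (R n)\<^sup>2 * (L n + 2))"
      using t1 t2 by (intro mult_left_mono order_trans[OF abs_triangle_ineq] add_mono) auto
    also have "\<dots> = w n" by (simp add: w_def add_divide_distrib algebra_simps)
    finally show ?thesis using True by simp
  qed
  have conterr: "continuous_on UNIV (err n)" for n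
    unfolding err_def using sp R(1)[of n]
    by (intro continuous_intros contB contL conts) (auto simp: less_imp_neq[symmetric])
  have meas_err: "(\<lambda>x. h x * err n x) \<in> borel_measurable lebesgue" for n
    by (intro borel_measurable_times h_meas continuous_imp_lebesgue_measurable conterr)
  have herr_le: "norm (h x * err n x) \<le> w n * (indicator (cball z (R n)) x * \<bar>h x\<bar>)" for n x
    using mult_left_mono[OF err_le[of n x] abs_ge_zero[of "h x"]] by (simp add: abs_mult mult_ac)
  have int_w: "integrable lebesgue (\<lambda>x. w n * (indicator (cball z (R n)) x * \<bar>h x\<bar>))" for n
    by (intro integrable_mult_right h_abs_int) simp
  have int_err: "integrable lebesgue (\<lambda>x. h x * err n x)" for n
    by (rule Bochner_Integration.integrable_bound[OF int_w[of n] meas_err])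
      (intro AE_I2 order_trans[OF herr_le], simp only: real_norm_def abs_ge_self)
  obtain \<alpha> \<beta> where growth: "\<And>R. R > 0 \<Longrightarrow> (LINT x|lebesgue. indicator (cball z R) x * \<bar>h x\<bar>) \<le> \<alpha> + \<beta> * R"
    by (rule mass_growth[OF that])
  have "(\<lambda>n. LINT x|lebesgue. h x * err n x) \<longlonglongrightarrow> 0"
  proof (rule Lim_null_comparison)
    show "\<forall>\<^sub>F n in sequentially. norm (LINT x|lebesgue. h x * err n x) \<le> w n * (\<alpha> + \<beta> * R n)"
    proof (intro always_eventually allI)
      fix n
      have "norm (LINT x|lebesgue. h x * err n x) \<le> (LINT x|lebesgue. norm (h x * err n x))"
        by (rule integral_norm_bound)
      also have "\<dots> \<le> (LINT x|lebesgue. w n * (indicator (cball z (R n)) x * \<bar>h x\<bar>))"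
        by (rule integral_mono[OF integrable_norm[OF int_err] int_w herr_le])
      also have "\<dots> = w n * (LINT x|lebesgue. indicator (cball z (R n)) x * \<bar>h x\<bar>)"
        by (rule integral_mult_right_zero)
      also have "\<dots> \<le> w n * (\<alpha> + \<beta> * R n)"
        by (intro mult_left_mono growth R w0)
      finally show "norm (LINT x|lebesgue. h x * err n x) \<le> w n * (\<alpha> + \<beta> * R n)" .
    qed
    have e2: "\<epsilon>\<^sup>2 > 0" using \<epsilon> by simp
    have "((\<lambda>n. \<bar>ln ((real n + 1)\<^sup>2 + e)\<bar> / (real n + 1)) \<longlonglongrightarrow> 0)" if "e > 0" for e :: real
      using that by real_asymp
    from this[OF e2] have l1: "(\<lambda>n. \<bar>ln ((R n)\<^sup>2 + \<epsilon>\<^sup>2)\<bar> / R n) \<longlonglongrightarrow> 0" by (simp add: R_def)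
    have l2: "(\<lambda>n. 1 / R n) \<longlonglongrightarrow> 0" unfolding R_def by real_asymp
    \<comment> \<open>The bound \<open>w n * (\<alpha> + \<beta> * R n)\<close> is of order ln R /
      R; it is rewritten as a product of factors with known limits.\<close>
    have "(\<lambda>n. exp 1 * (K1 + K2) * (((\<bar>ln (\<epsilon>\<^sup>2)\<bar> + 2) * (1 / R n) + \<bar>ln ((R n)\<^sup>2 + \<epsilon>\<^sup>2)\<bar> / R n) * (\<alpha> * (1 / R n) + \<beta>)))
        \<longlonglongrightarrow> exp 1 * (K1 + K2) * (((\<bar>ln (\<epsilon>\<^sup>2)\<bar> + 2) * 0 + 0) * (\<alpha> * 0 + \<beta>))"
      by (intro tendsto_mult tendsto_add tendsto_const l1 l2)
    moreover have "exp 1 * (K1 + K2) * (((\<bar>ln (\<epsilon>\<^sup>2)\<bar> + 2) * (1 / R n) + \<bar>ln ((R n)\<^sup>2 + \<epsilon>\<^sup>2)\<bar> / R n) * (\<alpha> * (1 / R n) + \<beta>))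
        = w n * (\<alpha> + \<beta> * R n)" for n
    proof -
      define l where "l = \<bar>ln ((R n)\<^sup>2 + \<epsilon>\<^sup>2)\<bar>"
      have "((k + 2) * (1 / r) + l / r) * (\<alpha> * (1 / r) + \<beta>) = (k + l + 2) / r\<^sup>2 * (\<alpha> + \<beta> * r)" if "r > 0" for k r
        using that by (simp add: field_simps power2_eq_square)
      from this[OF R(1)[of n], of "\<bar>ln (\<epsilon>\<^sup>2)\<bar>"] show ?thesis
        unfolding w_def L_def l_def[symmetric] by (simp only: times_divide_eq_right[symmetric] mult.assoc)
    qed
    ultimately show "(\<lambda>n. w n * (\<alpha> + \<beta> * R n)) \<longlonglongrightarrow> 0" by simp
  qed
  from tendsto_add[OF tendsto_mult[OF tendsto_const[of 4] limE] tendsto_mult[OF tendsto_const[of 4] this]]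
  have lhs: "(\<lambda>n. 4 * (LINT x|lebesgue. h x * (E n x * approx_delta \<epsilon> z x)) + 4 * (LINT x|lebesgue. h x * err n x))
      \<longlonglongrightarrow> 4 * (LINT x|lebesgue. h x * approx_delta \<epsilon> z x)"
    by simp
  have lap_int: "4 * (LINT x|lebesgue. h x * (E n x * approx_delta \<epsilon> z x)) + 4 * (LINT x|lebesgue. h x * err n x)
      = (LINT x|lebesgue. h x * laplacian (\<phi> n) x)" for n
  proof -
    have "(LINT x|lebesgue. h x * laplacian (\<phi> n) x)
        = (LINT x|lebesgue. 4 * (h x * (E n x * approx_delta \<epsilon> z x)) + 4 * (h x * err n x))"
      unfolding lap by (simp add: algebra_simps)
    also have "\<dots> = (LINT x|lebesgue. 4 * (h x * (E n x * approx_delta \<epsilon> z x))) + (LINT x|lebesgue. 4 * (h x * err n x))"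
      by (intro Bochner_Integration.integral_add integrable_mult_right intE int_err)
    finally show ?thesis by simp
  qed
  obtain S0 where S0: "S0 > 0" "\<And>x. x \<in> \<Omega> \<Longrightarrow> norm (x - z) \<le> S0"
  proof -
    obtain r where r: "r > 0" "\<And>x. x \<in> \<Omega> \<Longrightarrow> norm x \<le> r" using \<Omega>(2) by (auto simp: bounded_pos)
    have "norm (x - z) \<le> r + norm z" if "x \<in> \<Omega>" for x
      using norm_triangle_ineq4[of x z] r(2)[OF that] by linarith
    then show ?thesis using that[of "r + norm z"] r(1) by (simp add: add_pos_nonneg)
  qed
  \<comment> \<open>\<open>L'\<close> bounds the logarithm on \<Omega>, and \<open>D\<close> bounds
    the integrand there independently of \<open>n\<close>; for the latter \<open>R n \<ge> 1\<close>
    is used.\<close>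
  define L' where "L' = \<bar>ln (\<epsilon>\<^sup>2)\<bar> + \<bar>ln (S0\<^sup>2 + \<epsilon>\<^sup>2)\<bar>"
  define D where "D = 2 * (1 / \<epsilon>\<^sup>2 + exp 1 * L' * K1) * (norm b * S0)"
  have A': "log_cutoff' \<epsilon> (R n) (s x) = E n x / (s x + \<epsilon>\<^sup>2) - exp 1 * ln (s x + \<epsilon>\<^sup>2) * B 1 n x / (R n)\<^sup>2" for n x
    unfolding log_cutoff'_def E_def B_def by (simp add: algebra_simps)
  have contA': "continuous_on UNIV (\<lambda>x. log_cutoff' \<epsilon> (R n) (s x))" for n
    unfolding A' E_def using sp R(1)[of n]
    by (intro continuous_intros contB contL conts) (auto simp: less_imp_neq[symmetric])
  have "(\<lambda>n. LINT x|lebesgue. indicator \<Omega> x * (b \<bullet> gradient (\<phi> n) x))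
      \<longlonglongrightarrow> (LINT x|lebesgue. indicator \<Omega> x * (2 * (b \<bullet> (x - z)) / ((norm (x - z))\<^sup>2 + \<epsilon>\<^sup>2)))"
  proof (rule integral_dominated_convergence)
    show "integrable lebesgue (\<lambda>x. indicator \<Omega> x * D)"
      by (intro integrable_mult_left bounded_measurable_integrable_indicator \<Omega>)
    show "(\<lambda>x. indicator \<Omega> x * (2 * (b \<bullet> (x - z)) / ((norm (x - z))\<^sup>2 + \<epsilon>\<^sup>2))) \<in> borel_measurable lebesgue"
      using sp unfolding s_def[symmetric]
      by (intro borel_measurable_times borel_measurable_indicator \<Omega> continuous_imp_lebesgue_measurable continuous_intros conts)
        (auto simp: less_imp_neq[symmetric])
    show "(\<lambda>x. indicator \<Omega> x * (b \<bullet> gradient (\<phi> n) x)) \<in> borel_measurable lebesgue" for n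
      unfolding grad
      by (intro borel_measurable_times borel_measurable_indicator \<Omega> continuous_imp_lebesgue_measurable
          continuous_on_inner continuous_on_scaleR continuous_on_mult contA' continuous_intros)
    show "AE x in lebesgue. (\<lambda>n. indicator \<Omega> x * (b \<bullet> gradient (\<phi> n) x))
        \<longlonglongrightarrow> indicator \<Omega> x * (2 * (b \<bullet> (x - z)) / ((norm (x - z))\<^sup>2 + \<epsilon>\<^sup>2))"
    proof (rule AE_I2)
      fix x
      have "(\<lambda>n. 1 / (R n)\<^sup>2) \<longlonglongrightarrow> 0" unfolding R_def by real_asymp
      then have "(\<lambda>n. E n x / (s x + \<epsilon>\<^sup>2) - exp 1 * ln (s x + \<epsilon>\<^sup>2) * B 1 n x * (1 / (R n)\<^sup>2))
          \<longlonglongrightarrow> 1 / (s x + \<epsilon>\<^sup>2) - exp 1 * ln (s x + \<epsilon>\<^sup>2) * bump 1 1 * 0"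
        using sp[of x] by (intro tendsto_intros E_lim B_lim) auto
      then have "(\<lambda>n. log_cutoff' \<epsilon> (R n) (s x)) \<longlonglongrightarrow> 1 / (s x + \<epsilon>\<^sup>2)"
        unfolding A' by simp
      then have "(\<lambda>n. indicator \<Omega> x * (2 * log_cutoff' \<epsilon> (R n) (s x) * (b \<bullet> (x - z))))
          \<longlonglongrightarrow> indicator \<Omega> x * (2 * (1 / (s x + \<epsilon>\<^sup>2)) * (b \<bullet> (x - z)))"
        by (intro tendsto_intros)
      then show "(\<lambda>n. indicator \<Omega> x * (b \<bullet> gradient (\<phi> n) x))
          \<longlonglongrightarrow> indicator \<Omega> x * (2 * (b \<bullet> (x - z)) / ((norm (x - z))\<^sup>2 + \<epsilon>\<^sup>2))"
        unfolding grad s_def by simp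
    qed
    show "AE x in lebesgue. norm (indicator \<Omega> x * (b \<bullet> gradient (\<phi> n) x)) \<le> indicator \<Omega> x * D" for n
    proof (rule AE_I2)
      fix x
      show "norm (indicator \<Omega> x * (b \<bullet> gradient (\<phi> n) x)) \<le> indicator \<Omega> x * D"
      proof (cases "x \<in> \<Omega>")
        case True
        have "s x \<le> S0\<^sup>2" unfolding s_def using S0(2)[OF True] by (intro power_mono) auto
        then have l: "\<bar>ln (s x + \<epsilon>\<^sup>2)\<bar> \<le> L'"
          unfolding L'_def using \<epsilon> s0[of x] by (intro abs_ln_le) auto
        have "\<bar>exp 1 * ln (s x + \<epsilon>\<^sup>2) * B 1 n x / (R n)\<^sup>2\<bar> = exp 1 * \<bar>ln (s x + \<epsilon>\<^sup>2)\<bar> * \<bar>B 1 n x\<bar> * (1 / (R n)\<^sup>2)"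
          by (simp add: abs_mult)
        also have "\<dots> \<le> exp 1 * L' * K1 * 1"
          using l B1[of n x] R(2)[of n] K1(1) by (intro mult_mono) (auto simp: divide_le_eq_1)
        finally have t2: "\<bar>exp 1 * ln (s x + \<epsilon>\<^sup>2) * B 1 n x / (R n)\<^sup>2\<bar> \<le> exp 1 * L' * K1" by simp
        have t1: "\<bar>E n x / (s x + \<epsilon>\<^sup>2)\<bar> \<le> 1 / \<epsilon>\<^sup>2"
          using E01[of n x] s0[of x] sp[of x] \<epsilon> by (simp add: abs_of_pos frac_le)
        have bd: "\<bar>log_cutoff' \<epsilon> (R n) (s x)\<bar> \<le> 1 / \<epsilon>\<^sup>2 + exp 1 * L' * K1"
          unfolding A' using t1 t2 by linarith
        have bz: "\<bar>b \<bullet> (x - z)\<bar> \<le> norm b * S0"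
          using Cauchy_Schwarz_ineq2[of b "x - z"] mult_left_mono[OF S0(2)[OF True] norm_ge_zero[of b]] by linarith
        have "\<bar>2 * log_cutoff' \<epsilon> (R n) (s x) * (b \<bullet> (x - z))\<bar> \<le> D"
          unfolding D_def abs_mult using bd bz by (intro mult_mono) auto
        then show ?thesis using True by (simp add: grad)
      qed simp
    qed
  qed
  from tendsto_mult[OF tendsto_const[of c] this]
  have "(\<lambda>n. c * (LINT x|lebesgue. indicator \<Omega> x * (b \<bullet> gradient (\<phi> n) x)))
      \<longlonglongrightarrow> c * (LINT x|lebesgue. indicator \<Omega> x * (2 * (b \<bullet> (x - z)) / ((norm (x - z))\<^sup>2 + \<epsilon>\<^sup>2)))" .
  moreover have "(\<lambda>n. c * (LINT x|lebesgue. indicator \<Omega> x * (b \<bullet> gradient (\<phi> n) x)))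
      \<longlonglongrightarrow> 4 * (LINT x|lebesgue. h x * approx_delta \<epsilon> z x)"
    using lhs unfolding lap_int weak[OF \<phi>] .
  ultimately show ?thesis by (rule LIMSEQ_unique[symmetric])
qed

end

text \<open>The inequality \<open>4 * \<omega>\<^sup>2 * \<epsilon>\<^sup>2 \<le> (\<omega>\<^sup>2
  + \<epsilon>\<^sup>2)\<^sup>2\<close> removes \<epsilon>. With \<omega> the distance to the
  centre, it gives an integrable bound, independent of \<epsilon>, for the kernel times a function
  vanishing to first order there. At \<open>\<omega> = 0\<close> both sides are 0.\<close>

lemma kernel_bound_near:
  fixes \<omega> \<epsilon> :: real
  assumes "\<epsilon> > 0" "\<omega> \<ge> 0"
  shows "\<omega> * (\<epsilon>\<^sup>2 / (\<omega>\<^sup>2 + \<epsilon>\<^sup>2)\<^sup>2) \<le> 1 / 4 * (1 / \<omega>)"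
proof (cases "\<omega> = 0")
  case False
  then have w: "\<omega> > 0" using assms by simp
  have "0 \<le> (\<omega>\<^sup>2 - \<epsilon>\<^sup>2)\<^sup>2" by simp
  then have "4 * \<omega>\<^sup>2 * \<epsilon>\<^sup>2 \<le> (\<omega>\<^sup>2 + \<epsilon>\<^sup>2)\<^sup>2" by (simp add: power2_eq_square algebra_simps)
  then show ?thesis
    using w assms by (simp add: field_simps power2_eq_square add_pos_pos)
qed simp

text \<open>At distance at least \<open>r\<close> from the centre all kernels with
  \<open>\<epsilon> \<le> 1\<close> are dominated by a multiple of the one with
  \<open>\<epsilon> = 1\<close>, since there
  \<open>1 \<le> \<omega>\<^sup>2 / r\<^sup>2\<close>.\<close>

lemma kernel_bound_far:
  fixes \<omega> \<epsilon> r :: real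
  assumes "0 < \<epsilon>" "\<epsilon> \<le> 1" "0 < r" "r \<le> \<omega>"
  shows "\<epsilon>\<^sup>2 / (\<omega>\<^sup>2 + \<epsilon>\<^sup>2)\<^sup>2 \<le> (1 + 1 / r\<^sup>2)\<^sup>2 * (1 / (\<omega>\<^sup>2 + 1)\<^sup>2)"
proof -
  have w: "\<omega> > 0" using assms by simp
  have "r\<^sup>2 \<le> \<omega>\<^sup>2" using assms by (intro power_mono) auto
  then have "1 \<le> 1 / r\<^sup>2 * \<omega>\<^sup>2" using assms(3) by (simp add: field_simps)
  then have "\<omega>\<^sup>2 + 1 \<le> (1 + 1 / r\<^sup>2) * \<omega>\<^sup>2" by (simp add: algebra_simps)
  then have "(\<omega>\<^sup>2 + 1)\<^sup>2 \<le> ((1 + 1 / r\<^sup>2) * \<omega>\<^sup>2)\<^sup>2" by (intro power_mono) auto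
  then have a: "(\<omega>\<^sup>2 + 1)\<^sup>2 \<le> (1 + 1 / r\<^sup>2)\<^sup>2 * (\<omega>\<^sup>2)\<^sup>2" by (simp add: power_mult_distrib)
  have "(\<omega>\<^sup>2)\<^sup>2 \<le> (\<omega>\<^sup>2 + \<epsilon>\<^sup>2)\<^sup>2" by (intro power_mono) auto
  moreover have "\<epsilon>\<^sup>2 \<le> 1" using assms by (simp add: power_le_one)
  ultimately have "\<epsilon>\<^sup>2 / (\<omega>\<^sup>2 + \<epsilon>\<^sup>2)\<^sup>2 \<le> 1 / (\<omega>\<^sup>2)\<^sup>2" using w by (intro frac_le) auto
  also have "\<dots> \<le> (1 + 1 / r\<^sup>2)\<^sup>2 * (1 / (\<omega>\<^sup>2 + 1)\<^sup>2)"
  proof -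
    have "(\<omega>\<^sup>2 + 1)\<^sup>2 > 0" by (intro zero_less_power add_nonneg_pos) auto
    then show ?thesis using a w by (simp add: field_simps)
  qed
  finally show ?thesis .
qed

text \<open>The limit \<epsilon> to 0 in \<open>smoothed_identity\<close>. Near \<open>z\<close> the
  function \<open>h\<close> is affine, so \<open>h - C\<close> vanishes to first order and
  compensates the concentration of the kernel; what remains on the left is \<open>C\<close> times
  the total mass.\<close>

lemma pointwise_identity:
  fixes h :: "real^2 \<Rightarrow> real" and \<Omega> :: "(real^2) set" and b d :: "real^2"
  assumes h_meas: "h \<in> borel_measurable lebesgue"
    and h_int: "\<And>K. compact K \<Longrightarrow> integrable lebesgue (\<lambda>x. indicator K x * h x)"
    and h_far: "AE x in lebesgue. R0 \<le> norm x \<longrightarrow> \<bar>h x\<bar> \<le> M / norm x"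
    and R0: "R0 > 0" and M: "M \<ge> 0"
    and \<Omega>: "open \<Omega>" "bounded \<Omega>"
    and weak: "\<And>\<phi>. test_function \<phi> \<Longrightarrow> (LINT x|lebesgue. h x * laplacian \<phi> x)
        = c * (LINT x|lebesgue. indicator \<Omega> x * (b \<bullet> gradient \<phi> x))"
    and h_affine: "AE x in lebesgue. x \<in> \<Omega> \<longrightarrow> h x = d \<bullet> x + c0"
    and z: "z \<in> \<Omega>"
  shows "4 * delta_mass * (d \<bullet> z + c0)
      = c * (LINT x|lebesgue. indicator \<Omega> x * (2 * (b \<bullet> (x - z)) / (norm (x - z))\<^sup>2))"
proof -
  define e where "e n = 1 / (real n + 1)" for n
  have e: "e n > 0" "e n \<le> 1" for n by (auto simp: e_def)
  have e_lim: "(\<lambda>n. (e n)\<^sup>2) \<longlonglongrightarrow> 0" unfolding e_def by real_asymp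
  have \<Omega>m: "\<Omega> \<in> sets lebesgue" using \<Omega>(1) by auto
  obtain r where r: "r > 0" "ball z r \<subseteq> \<Omega>" using \<Omega>(1) z by (auto simp: open_contains_ball)
  define C where "C = d \<bullet> z + c0"
  note int_h = integrable_mult_approx_delta[OF h_meas h_int h_far R0 M]
  have int_hC: "integrable lebesgue (\<lambda>x. (h x - C) * approx_delta (e n) z x)" for n
    unfolding left_diff_distrib
    by (intro Bochner_Integration.integrable_diff integrable_mult_right approx_delta_integral int_h e)
  have split: "(LINT x|lebesgue. h x * approx_delta (e n) z x)
      = (LINT x|lebesgue. (h x - C) * approx_delta (e n) z x) + C * delta_mass" for n
  proof -
    have "(LINT x|lebesgue. (h x - C) * approx_delta (e n) z x)
        = (LINT x|lebesgue. h x * approx_delta (e n) z x) - (LINT x|lebesgue. C * approx_delta (e n) z x)"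
      unfolding left_diff_distrib
      by (intro Bochner_Integration.integral_diff integrable_mult_right approx_delta_integral int_h e)
    then show ?thesis using approx_delta_integral(2)[OF e(1)] by simp
  qed
  \<comment> \<open>A majorant independent of \<epsilon>: the first summand serves inside
    \<open>ball z r\<close>, the second outside.\<close>
  define W where "W x = norm d / 4 * (indicator (ball z r) x / norm (x - z))
      + (1 + 1 / r\<^sup>2)\<^sup>2 * (\<bar>h x * approx_delta 1 z x\<bar> + \<bar>C\<bar> * approx_delta 1 z x)" for x
  have int_W: "integrable lebesgue W"
    unfolding W_def
    by (intro Bochner_Integration.integrable_add integrable_mult_right inverse_norm_ball r integrable_abs int_h approx_delta_integral) simp_all
  have "(\<lambda>n. LINT x|lebesgue. (h x - C) * approx_delta (e n) z x) \<longlonglongrightarrow> (LINT x|(lebesgue :: (real^2) measure). 0)"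
  proof (rule integral_dominated_convergence[OF _ borel_measurable_integrable[OF int_hC] int_W])
    show "AE x in lebesgue. (\<lambda>n. (h x - C) * approx_delta (e n) z x) \<longlonglongrightarrow> 0"
      using h_affine
    proof eventually_elim
      case (elim x)
      show ?case
      proof (cases "x = z")
        case True
        \<comment> \<open>At \<open>z\<close> itself the kernel blows up, but the factor
          \<open>h z - C\<close> is 0.\<close>
        then show ?thesis using elim z by (simp add: C_def)
      next
        case False
        then have "(\<lambda>n. (h x - C) * ((e n)\<^sup>2 / ((norm (x - z))\<^sup>2 + (e n)\<^sup>2)\<^sup>2))
            \<longlonglongrightarrow> (h x - C) * (0 / ((norm (x - z))\<^sup>2 + 0)\<^sup>2)"
          by (intro tendsto_intros e_lim) auto
        then show ?thesis by (simp add: approx_delta_def)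
      qed
    qed
    show "AE x in lebesgue. norm ((h x - C) * approx_delta (e n) z x) \<le> W x" for n
      using h_affine
    proof eventually_elim
      case (elim x)
      have nn: "0 \<le> norm d / 4 * (indicator (ball z r) x / norm (x - z))"
        "0 \<le> (1 + 1 / r\<^sup>2)\<^sup>2 * (\<bar>h x * approx_delta 1 z x\<bar> + \<bar>C\<bar> * approx_delta 1 z x)"
        by (intro mult_nonneg_nonneg divide_nonneg_nonneg add_nonneg_nonneg, simp_all)+
      show ?case
      proof (cases "x \<in> ball z r")
        case True
        then have "h x - C = d \<bullet> (x - z)"
          using elim r(2) by (auto simp: C_def inner_diff_right)
        then have "\<bar>h x - C\<bar> \<le> norm d * norm (x - z)"
          using Cauchy_Schwarz_ineq2[of d "x - z"] by simp
        then have "norm ((h x - C) * approx_delta (e n) z x) \<le> norm d * norm (x - z) * approx_delta (e n) z x"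
          by (simp add: abs_mult mult_right_mono)
        also have "\<dots> = norm d * (norm (x - z) * ((e n)\<^sup>2 / ((norm (x - z))\<^sup>2 + (e n)\<^sup>2)\<^sup>2))"
          by (simp add: approx_delta_def)
        also have "\<dots> \<le> norm d * (1 / 4 * (1 / norm (x - z)))"
          by (intro mult_left_mono kernel_bound_near e) auto
        also have "\<dots> = norm d / 4 * (indicator (ball z r) x / norm (x - z))"
          using True by simp
        also have "\<dots> \<le> W x" using nn unfolding W_def by linarith
        finally show ?thesis .
      next
        case False
        then have "r \<le> norm (x - z)" by (simp add: dist_norm norm_minus_commute)
        from kernel_bound_far[OF e[of n] r(1) this]
        have k: "approx_delta (e n) z x \<le> (1 + 1 / r\<^sup>2)\<^sup>2 * approx_delta 1 z x"
          by (simp add: approx_delta_def)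
        have "norm ((h x - C) * approx_delta (e n) z x) = \<bar>h x - C\<bar> * approx_delta (e n) z x"
          by (simp add: abs_mult)
        also have "\<dots> \<le> (\<bar>h x\<bar> + \<bar>C\<bar>) * ((1 + 1 / r\<^sup>2)\<^sup>2 * approx_delta 1 z x)"
          by (intro mult_mono k abs_triangle_ineq4) auto
        also have "\<dots> = (1 + 1 / r\<^sup>2)\<^sup>2 * (\<bar>h x * approx_delta 1 z x\<bar> + \<bar>C\<bar> * approx_delta 1 z x)"
          by (simp add: abs_mult distrib_left distrib_right mult_ac)
        also have "\<dots> \<le> W x" using nn unfolding W_def by linarith
        finally show ?thesis .
      qed
    qed
  qed simp
  then have lim0: "(\<lambda>n. LINT x|lebesgue. (h x - C) * approx_delta (e n) z x) \<longlonglongrightarrow> 0" by simp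
  have "(\<lambda>n. 4 * ((LINT x|lebesgue. (h x - C) * approx_delta (e n) z x) + C * delta_mass)) \<longlonglongrightarrow> 4 * (0 + C * delta_mass)"
    by (intro tendsto_intros lim0)
  then have lhs: "(\<lambda>n. 4 * (LINT x|lebesgue. h x * approx_delta (e n) z x)) \<longlonglongrightarrow> 4 * delta_mass * C"
    by (simp add: split mult_ac)
  have cont: "continuous_on UNIV (\<lambda>x. 2 * (b \<bullet> (x - z)) / ((norm (x - z))\<^sup>2 + (e n)\<^sup>2))" for n
  proof -
    have "(norm (x - z))\<^sup>2 + (e n)\<^sup>2 \<noteq> 0" for x
      using e(1)[of n] by (simp add: add_nonneg_eq_0_iff)
    then show ?thesis by (intro continuous_intros) auto
  qed
  have meas0: "(\<lambda>x. 2 * (b \<bullet> (x - z)) / (norm (x - z))\<^sup>2) \<in> borel_measurable lebesgue"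
    by (intro borel_measurable_divide continuous_imp_lebesgue_measurable continuous_intros)
  have "(\<lambda>n. LINT x|lebesgue. indicator \<Omega> x * (2 * (b \<bullet> (x - z)) / ((norm (x - z))\<^sup>2 + (e n)\<^sup>2)))
      \<longlonglongrightarrow> (LINT x|lebesgue. indicator \<Omega> x * (2 * (b \<bullet> (x - z)) / (norm (x - z))\<^sup>2))"
  proof (rule integral_dominated_convergence)
    show "integrable lebesgue (\<lambda>x. 2 * norm b * (indicator \<Omega> x / norm (x - z)))"
      by (intro integrable_mult_right integrable_inverse_norm \<Omega>m \<Omega>)
    show "(\<lambda>x. indicator \<Omega> x * (2 * (b \<bullet> (x - z)) / ((norm (x - z))\<^sup>2 + (e n)\<^sup>2))) \<in> borel_measurable lebesgue" for n
      by (intro borel_measurable_times borel_measurable_indicator \<Omega>m continuous_imp_lebesgue_measurable[OF cont])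
    show "(\<lambda>x. indicator \<Omega> x * (2 * (b \<bullet> (x - z)) / (norm (x - z))\<^sup>2)) \<in> borel_measurable lebesgue"
      by (intro borel_measurable_times borel_measurable_indicator \<Omega>m meas0)
    show "AE x in lebesgue. (\<lambda>n. indicator \<Omega> x * (2 * (b \<bullet> (x - z)) / ((norm (x - z))\<^sup>2 + (e n)\<^sup>2)))
        \<longlonglongrightarrow> indicator \<Omega> x * (2 * (b \<bullet> (x - z)) / (norm (x - z))\<^sup>2)"
    proof (rule AE_I2)
      fix x
      show "(\<lambda>n. indicator \<Omega> x * (2 * (b \<bullet> (x - z)) / ((norm (x - z))\<^sup>2 + (e n)\<^sup>2)))
        \<longlonglongrightarrow> indicator \<Omega> x * (2 * (b \<bullet> (x - z)) / (norm (x - z))\<^sup>2)"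
      proof (cases "x = z")
        case False
        then have "(\<lambda>n. indicator \<Omega> x * (2 * (b \<bullet> (x - z)) / ((norm (x - z))\<^sup>2 + (e n)\<^sup>2)))
          \<longlonglongrightarrow> indicator \<Omega> x * (2 * (b \<bullet> (x - z)) / ((norm (x - z))\<^sup>2 + 0))"
          by (intro tendsto_intros e_lim) auto
        then show ?thesis by simp
      qed simp
    qed
    show "AE x in lebesgue. norm (indicator \<Omega> x * (2 * (b \<bullet> (x - z)) / ((norm (x - z))\<^sup>2 + (e n)\<^sup>2)))
        \<le> 2 * norm b * (indicator \<Omega> x / norm (x - z))" for n
    proof (rule AE_I2)
      fix x
      show "norm (indicator \<Omega> x * (2 * (b \<bullet> (x - z)) / ((norm (x - z))\<^sup>2 + (e n)\<^sup>2)))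
          \<le> 2 * norm b * (indicator \<Omega> x / norm (x - z))"
      proof (cases "x = z")
        case False
        define w where "w = norm (x - z)"
        have w: "w > 0" using False by (simp add: w_def)
        have "\<bar>b \<bullet> (x - z)\<bar> \<le> norm b * w" unfolding w_def by (rule Cauchy_Schwarz_ineq2)
        then have "\<bar>2 * (b \<bullet> (x - z))\<bar> / (w\<^sup>2 + (e n)\<^sup>2) \<le> (2 * (norm b * w)) / w\<^sup>2"
          using w by (intro frac_le) auto
        also have "\<dots> = 2 * norm b * (1 / w)" using w by (simp add: power2_eq_square)
        finally have "\<bar>2 * (b \<bullet> (x - z)) / (w\<^sup>2 + (e n)\<^sup>2)\<bar> \<le> 2 * norm b * (1 / w)"
          by (simp add: abs_divide add_nonneg_nonneg)
        then show ?thesis unfolding w_def[symmetric] by (cases "x \<in> \<Omega>") auto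
      qed simp
    qed
  qed
  note lim_rhs = tendsto_mult[OF tendsto_const[of c] this]
  have smoothed: "4 * (LINT x|lebesgue. h x * approx_delta (e n) z x)
      = c * (LINT x|lebesgue. indicator \<Omega> x * (2 * (b \<bullet> (x - z)) / ((norm (x - z))\<^sup>2 + (e n)\<^sup>2)))" for n
    by (rule smoothed_identity[OF h_meas h_int h_far R0 M \<Omega>m \<Omega>(2) e(1) weak])
  have "(\<lambda>n. 4 * (LINT x|lebesgue. h x * approx_delta (e n) z x))
      \<longlonglongrightarrow> c * (LINT x|lebesgue. indicator \<Omega> x * (2 * (b \<bullet> (x - z)) / (norm (x - z))\<^sup>2))"
    unfolding smoothed by (rule lim_rhs)
  with lhs have "4 * delta_mass * C = c * (LINT x|lebesgue. indicator \<Omega> x * (2 * (b \<bullet> (x - z)) / (norm (x - z))\<^sup>2))"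
    by (rule LIMSEQ_unique)
  then show ?thesis by (simp only: C_def)
qed

section \<open>Domains bounded by a quadric\<close>

lemma unbounded_connected_meets_frontier:
  fixes S :: "'a::euclidean_space set"
  assumes "bounded S" "connected L" "x \<in> L" "x \<in> S" "\<not> bounded L"
  obtains y where "y \<in> L" "y \<in> frontier S"
proof -
  have "L - S \<noteq> {}" using assms(1,5) bounded_subset by blast
  moreover have "L \<inter> S \<noteq> {}" using assms(3,4) by blast
  ultimately have "L \<inter> frontier S \<noteq> {}"
    using connected_Int_frontier[OF assms(2)] by blast
  then show ?thesis using that by blast
qed

lemma unbounded_line:
  fixes v :: "'a::real_normed_vector"
  assumes "v \<noteq> 0"
  shows "\<not> bounded ((\<lambda>t. x + t *\<^sub>R v) ` {1..})"
proof
  assume "bounded ((\<lambda>t. x + t *\<^sub>R v) ` {1..})"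
  then obtain B where B: "\<And>t. t \<ge> 1 \<Longrightarrow> norm (x + t *\<^sub>R v) \<le> B"
    by (auto simp: bounded_iff)
  define t where "t = 1 + (\<bar>B\<bar> + norm x) / norm v"
  have nv: "norm v > 0" using assms by simp
  have t1: "t \<ge> 1" unfolding t_def by simp
  have "norm (t *\<^sub>R v) \<le> norm (x + t *\<^sub>R v) + norm x"
    using norm_triangle_ineq4[of "x + t *\<^sub>R v" x] by simp
  then have "t * norm v \<le> B + norm x" using B[OF t1] t1 by simp
  moreover have "t * norm v = norm v + (\<bar>B\<bar> + norm x)"
    unfolding t_def using nv by (simp add: field_simps)
  ultimately show False using nv by linarith
qed

text \<open>\<open>N z = (norm (T z + q))^2\<close> is a quadratic function, definite unless
  \<open>norm p = 1\<close>. Half-lines starting in the bounded set \<open>S\<close> must hit its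
  frontier, which yields \<open>N < \<gamma>\<close> on \<open>S\<close>; segments from
  \<open>S\<close> to a point outside must hit it too, which yields the reverse inclusion.\<close>

lemma frontier_in_quadric_imp_ellipse:
  fixes S :: "complex set"
  assumes S: "open S" "bounded S" "S \<noteq> {}"
    and front: "\<And>z. z \<in> frontier S \<Longrightarrow> (norm (cnj z + p * z + q))\<^sup>2 = \<gamma>"
  obtains z0 e \<alpha> \<beta> where "norm e = 1" "\<alpha> > 0" "\<beta> > 0"
    "S = {z. (Re ((z - z0) * cnj e) / \<alpha>)\<^sup>2 + (Im ((z - z0) * cnj e) / \<beta>)\<^sup>2 < 1}"
proof -
  define T where "T z = cnj z + p * z" for z
  define P where "P = norm p"
  \<comment> \<open>\<open>u\<close> has half the argument of \<open>p\<close>. Rotating by it makes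
    the coefficient real and diagonalises \<open>T\<close>.\<close>
  obtain u where u: "norm u = 1" "p = of_real P * u\<^sup>2"
  proof (cases "p = 0")
    case True
    then show ?thesis using that[of 1] by (simp add: P_def)
  next
    case False
    have "norm (csqrt (sgn p)) = 1" using False by (simp add: norm_sgn)
    moreover have "p = of_real P * (csqrt (sgn p))\<^sup>2"
      unfolding P_def by (simp add: complex_sgn_def scaleR_conv_of_real divide_inverse False)
    ultimately show ?thesis by (rule that)
  qed
  \<comment> \<open>In the coordinate \<open>w\<close> with \<open>z = cnj u * w\<close> the map \<open>T\<close> is diagonal, with factors \<open>1 + P\<close> and \<open>P - 1\<close>.\<close>
  define e where "e = cnj u"
  have uu: "u * cnj u = 1" using u(1) by (simp add: complex_norm_square[symmetric])
  have e1: "norm e = 1" "e * cnj e = 1" using u(1) uu by (simp_all add: e_def mult.commute)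
  have T_add: "T (x + y) = T x + T y" and T_diff: "T (x - y) = T x - T y" and T_scale: "T (of_real t * x) = of_real t * T x" for x y t
    by (simp_all add: T_def algebra_simps)
  have T_e: "T (e * w) = u * Complex ((1 + P) * Re w) ((P - 1) * Im w)" for w
  proof -
    have "T (e * w) = u * cnj w + of_real P * (u * (u * cnj u)) * w"
      unfolding T_def e_def u(2) by (simp add: power2_eq_square mult_ac)
    also have "\<dots> = u * (cnj w + of_real P * w)" unfolding uu by (simp add: algebra_simps)
    also have "cnj w + of_real P * w = Complex ((1 + P) * Re w) ((P - 1) * Im w)"
      by (simp add: complex_eq_iff algebra_simps)
    finally show ?thesis .
  qed
  have normT: "(norm (T z))\<^sup>2 = ((1 + P) * Re (z * cnj e))\<^sup>2 + ((1 - P) * Im (z * cnj e))\<^sup>2" for z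
  proof -
    have "e * (z * cnj e) = z * (e * cnj e)" by (rule mult.left_commute)
    then have "e * (z * cnj e) = z" unfolding e1(2) by simp
    then have "T z = u * Complex ((1 + P) * Re (z * cnj e)) ((P - 1) * Im (z * cnj e))"
      using T_e[of "z * cnj e"] by (simp only:)
    then have "(norm (T z))\<^sup>2 = ((1 + P) * Re (z * cnj e))\<^sup>2 + ((P - 1) * Im (z * cnj e))\<^sup>2"
      using u(1) by (simp add: norm_mult cmod_power2)
    then show ?thesis by (simp add: power_mult_distrib power2_commute[of P 1])
  qed
  have P0: "P \<ge> 0" by (simp add: P_def)
  define N where "N z = (norm (T z + q))\<^sup>2" for z
  have front: "N y = \<gamma>" if "y \<in> frontier S" for y
    using front[OF that] by (simp add: N_def T_def)
  obtain x where x: "x \<in> S" using S(3) by blast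
  \<comment> \<open>For \<open>P = 1\<close> the direction \<open>\<i> * e\<close> lies in the
    kernel of \<open>T\<close>. Moving along it from any point of \<open>S\<close> reaches the
    frontier without changing \<open>N\<close>, so \<open>N\<close> would be constant on an open
    set.\<close>
  have "P \<noteq> 1"
  proof
    assume P1: "P = 1"
    have const: "N x = \<gamma>" if xS: "x \<in> S" for x
    proof -
      define L where "L = (\<lambda>t. (x - \<i> * e) + t *\<^sub>R (\<i> * e)) ` {1..}"
      have ie: "\<i> * e \<noteq> 0" using e1(1) by auto
      have "connected L" unfolding L_def
        by (intro connected_continuous_image continuous_intros) auto
      have "x \<in> L" unfolding L_def by (rule image_eqI[of _ _ 1]) auto
      have "\<not> bounded L" unfolding L_def by (rule unbounded_line[OF ie])
      obtain y where y: "y \<in> L" "y \<in> frontier S"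
        by (rule unbounded_connected_meets_frontier[OF S(2) \<open>connected L\<close> \<open>x \<in> L\<close> xS \<open>\<not> bounded L\<close> that])
      obtain t where "y = (x - \<i> * e) + t *\<^sub>R (\<i> * e)"
        using y(1) unfolding L_def by (rule imageE)
      then have "y = x + e * Complex 0 (t - 1)"
        by (simp add: scaleR_conv_of_real complex_eq_iff algebra_simps)
      then have "T y = T x" by (simp add: T_add T_e P1 flip: zero_complex.code)
      then show ?thesis using front[OF y(2)] by (simp add: N_def)
    qed
    obtain r where r: "r > 0" "ball x r \<subseteq> S" using S(1) x by (auto simp: open_contains_ball)
    define v where "v = e * of_real (r / 2)"
    have nv: "norm v = r / 2" using r(1) e1(1) by (simp add: v_def norm_mult)
    have "x + v \<in> S" "x - v \<in> S"
      using r nv by (auto simp: subset_iff dist_norm)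
    then have "N (x + v) = \<gamma>" "N (x - v) = \<gamma>" "N x = \<gamma>" using const x by auto
    \<comment> \<open>The parallelogram law, which turns constancy of \<open>N\<close> at
      \<open>x\<close>, \<open>x + v\<close> and \<open>x - v\<close> into \<open>T v = 0\<close>.
      But \<open>v\<close> points along \<open>e\<close>, where \<open>T\<close> stretches by the
      factor \<open>1 + P\<close>.\<close>
    moreover have "N (x + v) + N (x - v) = 2 * N x + 2 * (norm (T v))\<^sup>2"
    proof -
      have "(norm (L + w))\<^sup>2 + (norm (L - w))\<^sup>2 = 2 * (norm L)\<^sup>2 + 2 * (norm w)\<^sup>2" for L w :: complex
        unfolding cmod_power2 by (simp add: power2_eq_square algebra_simps)
      from this[of "T x + q" "T v"] show ?thesis
        by (simp add: N_def T_add T_diff add_ac add_diff_eq diff_add_eq)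
    qed
    ultimately have "T v = 0" by simp
    moreover have "T v = u * of_real (1 + P) * of_real (r / 2)"
      unfolding v_def T_e by (simp add: complex_eq_iff)
    ultimately show False using u(1) r(1) P1 by auto
  qed
  have T_inj: "y = 0" if "T y = 0" for y
  proof -
    have "((1 + P) * Re (y * cnj e))\<^sup>2 + ((1 - P) * Im (y * cnj e))\<^sup>2 = 0"
      using normT[of y] that by simp
    then have "(1 + P) * Re (y * cnj e) = 0" "(1 - P) * Im (y * cnj e) = 0"
      by (simp_all add: sum_power2_eq_zero_iff)
    then have "y * cnj e = 0" using P0 \<open>P \<noteq> 1\<close> by (simp add: complex_eq_iff)
    then show ?thesis using e1(1) by auto
  qed
  \<comment> \<open>The centre is the solution of \<open>T z0 = - q\<close>, obtained by eliminating
    \<open>cnj z0\<close> between this equation and its conjugate.\<close>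
  define z0 where "z0 = (cnj p * q - cnj q) / of_real (1 - P\<^sup>2)"
  have P2: "1 - P\<^sup>2 \<noteq> 0" using P0 \<open>P \<noteq> 1\<close> by (simp add: power2_eq_1_iff)
  have Tz0: "T z0 = - q"
  proof -
    have "T z0 = (p * cnj q - q + p * (cnj p * q - cnj q)) / of_real (1 - P\<^sup>2)"
      unfolding T_def z0_def by (simp add: add_divide_distrib)
    also have "p * cnj q - q + p * (cnj p * q - cnj q) = (p * cnj p - 1) * q"
      by (simp add: algebra_simps)
    also have "p * cnj p = of_real (P\<^sup>2)"
      unfolding P_def by (rule complex_norm_square[symmetric])
    also have "(of_real (P\<^sup>2) - 1) * q / of_real (1 - P\<^sup>2) = - q"
    proof -
      define k where "k = complex_of_real (1 - P\<^sup>2)"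
      have "k \<noteq> 0" using P2 unfolding k_def of_real_eq_0_iff .
      moreover have "of_real (P\<^sup>2) - 1 = - k" by (simp add: k_def)
      ultimately show ?thesis unfolding k_def[symmetric] by simp
    qed
    finally show ?thesis .
  qed
  have N: "N z = (norm (T (z - z0)))\<^sup>2" for z
    by (simp add: N_def T_diff Tz0)
  have N_scale: "N (z0 + of_real t * y) = t\<^sup>2 * (norm (T y))\<^sup>2" for t y
    by (simp add: N T_scale norm_mult power_mult_distrib)
  have N_le: "N x \<le> \<gamma>" if x: "x \<in> S" for x
  proof (rule ccontr)
    assume "\<not> N x \<le> \<gamma>"
    have "frontier S \<noteq> {}"
      using S(2,3) frontier_eq_empty[of S] not_bounded_UNIV by blast
    then obtain y0 where "y0 \<in> frontier S" by blast
    then have "\<gamma> \<ge> 0" using front[of y0] by (auto simp: N_def)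
    have xz: "x - z0 \<noteq> 0"
    proof
      assume "x - z0 = 0"
      then have "N x = 0" by (simp add: N T_def)
      then show False using \<open>\<not> N x \<le> \<gamma>\<close> \<open>\<gamma> \<ge> 0\<close> by simp
    qed
    \<comment> \<open>The half-line from \<open>x\<close> directly away from \<open>z0\<close>, on
      which \<open>N\<close> grows like \<open>t\<^sup>2\<close>. Where it meets the frontier,
      \<open>N\<close> is at least \<open>N x\<close>.\<close>
    define L where "L = (\<lambda>t. z0 + t *\<^sub>R (x - z0)) ` {1..}"
    have "connected L" unfolding L_def
      by (intro connected_continuous_image continuous_intros) auto
    have "x \<in> L" unfolding L_def by (rule image_eqI[of _ _ 1]) auto
    have "\<not> bounded L" unfolding L_def by (rule unbounded_line[OF xz])
    obtain y where y: "y \<in> L" "y \<in> frontier S"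
      by (rule unbounded_connected_meets_frontier[OF S(2) \<open>connected L\<close> \<open>x \<in> L\<close> x \<open>\<not> bounded L\<close> that])
    obtain t where t: "y = z0 + t *\<^sub>R (x - z0)" "t \<in> {1..}"
      using y(1) unfolding L_def by (rule imageE)
    have "N x = (norm (T (x - z0)))\<^sup>2" by (rule N)
    also have "\<dots> \<le> t\<^sup>2 * (norm (T (x - z0)))\<^sup>2"
      using t(2) mult_right_mono[of 1 "t\<^sup>2" "(norm (T (x - z0)))\<^sup>2"] by (simp add: one_le_power)
    also have "\<dots> = N y" unfolding t(1) scaleR_conv_of_real by (rule N_scale[symmetric])
    also have "\<dots> = \<gamma>" by (rule front[OF y(2)])
    finally show False using \<open>\<not> N x \<le> \<gamma>\<close> by simp
  qed
  have N_less: "N x < \<gamma>" if x: "x \<in> S" for x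
  proof (rule ccontr)
    assume "\<not> N x < \<gamma>"
    with N_le[OF x] have Nx: "N x = \<gamma>" by simp
    obtain r where r: "r > 0" "ball x r \<subseteq> S" using S(1) x by (auto simp: open_contains_ball)
    show False
    proof (cases "x = z0")
      case True
      then have "\<gamma> = 0" using Nx by (simp add: N T_def)
      have "x + of_real (r / 2) \<in> S" using r by (auto simp: subset_iff dist_norm)
      then have "N (z0 + of_real (r / 2) * 1) \<le> 0" using N_le \<open>\<gamma> = 0\<close> True by fastforce
      moreover have "norm (T 1) > 0" using T_inj[of 1] by auto
      ultimately show False using r(1) unfolding N_scale by (simp add: mult_le_0_iff)
    next
      case False
      then have nx: "norm (x - z0) > 0" by simp
      \<comment> \<open>A step outwards by \<open>r / 2\<close>: it stays in the ball inside
        \<open>S\<close> but increases \<open>N\<close> strictly, against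
        \<open>N_le\<close>.\<close>
      define \<delta> where "\<delta> = r / (2 * norm (x - z0))"
      have \<delta>: "\<delta> > 0" using r(1) nx by (simp add: \<delta>_def)
      have "z0 + of_real (1 + \<delta>) * (x - z0) \<in> ball x r"
      proof -
        have "x - (z0 + of_real (1 + \<delta>) * (x - z0)) = - (of_real \<delta> * (x - z0))"
          by (simp add: algebra_simps)
        then have "dist x (z0 + of_real (1 + \<delta>) * (x - z0)) = \<delta> * norm (x - z0)"
          using \<delta> by (simp add: dist_norm norm_mult)
        also have "\<dots> = r / 2" using nx by (simp add: \<delta>_def)
        finally show ?thesis using r(1) by simp
      qed
      then have "N (z0 + of_real (1 + \<delta>) * (x - z0)) \<le> N x" using r(2) N_le Nx by auto
      then have "(1 + \<delta>)\<^sup>2 * (norm (T (x - z0)))\<^sup>2 \<le> (norm (T (x - z0)))\<^sup>2"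
        unfolding N_scale unfolding N .
      moreover have "(norm (T (x - z0)))\<^sup>2 > 0" using T_inj[of "x - z0"] False by auto
      moreover have "1 < (1 + \<delta>)\<^sup>2" using \<delta> by (simp add: one_less_power)
      ultimately show False by (simp add: mult_le_cancel_right1)
    qed
  qed
  have \<gamma>: "\<gamma> > 0"
    using N_less[OF x] zero_le_power2[of "norm (T x + q)"] unfolding N_def by linarith
  \<comment> \<open>Sublevel sets of \<open>N\<close> are convex, so a segment joining two points
    with \<open>N < \<gamma>\<close> cannot meet the frontier, where
    \<open>N = \<gamma>\<close>.\<close>
  have "y \<in> S" if y: "N y < \<gamma>" for y
  proof (rule ccontr)
    assume "y \<notin> S"
    have "closed_segment x y \<inter> frontier S \<noteq> {}"
    proof (rule connected_Int_frontier)
      show "connected (closed_segment x y)" by simp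
      show "closed_segment x y \<inter> S \<noteq> {}" using x ends_in_segment(1)[of x y] by (auto simp del: ends_in_segment)
      show "closed_segment x y - S \<noteq> {}" using \<open>y \<notin> S\<close> ends_in_segment(2)[where a = x and b = y] by (auto simp del: ends_in_segment)
    qed
    then obtain w where w: "w \<in> closed_segment x y" "w \<in> frontier S" by blast
    then obtain t where t: "0 \<le> t" "t \<le> 1" "w = (1 - t) *\<^sub>R x + t *\<^sub>R y"
      by (auto simp: closed_segment_def)
    have sq: "norm (T v + q) < sqrt \<gamma>" if "N v < \<gamma>" for v
      using that unfolding N_def by (rule real_less_rsqrt)
    have "T w + q = (1 - t) *\<^sub>R (T x + q) + t *\<^sub>R (T y + q)"
      unfolding t(3) T_add scaleR_conv_of_real T_scale by (simp add: algebra_simps)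
    then have "norm (T w + q) \<le> (1 - t) * norm (T x + q) + t * norm (T y + q)"
      using t(1,2) norm_triangle_ineq[of "(1 - t) *\<^sub>R (T x + q)" "t *\<^sub>R (T y + q)"] by simp
    also have "\<dots> < sqrt \<gamma>"
      using sq[OF N_less[OF x]] sq[OF y] t(1,2) by (intro convex_bound_lt) auto
    finally have "N w < (sqrt \<gamma>)\<^sup>2" unfolding N_def by (intro power_strict_mono) auto
    then show False using front[OF w(2)] \<gamma> by simp
  qed
  then have S_eq: "S = {z. N z < \<gamma>}" using N_less by auto
  \<comment> \<open>The semi-axes come from the two stretching factors of \<open>T\<close>.
    \<open>P\<close> may lie on either side of 1, hence the absolute value.\<close>
  define \<alpha> \<beta> where "\<alpha> = sqrt \<gamma> / (1 + P)" and "\<beta> = sqrt \<gamma> / \<bar>1 - P\<bar>"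
  have "N z < \<gamma> \<longleftrightarrow> (Re ((z - z0) * cnj e) / \<alpha>)\<^sup>2 + (Im ((z - z0) * cnj e) / \<beta>)\<^sup>2 < 1" for z
  proof -
    have "(Re ((z - z0) * cnj e) / \<alpha>)\<^sup>2 + (Im ((z - z0) * cnj e) / \<beta>)\<^sup>2 = N z / \<gamma>"
      unfolding N normT \<alpha>_def \<beta>_def using \<gamma>
      by (simp add: power_divide power_mult_distrib add_divide_distrib mult.commute)
    then show ?thesis using \<gamma> by simp
  qed
  then have "S = {z. (Re ((z - z0) * cnj e) / \<alpha>)\<^sup>2 + (Im ((z - z0) * cnj e) / \<beta>)\<^sup>2 < 1}"
    using S_eq by simp
  moreover have "\<alpha> > 0" "\<beta> > 0" using \<gamma> P0 \<open>P \<noteq> 1\<close> by (simp_all add: \<alpha>_def \<beta>_def add_pos_nonneg)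
  ultimately show ?thesis using that[OF e1(1)] by blast
qed

section \<open>Eshelby uniformity in the plane\<close>

lemma to_complex_inner: "v \<bullet> x = Re (cnj (to_complex v) * to_complex x)"
  by (simp add: to_complex_def inner_vec_def sum_2)

lemma bij_to_complex: "bij to_complex"
  by (rule o_bij[of of_complex]) (simp_all add: fun_eq_iff)

lemma closure_to_complex_image: "closure (to_complex ` A) = to_complex ` closure A"
  by (rule closure_injective_linear_image[OF linear_to_complex, symmetric])
    (rule bij_is_inj[OF bij_to_complex])

lemma open_to_complex_image: "open A \<Longrightarrow> open (to_complex ` A)"
  by (rule open_surjective_linear_image[OF _ linear_to_complex bij_is_surj[OF bij_to_complex]])

lemma Compl_to_complex_image: "- (to_complex ` A) = to_complex ` (- A)"
  by (rule bij_image_Compl_eq[OF bij_to_complex, symmetric])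

text \<open>For complex numbers \<open>v\<close> and \<open>w\<close> the real part of
  \<open>v / w\<close> is that of \<open>v * cnj w\<close> divided by
  \<open>(norm w)\<^sup>2\<close>, that is, an inner product over a squared norm. The sign comes
  from writing \<open>x - z\<close> on one side and \<open>z - x\<close> on the other.\<close>

lemma integral_kernel_eq_cauchy_transform:
  assumes \<Omega>: "\<Omega> \<in> sets lebesgue" "bounded \<Omega>"
  shows "(LINT x|lebesgue. indicator \<Omega> x * (2 * (b \<bullet> (x - z)) / (norm (x - z))\<^sup>2))
    = - 2 * Re (to_complex b * cauchy_transform \<Omega> (to_complex z))"
proof -
  have pt: "indicator \<Omega> x * (2 * (b \<bullet> (x - z)) / (norm (x - z))\<^sup>2)
      = - 2 * Re (to_complex b * (indicator \<Omega> x *\<^sub>R (1 / (to_complex z - to_complex x))))" for x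
  proof -
    have n: "(norm (x - z))\<^sup>2 = (x $ 1 - z $ 1)\<^sup>2 + (x $ 2 - z $ 2)\<^sup>2"
      unfolding power2_norm_eq_inner by (simp add: inner_vec_def sum_2 power2_eq_square)
    have "Re (to_complex b * (1 / (to_complex z - to_complex x)))
        = (b $ 1 * (z $ 1 - x $ 1) + b $ 2 * (z $ 2 - x $ 2)) / ((z $ 1 - x $ 1)\<^sup>2 + (z $ 2 - x $ 2)\<^sup>2)"
      by (simp add: to_complex_def Re_divide)
    also have "\<dots> = - ((b \<bullet> (x - z)) / (norm (x - z))\<^sup>2)"
      unfolding n power2_commute[of "z $ 1"] power2_commute[of "z $ 2"] minus_divide_left
      by (rule arg_cong[of _ _ "\<lambda>t. t / _"]) (simp add: inner_vec_def sum_2 algebra_simps)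
    finally show ?thesis by (cases "x \<in> \<Omega>") auto
  qed
  have "(LINT x|lebesgue. Re (to_complex b * (indicator \<Omega> x *\<^sub>R (1 / (to_complex z - to_complex x)))))
      = Re (to_complex b * cauchy_transform \<Omega> (to_complex z))"
    unfolding cauchy_transform_def integral_mult_right_zero[symmetric]
    by (intro integral_Re integrable_mult_right integrable_kernel \<Omega>)
  then show ?thesis unfolding pt integral_mult_right_zero by simp
qed

text \<open>The difference of the two sides has real part 0; multiplied by \<open>\<i>\<close> it
  has imaginary part 0 and is therefore constant.\<close>

lemma holomorphic_Re_affine:
  assumes hol: "g holomorphic_on S" and S: "open S" "connected S"
    and Re: "\<And>w. w \<in> S \<Longrightarrow> Re (g w) = Re (\<nu> * w) + \<kappa>"
  obtains q where "\<And>w. w \<in> S \<Longrightarrow> g w = \<nu> * w + q"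
proof -
  have "(\<lambda>w. \<i> * (g w - \<nu> * w - of_real \<kappa>)) constant_on S"
  proof (rule holomorphic_Im_eq_0_imp_constant[OF _ S])
    show "(\<lambda>w. \<i> * (g w - \<nu> * w - of_real \<kappa>)) holomorphic_on S"
      by (intro holomorphic_intros hol)
    show "Im (\<i> * (g w - \<nu> * w - of_real \<kappa>)) = 0" if "w \<in> S" for w
      using Re[OF that] by simp
  qed
  then obtain k where k: "\<And>w. w \<in> S \<Longrightarrow> \<i> * (g w - \<nu> * w - of_real \<kappa>) = k"
    by (auto simp: constant_on_def)
  have "g w = \<nu> * w + (of_real \<kappa> - \<i> * k)" if "w \<in> S" for w
    using k[OF that] by (simp add: complex_eq_iff)
  then show ?thesis by (rule that)
qed

theorem theorem1p7:
  fixes k :: real and \<Omega> :: "(real^2) set" and a :: "real^2" and u :: "real^2 \<Rightarrow> real"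
  assumes "k > 0" and "k \<noteq> 1"
    and "bounded_lipschitz_domain \<Omega>" and "simply_connected \<Omega>"
    and "a \<noteq> 0"
    and "weak_solution (\<lambda>x. 1 + (k - 1) * indicator \<Omega> x) u"
    and "far_field a u"
    and "linear_in \<Omega> u"
  shows "is_ellipse \<Omega>"
proof -
  have \<Omega>: "\<Omega> \<noteq> {}" "open \<Omega>" "connected \<Omega>" "bounded \<Omega>"
    using assms(3) by (simp_all add: bounded_lipschitz_domain_def)
  have \<Omega>m: "\<Omega> \<in> sets lebesgue" using \<Omega>(2) by auto
  obtain b c where u_affine: "AE x in lebesgue. x \<in> \<Omega> \<longrightarrow> u x = b \<bullet> x + c"
    using assms(8) by (auto simp: linear_in_def)
  obtain G where "H1_loc_with_gradient u G"
    using assms(6) by (auto simp: weak_solution_def)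
  then have L2u: "L2_loc u" by (simp add: H1_loc_with_gradient_def)
  obtain v where v: "AE x in lebesgue. u x = v x" "(\<lambda>x. v x - a \<bullet> x) \<in> O[at_infinity](\<lambda>x. 1 / norm x)"
    using assms(7) by (auto simp: far_field_def)
  define h where "h x = u x - a \<bullet> x" for x
  have L2a: "L2_loc (\<lambda>x. a \<bullet> x)" by (intro L2_loc_continuous continuous_intros)
  have h_meas: "h \<in> borel_measurable lebesgue"
    using L2u L2a unfolding h_def L2_loc_def by (intro borel_measurable_diff) simp_all
  have h_int: "integrable lebesgue (\<lambda>x. indicator K x * h x)" if "compact K" for K
    using Bochner_Integration.integrable_diff[OF L2_loc_integrable[OF L2u that] L2_loc_integrable[OF L2a that]]
    by (simp add: h_def right_diff_distrib)
  obtain M where M: "M > 0" "\<forall>\<^sub>F x in at_infinity. norm (v x - a \<bullet> x) \<le> M * norm (1 / norm x)"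
    using v(2) by (rule landau_o.bigE)
  then obtain B where B: "\<And>x. norm x \<ge> B \<Longrightarrow> norm (v x - a \<bullet> x) \<le> M * norm (1 / norm x)"
    by (auto simp: eventually_at_infinity)
  define R0 where "R0 = max B 1"
  have R0: "R0 > 0" "R0 \<ge> B" by (simp_all add: R0_def)
  \<comment> \<open>The pointwise decay holds for the representative \<open>v\<close>; for
    \<open>u\<close> it survives almost everywhere.\<close>
  have h_far: "AE x in lebesgue. R0 \<le> norm x \<longrightarrow> \<bar>h x\<bar> \<le> M / norm x"
    using v(1)
  proof eventually_elim
    case (elim x)
    show ?case using B[of x] R0(2) by (auto simp: h_def elim)
  qed
  define d where "d = b - a"
  have h_affine: "AE x in lebesgue. x \<in> \<Omega> \<longrightarrow> h x = d \<bullet> x + c"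
    using u_affine by eventually_elim (simp add: h_def d_def inner_diff_left)
  have weak: "(LINT x|lebesgue. h x * laplacian \<phi> x)
      = (k - 1) * (LINT x|lebesgue. indicator \<Omega> x * (b \<bullet> gradient \<phi> x))" if "test_function \<phi>" for \<phi>
    using transmission_weak_identity[OF assms(6) \<Omega>(2) u_affine that] by (simp add: h_def)
  have M0: "M \<ge> 0" using M(1) by simp
  define \<beta> where "\<beta> = to_complex b"
  have id: "4 * delta_mass * (d \<bullet> z + c) = (k - 1) * (- 2 * Re (\<beta> * cauchy_transform \<Omega> (to_complex z)))" if "z \<in> \<Omega>" for z
    using pointwise_identity[OF h_meas h_int h_far R0(1) M0 \<Omega>(2,4) weak h_affine that]
    unfolding integral_kernel_eq_cauchy_transform[OF \<Omega>m \<Omega>(4)] \<beta>_def .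
  \<comment> \<open>If \<open>b = 0\<close>, the right side of \<open>id\<close> vanishes and
    \<open>d = - a\<close>, so \<open>a \<bullet> z\<close> would be constant on the open set
    \<Omega>. A short step along \<open>a\<close> contradicts this.\<close>
  have "\<beta> \<noteq> 0"
  proof
    assume "\<beta> = 0"
    then have "norm b = 0" using norm_to_complex[of b] by (simp add: \<beta>_def)
    then have d: "d = - a" by (simp add: d_def)
    have zero: "d \<bullet> z + c = 0" if "z \<in> \<Omega>" for z
      using id[OF that] delta_mass_pos \<open>\<beta> = 0\<close> by simp
    obtain z where z: "z \<in> \<Omega>" using \<Omega>(1) by blast
    obtain r where r: "r > 0" "ball z r \<subseteq> \<Omega>" using \<Omega>(2) z by (auto simp: open_contains_ball)
    define t where "t = r / (2 * norm a)"
    have t: "t > 0" "t * norm a < r" using r(1) assms(5) by (simp_all add: t_def)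
    then have "z + t *\<^sub>R a \<in> ball z r" by (simp add: dist_norm)
    then have "z + t *\<^sub>R a \<in> \<Omega>" using r(2) by blast
    from zero[OF this] zero[OF z] have "t * (a \<bullet> a) = 0"
      by (simp add: d inner_add_right)
    then show False using t(1) assms(5) by simp
  qed
  define S where "S = to_complex ` \<Omega>"
  have S: "open S" "connected S" "bounded S" "S \<noteq> {}"
  proof -
    show "open S" unfolding S_def by (rule open_to_complex_image[OF \<Omega>(2)])
    show "connected S" unfolding S_def
      by (intro connected_continuous_image continuous_intros \<Omega>)
    show "bounded S" using \<Omega>(4) unfolding S_def bounded_iff by auto
  qed (use \<Omega>(1) in \<open>simp add: S_def\<close>)
  define H where "H w = cauchy_transform \<Omega> w - of_real pi * cnj w" for w
  have holH: "H holomorphic_on S"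
    unfolding H_def S_def by (rule cauchy_transform_interior[OF \<Omega>(2,4)])
  \<comment> \<open>The factor obtained on solving \<open>id\<close> for the real part of \<beta>
    times the transform.\<close>
  define \<mu> where "\<mu> = - 2 * delta_mass / (k - 1)"
  \<comment> \<open>The first term is the linear part \<open>d\<close> as a complex multiplier; the
    second arises since subtracting \<open>of_real pi * cnj w\<close> and multiplying by \<beta> has
    the same real part as \<open>- of_real pi * cnj \<beta> * w\<close>.\<close>
  define \<nu> where "\<nu> = of_real \<mu> * cnj (to_complex d) - of_real pi * cnj \<beta>"
  have ReH: "Re (\<beta> * H w) = Re (\<nu> * w) + \<mu> * c" if wS: "w \<in> S" for w
  proof -
    obtain z where z: "z \<in> \<Omega>" "w = to_complex z" using wS by (auto simp: S_def)
    have "Re (\<beta> * cauchy_transform \<Omega> w) = \<mu> * (d \<bullet> z + c)"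
      using id[OF z(1)] assms(2) unfolding z(2)[symmetric] by (simp add: \<mu>_def field_simps)
    moreover have "d \<bullet> z = Re (cnj (to_complex d) * w)" unfolding z(2) by (rule to_complex_inner)
    moreover have "Re (\<beta> * (of_real pi * cnj w)) = Re (of_real pi * cnj \<beta> * w)"
      by (simp add: algebra_simps)
    ultimately show ?thesis
      unfolding H_def \<nu>_def right_diff_distrib left_diff_distrib minus_complex.sel mult.assoc
      by (simp add: algebra_simps)
  qed
  obtain q0 where q0: "\<And>w. w \<in> S \<Longrightarrow> \<beta> * H w = \<nu> * w + q0"
    by (rule holomorphic_Re_affine[OF _ S(1,2) ReH that]) (intro holomorphic_intros holH, assumption)
  define p where "p = \<nu> / (\<beta> * of_real pi)"
  define q where "q = q0 / (\<beta> * of_real pi)"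
  define C where "C w = cauchy_transform \<Omega> w / of_real pi" for w
  have C: "C w = cnj w + p * w + q" if "w \<in> S" for w
  proof -
    have "cauchy_transform \<Omega> w = of_real pi * cnj w + (\<nu> * w + q0) / \<beta>"
      using q0[OF that] \<open>\<beta> \<noteq> 0\<close> by (simp add: H_def field_simps)
    then show ?thesis
      using \<open>\<beta> \<noteq> 0\<close> by (simp add: C_def p_def q_def field_simps)
  qed
  have sc: "simply_connected S"
  proof -
    have "\<Omega> homeomorphic S"
      unfolding S_def
      by (rule homeomorphicI[of to_complex _ _ of_complex]) (auto intro!: continuous_intros simp: image_image)
    from homeomorphic_simply_connected_eq[OF this] show ?thesis using assms(4) by simp
  qed
  \<comment> \<open>For a bounded open connected set in the plane, simple connectedness means
    exactly this.\<close>
  have "connected (- S)"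
    using simply_connected_iff_simple[OF S(1,3)] sc by simp
  then have "connected (of_complex ` (- S))"
    by (intro connected_continuous_image continuous_intros)
  moreover have "of_complex ` (- S) = - \<Omega>"
    unfolding S_def Compl_to_complex_image image_image of_complex_to_complex by (rule image_ident)
  ultimately have ext: "connected (- closure \<Omega>)" "frontier \<Omega> \<subseteq> closure (- closure \<Omega>)"
    using lipschitz_domain_exterior[OF assms(3)] by simp_all
  have extS: "- closure S = to_complex ` (- closure \<Omega>)"
    unfolding S_def closure_to_complex_image Compl_to_complex_image ..
  have "connected (- closure S)"
    unfolding extS by (intro connected_continuous_image continuous_intros ext)
  note connS = this
  have frontS: "frontier S \<subseteq> closure (- closure S)"
  proof -
    have "frontier S = to_complex ` closure \<Omega> - to_complex ` \<Omega>"
      using S(1) by (simp add: frontier_def interior_open S_def closure_to_complex_image)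
    also have "\<dots> \<subseteq> to_complex ` frontier \<Omega>"
      using \<Omega>(2) by (auto simp: frontier_def interior_open)
    also have "\<dots> \<subseteq> to_complex ` closure (- closure \<Omega>)" using ext(2) by (rule image_mono)
    finally show ?thesis unfolding extS closure_to_complex_image .
  qed
  have contC: "continuous_on UNIV C"
    unfolding C_def by (intro continuous_intros continuous_on_cauchy_transform \<Omega>m \<Omega>) simp
  have holC: "C holomorphic_on - closure S"
    unfolding C_def S_def by (intro holomorphic_intros cauchy_transform_holomorphic \<Omega>m \<Omega>) simp
  obtain R K where decay: "\<And>z. norm z \<ge> R \<Longrightarrow> norm (z * cauchy_transform \<Omega> z) \<le> K"
    by (rule cauchy_transform_decay[OF \<Omega>m \<Omega>(4) that])
  have decayC: "norm (z * C z) \<le> K / pi" if "norm z \<ge> R" for z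
    using decay[OF that] by (simp add: C_def norm_mult norm_divide divide_right_mono)
  obtain \<gamma> where \<gamma>: "\<And>z. z \<in> frontier S \<Longrightarrow> (norm (cnj z + p * z + q))\<^sup>2 = \<gamma>"
    by (rule quadratic_constant_on_frontier[OF S(1,3,4) connS frontS contC holC decayC C that])
  obtain z0 e \<alpha> \<beta>' where ell: "norm e = 1" "\<alpha> > 0" "\<beta>' > 0"
      "S = {z. (Re ((z - z0) * cnj e) / \<alpha>)\<^sup>2 + (Im ((z - z0) * cnj e) / \<beta>')\<^sup>2 < 1}"
    by (rule frontier_in_quadric_imp_ellipse[OF S(1,3,4) \<gamma> that])
  show ?thesis
    unfolding is_ellipse_def
  proof (intro exI conjI)
    \<comment> \<open>The inner product with the vector of \<open>\<i> * e\<close> is the imaginary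
      part of the product with \<open>cnj e\<close>, so the second axis is the quarter turn of the
      first.\<close>
    show "norm (of_complex e) = 1" "norm (of_complex (\<i> * e)) = 1"
      using ell(1) by (simp_all add: norm_mult)
    show "of_complex e \<bullet> of_complex (\<i> * e) = 0" by (simp add: to_complex_inner)
    show "\<alpha> > 0" "\<beta>' > 0" by (fact ell)+
    have "x \<in> \<Omega> \<longleftrightarrow> to_complex x \<in> S" for x
      unfolding S_def by (metis image_iff of_complex_to_complex)
    moreover have "(x - of_complex z0) \<bullet> of_complex e = Re ((to_complex x - z0) * cnj e)"
      "(x - of_complex z0) \<bullet> of_complex (\<i> * e) = Im ((to_complex x - z0) * cnj e)" for x
      by (simp_all add: to_complex_inner to_complex_diff algebra_simps)
    ultimately show "\<Omega> = {x. ((x - of_complex z0) \<bullet> of_complex e / \<alpha>)\<^sup>2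
        + ((x - of_complex z0) \<bullet> of_complex (\<i> * e) / \<beta>')\<^sup>2 < 1}"
      by (auto simp: ell(4))
  qed
qed

end
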